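(* Let $V$ be a complex vector space of dimension $n\ge 2$, let $\mathfrak h\subset V$ be a complex subspace of dimension $n-1$, fix $v_0\in V\setminus\mathfrak h$, and let $\rho_{v_0}$ be the associated immersion of forms on $\mathfrak h$ into forms on $V$, through which $\Lambda^{p,q}_{\mathfrak h}$ is identified with a subspace of $\Lambda^{p,q}V^*$. Fix $\alpha\in\Lambda^{1,0}V^*\setminus\Lambda^{1,0}_{\mathfrak h}$. Let $1\le p\le n-1$, let $\Omega$ be a real $(p,p)$-form on $V$, and write $$\Omega=\Xi+\alpha\wedge\eta+\bar\alpha\wedge\bar\eta+i\,\alpha\wedge\bar\alpha\wedge\vartheta$$ with (uniquely determined) $\Xi\in\Lambda^{p,p}_{\mathfrak h}$, $\eta\in\Lambda^{p-1,p}_{\mathfrak h}$, $\vartheta\in\Lambda^{p-1,p-1}_{\mathfrak h}$. Let $\mathcal C$ denote one of the three positivity types: strong ($\operatorname{SP}$), Hermitian ($\operatorname{HP}$) or weak ($\operatorname{WP}$). Then: (1) If $\Omega\in\mathcal C^p$, then $\Xi\in\mathcal C^p_{\mathfrak h}$ and $\vartheta\in\mathcal C^{p-1}_{\mathfrak h}$. (2) If $\Omega$ is in the interior of $\mathcal C^p$, then $\Xi$ is in the interior of $\mathcal C^p_{\mathfrak h}$ and $\vartheta$ is in the interior of $\mathcal C^{p-1}_{\mathfrak h}$. (3) If $\eta=0$, the converses of both (1) and (2) hold: if $\Xi\in\mathcal C^p_{\mathfrak h}$ and $\vartheta\in\mathcal C^{p-1}_{\mathfrak h}$, then $\Omega\in\mathcal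 C^p$; and if $\Xi$ and $\vartheta$ are in the interiors of $\mathcal C^p_{\mathfrak h}$ and $\mathcal C^{p-1}_{\mathfrak h}$ respectively, then $\Omega$ is in the interior of $\mathcal C^p$.
   Context: For a complex vector space $W$ of dimension $m$, $\Lambda^{p,q}W^*$ is the space of $(p,q)$-forms on $W$. An $(m,m)$-form on $W$ is called non-negative (resp. strictly positive) if it is a non-negative (resp. positive) real multiple of $i\,\beta^1\wedge\bar\beta^1\wedge\cdots\wedge i\,\beta^m\wedge\bar\beta^m$ for a basis $\beta^1,\dots,\beta^m$ of $\Lambda^{1,0}W^*$ (this does not depend on the basis). A $(k,0)$-form is decomposable if it is a wedge product of $k$ forms of type $(1,0)$ (for $k=0$, any constant). A $(p,p)$-form is real if it equals its complex conjugate. A real $(p,p)$-form $\Omega$ on $W$ is: - strongly positive if $\Omega=i^{p^2}\sum_j\psi_j\wedge\bar\psi_j$ (finite sum) with each $\psi_j\in\Lambda^{p,0}W^*$ decomposable; - (Hermitian) positive if $i^{(m-p)^2}\,\Omega\wedge\eta\wedge\bar\eta$ is non-negative for all $\eta\in\Lambda^{m-p,0}W^*$; - weakly positive if $i^{(m-p)^2}\,\Omega\wedge\psi\wedge\bar\psi$ is non-negative for all decomposable $\psi\in\Lambda^{m-p,0}W^*$ (equivalently, its restriction to each $p$-dimensional complex subspace is non-negative). Hermitian positivity is the "intermediate" positivity notion. The corresponding cones of $(p,p)$-forms on $V$ are denoted $\operatorname{SP}^p,\operatorname{HP}^p,\operatorname{WP}^p$, and those on $\mathfrak h$ are denoted $\operatorname{SP}^p_{\mathfrak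 h},\operatorname{HP}^p_{\mathfrak h},\operatorname{WP}^p_{\mathfrak h}$. Interiors are taken in the real vector space of real $(p,p)$-forms on the relevant space ($V$ or $\mathfrak h$). For $p=0$ all three cones are the non-negative reals. Immersion: $\Lambda^{p,q}_{\mathfrak h}$ denotes the space of $(p,q)$-forms on $\mathfrak h$. For $\eta\in\Lambda^{p,q}_{\mathfrak h}$, $\rho_{v_0}\eta\in\Lambda^{p,q}V^*$ is the extension of $\eta$ vanishing on $v_0$ and $\bar v_0$: writing $v_j=c_jv_0+v_j^{\mathfrak h}$ with $c_j\in\mathbb C$, $v_j^{\mathfrak h}\in\mathfrak h$, one has $\rho_{v_0}\eta(v_1,\dots,v_p,\bar v_{p+1},\dots,\bar v_{p+q})=\eta(v_1^{\mathfrak h},\dots,v_p^{\mathfrak h},\bar v_{p+1}^{\mathfrak h},\dots,\bar v_{p+q}^{\mathfrak h})$. Membership of $\Xi$, $\vartheta$ in cones on $\mathfrak h$ (or their interiors) refers to the corresponding forms on $\mathfrak h$, i.e. to their restrictions to $\mathfrak h$. *)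

theory Defs
  imports "HOL-Analysis.Analysis" "HOL-Library.Function_Algebras"
begin

class complex_vector = ab_group_add +
  fixes scaleC :: "complex \<Rightarrow> 'a \<Rightarrow> 'a" (infixr "*\<^sub>C" 75)
  assumes scaleC_add_right: "a *\<^sub>C (x + y) = a *\<^sub>C x + a *\<^sub>C y"
    and scaleC_add_left: "(a + b) *\<^sub>C x = a *\<^sub>C x + b *\<^sub>C x"
    and scaleC_scaleC: "a *\<^sub>C b *\<^sub>C x = (a * b) *\<^sub>C x"
    and scaleC_one: "1 *\<^sub>C x = x"

global_interpretation complex_vector:
  vector_space "scaleC :: complex \<Rightarrow> 'a \<Rightarrow> 'a::complex_vector"
  by unfold_locales
    (rule scaleC_add_right scaleC_add_left scaleC_scaleC scaleC_one)+

instantiation complex :: complex_vector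
begin
definition scaleC_complex :: "complex \<Rightarrow> complex \<Rightarrow> complex"
  where "scaleC_complex a x = a * x"
instance
  by standard (simp_all add: scaleC_complex_def algebra_simps)
end

instantiation "fun" :: (type, complex_vector) complex_vector
begin
definition scaleC_fun :: "complex \<Rightarrow> ('a \<Rightarrow> 'b) \<Rightarrow> 'a \<Rightarrow> 'b"
  where "scaleC_fun a f = (\<lambda>x. a *\<^sub>C f x)"
instance
  by standard
    (simp_all add: scaleC_fun_def plus_fun_def fun_eq_iff scaleC_add_right scaleC_add_left
      scaleC_scaleC scaleC_one)
end

text \<open>
  A \<open>k\<close>-form on a complex subspace \<open>W\<close> is represented by the complex-valued alternating
  real-multilinear function it induces on \<open>k\<close>-tuples of vectors of \<open>W\<close>, extended by \<open>0\<close> to all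
  lists that are not \<open>k\<close>-tuples in \<open>W\<close>. Two forms on \<open>W\<close> are then equal iff the functions are.
  Nothing is said about general alternating functions: the spaces of \<open>(p,q)\<close>-forms below are
  generated from the complex-linear functionals by wedge products and conjugation.
\<close>

type_synonym 'v form = "'v list \<Rightarrow> complex"

definition one_form0 :: "'v form" \<comment> \<open>the constant \<open>1\<close> as a \<open>0\<close>-form\<close>
  where "one_form0 vs = (if vs = [] then 1 else 0)"

text \<open>
  The wedge product as a sum over shuffles: \<open>S\<close> is the set of positions passed to the first
  factor, and the sign counts the inversions of the shuffle. The degrees of the factors need not
  be given, since forms vanish on lists of the wrong length.
\<close>

definition wedge :: "'v form \<Rightarrow> 'v form \<Rightarrow> 'v form" (infixr "\<and>\<^sub>\<Lambda>" 70)
  where "(\<omega> \<and>\<^sub>\<Lambda> \<zeta>) vs =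
    (\<Sum>S\<in>Pow {..<length vs}.
      (-1) ^ card {(i, j). i \<in> S \<and> j \<in> {..<length vs} - S \<and> j < i} *
      \<omega> (nths vs S) * \<zeta> (nths vs ({..<length vs} - S)))"

definition wedge_list :: "'v form list \<Rightarrow> 'v form"
  where "wedge_list \<omega>s = foldr wedge \<omega>s one_form0"

definition cnj_form :: "'v form \<Rightarrow> 'v form"
  where "cnj_form \<omega> = (\<lambda>vs. cnj (\<omega> vs))"

definition covectors :: "'v::complex_vector set \<Rightarrow> 'v form set" \<comment> \<open>\<open>\<Lambda>\<^sup>1\<^sup>,\<^sup>0W\<^sup>*\<close>\<close>
  where "covectors W = {\<beta>.
    (\<forall>vs. \<not> (length vs = 1 \<and> set vs \<subseteq> W) \<longrightarrow> \<beta> vs = 0) \<and>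
    (\<forall>x\<in>W. \<forall>y\<in>W. \<beta> [x + y] = \<beta> [x] + \<beta> [y]) \<and>
    (\<forall>c. \<forall>x\<in>W. \<beta> [c *\<^sub>C x] = c * \<beta> [x])}"

definition forms :: "'v::complex_vector set \<Rightarrow> nat \<Rightarrow> nat \<Rightarrow> 'v form set" \<comment> \<open>\<open>\<Lambda>\<^sup>p\<^sup>,\<^sup>qW\<^sup>*\<close>\<close>
  where "forms W p q = complex_vector.span
    {wedge_list (\<beta>s @ map cnj_form \<gamma>s) |\<beta>s \<gamma>s.
      length \<beta>s = p \<and> set \<beta>s \<subseteq> covectors W \<and> length \<gamma>s = q \<and> set \<gamma>s \<subseteq> covectors W}"

definition real_forms :: "'v::complex_vector set \<Rightarrow> nat \<Rightarrow> 'v form set"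
  where "real_forms W p = {\<Omega> \<in> forms W p p. cnj_form \<Omega> = \<Omega>}"

definition decomposable :: "'v::complex_vector set \<Rightarrow> nat \<Rightarrow> 'v form set"
  where "decomposable W k =
    (if k = 0 then range (\<lambda>c. c *\<^sub>C one_form0)
     else {wedge_list \<beta>s |\<beta>s. length \<beta>s = k \<and> set \<beta>s \<subseteq> covectors W})"

definition nonneg_top :: "'v::complex_vector set \<Rightarrow> 'v form \<Rightarrow> bool"
  where "nonneg_top W \<omega> \<longleftrightarrow> (\<exists>\<beta>s c. distinct \<beta>s \<and> complex_vector.independent (set \<beta>s) \<and>
    complex_vector.span (set \<beta>s) = covectors W \<and> 0 \<le> c \<and>
    \<omega> = complex_of_real c *\<^sub>C wedge_list (map (\<lambda>\<beta>. \<i> *\<^sub>C (\<beta> \<and>\<^sub>\<Lambda> cnj_form \<beta>)) \<beta>s))"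

text \<open>
  The strongly, Hermitian and weakly positive cones. The last two are meant for \<open>p\<close> at most the
  dimension of \<open>W\<close>, so that the subtraction is not truncated.
\<close>

definition SP :: "'v::complex_vector set \<Rightarrow> nat \<Rightarrow> 'v form set"
  where "SP W p = {\<Omega> \<in> real_forms W p. \<exists>\<psi>s. set \<psi>s \<subseteq> decomposable W p \<and>
    \<Omega> = \<i> ^ (p\<^sup>2) *\<^sub>C (\<Sum>\<psi>\<leftarrow>\<psi>s. \<psi> \<and>\<^sub>\<Lambda> cnj_form \<psi>)}"

definition HP :: "'v::complex_vector set \<Rightarrow> nat \<Rightarrow> 'v form set"
  where "HP W p = {\<Omega> \<in> real_forms W p. \<forall>\<eta> \<in> forms W (complex_vector.dim W - p) 0.
    nonneg_top W (\<i> ^ ((complex_vector.dim W - p)\<^sup>2) *\<^sub>C (\<Omega> \<and>\<^sub>\<Lambda> \<eta> \<and>\<^sub>\<Lambda> cnj_form \<eta>))}"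

definition WP :: "'v::complex_vector set \<Rightarrow> nat \<Rightarrow> 'v form set"
  where "WP W p = {\<Omega> \<in> real_forms W p. \<forall>\<psi> \<in> decomposable W (complex_vector.dim W - p).
    nonneg_top W (\<i> ^ ((complex_vector.dim W - p)\<^sup>2) *\<^sub>C (\<Omega> \<and>\<^sub>\<Lambda> \<psi> \<and>\<^sub>\<Lambda> cnj_form \<psi>))}"

text \<open>
  The function space carries the topology of pointwise convergence. It is Hausdorff and makes the
  vector space operations continuous, so on the finite-dimensional real vector space
  \<^term>\<open>real_forms W p\<close> it induces the standard topology.
\<close>

definition interior_cone ::
    "('v::complex_vector set \<Rightarrow> nat \<Rightarrow> 'v form set) \<Rightarrow> 'v set \<Rightarrow> nat \<Rightarrow> 'v form set"
  where "interior_cone C W p = top_of_set (real_forms W p) interior_of C W p"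

definition hyperplane_part :: "'v::complex_vector \<Rightarrow> 'v set \<Rightarrow> 'v \<Rightarrow> 'v"
  where "hyperplane_part v0 h v = (THE w. w \<in> h \<and> (\<exists>c. v = c *\<^sub>C v0 + w))"

text \<open>
  Pulling the alternating function back along the projection onto \<open>h\<close> amounts to the formula
  \<open>\<eta>(v\<^sub>1\<^sup>h, \<dots>, v\<^sub>p\<^sup>h, conj v\<^sub>p\<^sub>+\<^sub>1\<^sup>h, \<dots>)\<close> for the complex-multilinear extension of \<open>\<eta>\<close>,
  because the projection is complex linear.
\<close>

definition immersion :: "'v::complex_vector \<Rightarrow> 'v set \<Rightarrow> 'v form \<Rightarrow> 'v form" \<comment> \<open>\<open>\<rho>\<^sub>v\<^sub>0\<close>\<close>
  where "immersion v0 h \<eta> = (\<lambda>vs. \<eta> (map (hyperplane_part v0 h) vs))"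

definition splits ::
    "'v::complex_vector \<Rightarrow> 'v set \<Rightarrow> 'v form \<Rightarrow> nat \<Rightarrow> 'v form \<Rightarrow> 'v form \<Rightarrow> 'v form \<Rightarrow> 'v form \<Rightarrow> bool"
  where "splits v0 h \<alpha> p \<Omega> \<Xi> \<eta> \<theta> \<longleftrightarrow>
    \<Xi> \<in> forms h p p \<and> \<eta> \<in> forms h (p - 1) p \<and> \<theta> \<in> forms h (p - 1) (p - 1) \<and>
    \<Omega> = immersion v0 h \<Xi> + \<alpha> \<and>\<^sub>\<Lambda> immersion v0 h \<eta>
      + cnj_form \<alpha> \<and>\<^sub>\<Lambda> cnj_form (immersion v0 h \<eta>)
      + \<i> *\<^sub>C (\<alpha> \<and>\<^sub>\<Lambda> cnj_form \<alpha> \<and>\<^sub>\<Lambda> immersion v0 h \<theta>)"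

end

theory Submission
  imports Defs
begin

text \<open>
  The proof works in the graded-commutative algebra of all functions on lists of vectors with the
  wedge product. Its laws follow from the fact that the interior product with a vector is a graded
  derivation (\<open>wedge_Cons\<close>). Inside it, the forms on a subspace are generated by its
  \<open>(1,0)\<close>-forms and their conjugates.

  Let \<open>a\<close> stand for \<open>\<alpha>\<close> and \<open>a'\<close> for its conjugate. The parts of a splitting
  \<open>\<Omega> = \<Xi> + a \<eta> + a' \<eta>' + \<i> a a' \<theta>\<close> are read off by contracting with the \<open>(1,0)\<close>- and the
  \<open>(0,1)\<close>-part of \<open>v0\<close> and restricting to the kernel of \<open>\<alpha>\<close> (\<open>split_parts\<close>), which gives
  uniqueness; existence follows by splitting each one-form, and reality follows from uniqueness.
  A decomposable form splits as \<open>\<psi>2 + a \<psi>1\<close> with \<open>\<psi>1\<close>, \<open>\<psi>2\<close> decomposable on the hyperplane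
  (\<open>decomposable_split\<close>), by elimination with a pivot.

  For the strong cone, the outer parts of \<open>\<psi> \<psi>'\<close> are therefore \<open>\<psi>2 \<psi>2'\<close> and \<open>\<psi>1 \<psi>1'\<close> up to
  the correct powers of \<open>\<i>\<close>. For the other two cones, a test form splits in the same way, and for
  reasons of degree its part with \<open>a\<close> only pairs with \<open>\<Xi>\<close> and its part without \<open>a\<close> only with
  \<open>\<theta>\<close> (\<open>test_pairing\<close>). This gives both implications between \<open>\<Omega>\<close> and its outer parts.

  Interior points have interior outer parts because the projections to the outer parts have
  continuous right inverses and are thus open. For the converse the mixed part of a perturbation has
  to be absorbed. By polarization the strongly positive forms span all \<open>(p,p)\<close>-forms, so the strong
  cone, and with it each of the three cones, has an interior point (\<open>SP_interior_nonempty\<close>).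
  Symmetrizing under the reflection that negates \<open>\<alpha>\<close> makes its mixed part zero. Splitting off a small
  multiple of that point from \<open>\<Omega>\<close> leaves a form of the cone, and an interior point plus a point of
  a convex cone is interior (\<open>interior_combine\<close>).
\<close>

section \<open>The graded algebra of functions on lists\<close>

lemma scaleC_form_apply: "(c *\<^sub>C \<omega>) vs = c * (\<omega> :: 'v form) vs"
  by (simp add: scaleC_fun_def scaleC_complex_def)

text \<open>
  Forms are treated as elements of an algebra; they are evaluated on vectors only where these rules
  are named explicitly.
\<close>

lemmas form_apply = scaleC_form_apply plus_fun_apply zero_fun_apply minus_apply uminus_apply

declare form_apply [simp del]

text \<open>
  The interior product with a vector.
\<close>

definition contract :: "'v \<Rightarrow> 'v form \<Rightarrow> 'v form"
  where "contract v \<omega> = (\<lambda>vs. \<omega> (v # vs))"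

definition grade_involution :: "'v form \<Rightarrow> 'v form"
  where "grade_involution \<omega> = (\<lambda>vs. (-1) ^ length vs * \<omega> vs)"

lemma wedge_Nil: "(\<omega> \<and>\<^sub>\<Lambda> \<zeta>) [] = \<omega> [] * \<zeta> []"
  by (simp add: wedge_def)

lemma sum_Pow_lessThan_Suc:
  fixes f :: "nat set \<Rightarrow> 'b::comm_monoid_add"
  shows "sum f (Pow {..<Suc n}) =
    (\<Sum>S\<in>Pow {..<n}. f (insert 0 (Suc ` S))) + (\<Sum>S\<in>Pow {..<n}. f (Suc ` S))"
proof -
  have eq: "Pow {..<Suc n} = (\<lambda>S. insert 0 (Suc ` S)) ` Pow {..<n} \<union> (\<lambda>S. Suc ` S) ` Pow {..<n}"
    unfolding lessThan_Suc_eq_insert_0 Pow_insert image_Pow_surj[OF refl, symmetric]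
    by (simp add: image_image Un_commute)
  have inj: "inj_on (\<lambda>S. insert 0 (Suc ` S)) (Pow {..<n})" "inj_on (\<lambda>S. Suc ` S) (Pow {..<n})"
  proof -
    show "inj_on (\<lambda>S. Suc ` S) (Pow {..<n})"
      by (simp add: inj_on_def inj_image_eq_iff)
    show "inj_on (\<lambda>S. insert 0 (Suc ` S)) (Pow {..<n})"
    proof (rule inj_onI)
      fix S T assume "insert 0 (Suc ` S) = insert 0 (Suc ` T)"
      then have "Suc ` S = Suc ` T" by (metis Diff_insert_absorb image_iff nat.distinct(1))
      then show "S = T" by (simp add: inj_image_eq_iff)
    qed
  qed
  show ?thesis unfolding eq
    by (subst sum.union_disjoint) (auto simp: sum.reindex[OF inj(1)] sum.reindex[OF inj(2)])
qed

definition inversions :: "nat \<Rightarrow> nat set \<Rightarrow> (nat \<times> nat) set"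
  where "inversions n S = {(i, j). i \<in> S \<and> j \<in> {..<n} - S \<and> j < i}"

lemma inversions_insert_0: "inversions (Suc n) (insert 0 (Suc ` S)) = map_prod Suc Suc ` inversions n S"
proof (intro set_eqI iffI)
  fix x assume "x \<in> inversions (Suc n) (insert 0 (Suc ` S))"
  then obtain i j where x: "x = (i, j)" "i \<in> insert 0 (Suc ` S)" "j < Suc n"
    "j \<notin> insert 0 (Suc ` S)" "j < i" unfolding inversions_def by blast
  moreover obtain i' j' where "i = Suc i'" "j = Suc j'"
    using x by (cases i; cases j) auto
  ultimately have "x = map_prod Suc Suc (i', j')" "(i', j') \<in> inversions n S"
    by (auto simp: inversions_def)
  then show "x \<in> map_prod Suc Suc ` inversions n S" by blast
qed (auto simp: inversions_def)

lemma inversions_Suc: "inversions (Suc n) (Suc ` S) = map_prod Suc Suc ` inversions n S \<union> (Suc ` S) \<times> {0}"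
proof (intro set_eqI iffI)
  fix x assume "x \<in> inversions (Suc n) (Suc ` S)"
  then obtain i j where x: "x = (i, j)" "i \<in> Suc ` S" "j < Suc n" "j \<notin> Suc ` S" "j < i"
    unfolding inversions_def by blast
  then obtain i' where i': "i = Suc i'" "i' \<in> S" by blast
  show "x \<in> map_prod Suc Suc ` inversions n S \<union> (Suc ` S) \<times> {0}"
  proof (cases j)
    case 0 then show ?thesis using x by simp
  next
    case (Suc j')
    then have "x = map_prod Suc Suc (i', j')" "(i', j') \<in> inversions n S"
      using x i' by (auto simp: inversions_def)
    then show ?thesis by blast
  qed
qed (auto simp: inversions_def)

lemma finite_inversions: "S \<subseteq> {..<n} \<Longrightarrow> finite (inversions n S)"
  by (rule finite_subset[of _ "{..<n} \<times> {..<n}"]) (auto simp: inversions_def)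

lemma card_inversions_insert_0: "card (inversions (Suc n) (insert 0 (Suc ` S))) = card (inversions n S)"
  unfolding inversions_insert_0 by (intro card_image) (auto simp: inj_on_def)

lemma card_inversions_Suc:
  assumes "S \<subseteq> {..<n}"
  shows "card (inversions (Suc n) (Suc ` S)) = card (inversions n S) + card S"
proof -
  have "card (map_prod Suc Suc ` inversions n S) = card (inversions n S)"
    by (intro card_image) (auto simp: inj_on_def)
  moreover have "card (Suc ` S \<times> {0::nat}) = card S"
    by (simp add: card_cartesian_product card_image)
  moreover have "finite (map_prod Suc Suc ` inversions n S)" "finite (Suc ` S \<times> {0::nat})"
    using finite_inversions[OF assms] finite_subset[OF assms] by simp_all
  moreover have "map_prod Suc Suc ` inversions n S \<inter> Suc ` S \<times> {0} = {}" by auto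
  ultimately show ?thesis
    unfolding inversions_Suc by (simp add: card_Un_disjoint)
qed

lemma nths_Cons_insert_0:
  assumes "S \<subseteq> {..<length vs}"
  shows "nths (v # vs) (insert 0 (Suc ` S)) = v # nths vs S"
    "nths (v # vs) ({..<Suc (length vs)} - insert 0 (Suc ` S)) = nths vs ({..<length vs} - S)"
proof -
  have "{j. Suc j \<in> insert 0 (Suc ` S)} = S" "{j. Suc j \<in> {..<Suc (length vs)} - insert 0 (Suc ` S)} = {..<length vs} - S"
    by auto
  then show "nths (v # vs) (insert 0 (Suc ` S)) = v # nths vs S"
    "nths (v # vs) ({..<Suc (length vs)} - insert 0 (Suc ` S)) = nths vs ({..<length vs} - S)"
    unfolding nths_Cons by auto
qed

lemma nths_Cons_Suc:
  assumes "S \<subseteq> {..<length vs}"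
  shows "nths (v # vs) (Suc ` S) = nths vs S"
    "nths (v # vs) ({..<Suc (length vs)} - Suc ` S) = v # nths vs ({..<length vs} - S)"
proof -
  have "{j. Suc j \<in> Suc ` S} = S" "{j. Suc j \<in> {..<Suc (length vs)} - Suc ` S} = {..<length vs} - S"
    by auto
  then show "nths (v # vs) (Suc ` S) = nths vs S"
    "nths (v # vs) ({..<Suc (length vs)} - Suc ` S) = v # nths vs ({..<length vs} - S)"
    unfolding nths_Cons by auto
qed

lemma length_nths_subset: "S \<subseteq> {..<length vs} \<Longrightarrow> length (nths vs S) = card S"
  unfolding length_nths by (intro arg_cong[of _ _ card]) auto

lemma wedge_eq_inversions:
  "(\<omega> \<and>\<^sub>\<Lambda> \<zeta>) vs = (\<Sum>S\<in>Pow {..<length vs}. (-1) ^ card (inversions (length vs) S) *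
    \<omega> (nths vs S) * \<zeta> (nths vs ({..<length vs} - S)))"
  by (simp add: wedge_def inversions_def)

text \<open>
  The interior product is a graded derivation. In the sum over shuffles, the sets of positions
  that contain the first position give the first summand. For the other sets \<open>S\<close> the
  first vector goes to the second factor and passes the \<open>card S\<close> vectors of the first
  one, which is the sign produced by the grading involution. As this determines the product by
  recursion on the list of vectors, the algebra laws below follow by induction on the list without
  further work on shuffles.
\<close>

lemma wedge_Cons:
  "(\<omega> \<and>\<^sub>\<Lambda> \<zeta>) (v # vs) =
    (contract v \<omega> \<and>\<^sub>\<Lambda> \<zeta>) vs + (grade_involution \<omega> \<and>\<^sub>\<Lambda> contract v \<zeta>) vs"
  unfolding wedge_eq_inversions length_Cons sum_Pow_lessThan_Suc
  by (intro arg_cong2[of _ _ _ _ "(+)"] sum.cong refl)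
    (simp_all only: Pow_iff card_inversions_insert_0 card_inversions_Suc nths_Cons_insert_0 nths_Cons_Suc
      contract_def grade_involution_def length_nths_subset power_add ac_simps)

lemma wedge_add_left: "(\<omega> + \<omega>') \<and>\<^sub>\<Lambda> \<zeta> = \<omega> \<and>\<^sub>\<Lambda> \<zeta> + \<omega>' \<and>\<^sub>\<Lambda> \<zeta>"
  by (simp add: fun_eq_iff form_apply wedge_def sum.distrib algebra_simps)

lemma wedge_add_right: "\<omega> \<and>\<^sub>\<Lambda> (\<zeta> + \<zeta>') = \<omega> \<and>\<^sub>\<Lambda> \<zeta> + \<omega> \<and>\<^sub>\<Lambda> \<zeta>'"
  by (simp add: fun_eq_iff form_apply wedge_def sum.distrib algebra_simps)

lemma wedge_scaleC_left: "(c *\<^sub>C \<omega>) \<and>\<^sub>\<Lambda> \<zeta> = c *\<^sub>C (\<omega> \<and>\<^sub>\<Lambda> \<zeta>)"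
  by (simp add: fun_eq_iff form_apply wedge_def sum_distrib_left algebra_simps)

lemma wedge_scaleC_right: "\<omega> \<and>\<^sub>\<Lambda> (c *\<^sub>C \<zeta>) = c *\<^sub>C (\<omega> \<and>\<^sub>\<Lambda> \<zeta>)"
  by (simp add: fun_eq_iff form_apply wedge_def sum_distrib_left algebra_simps)

lemma wedge_zero_left [simp]: "0 \<and>\<^sub>\<Lambda> \<zeta> = 0"
  by (simp add: fun_eq_iff form_apply wedge_def)

lemma wedge_zero_right [simp]: "\<omega> \<and>\<^sub>\<Lambda> 0 = 0"
  by (simp add: fun_eq_iff form_apply wedge_def)

lemma scaleC_minus_one: "(-1) *\<^sub>C \<omega> = - (\<omega> :: 'v form)"
  by (simp add: fun_eq_iff form_apply)

lemma wedge_minus_left: "(- \<omega>) \<and>\<^sub>\<Lambda> \<zeta> = - (\<omega> \<and>\<^sub>\<Lambda> \<zeta>)"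
  by (metis scaleC_minus_one wedge_scaleC_left)

lemma wedge_minus_right: "\<omega> \<and>\<^sub>\<Lambda> (- \<zeta>) = - (\<omega> \<and>\<^sub>\<Lambda> \<zeta>)"
  by (metis scaleC_minus_one wedge_scaleC_right)

lemma contract_add: "contract v (\<omega> + \<zeta>) = contract v \<omega> + contract v \<zeta>"
  by (simp add: contract_def fun_eq_iff form_apply)

lemma contract_scaleC: "contract v (c *\<^sub>C \<omega>) = c *\<^sub>C contract v \<omega>"
  by (simp add: contract_def fun_eq_iff form_apply)

lemma contract_wedge:
  "contract v (\<omega> \<and>\<^sub>\<Lambda> \<zeta>) = contract v \<omega> \<and>\<^sub>\<Lambda> \<zeta> + grade_involution \<omega> \<and>\<^sub>\<Lambda> contract v \<zeta>"
  by (simp add: contract_def fun_eq_iff form_apply wedge_Cons)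

lemma contract_grade_involution:
  "contract v (grade_involution \<omega>) = - grade_involution (contract v \<omega>)"
  by (simp add: contract_def grade_involution_def fun_eq_iff form_apply)

lemma grade_involution_wedge:
  "grade_involution (\<omega> \<and>\<^sub>\<Lambda> \<zeta>) = grade_involution \<omega> \<and>\<^sub>\<Lambda> grade_involution \<zeta>"
proof
  show "grade_involution (\<omega> \<and>\<^sub>\<Lambda> \<zeta>) vs = (grade_involution \<omega> \<and>\<^sub>\<Lambda> grade_involution \<zeta>) vs" for vs
  proof (induction vs arbitrary: \<omega> \<zeta>)
    case Nil
    then show ?case by (simp add: grade_involution_def wedge_Nil)
  next
    case (Cons v vs)
    have "grade_involution (\<omega> \<and>\<^sub>\<Lambda> \<zeta>) (v # vs) = - (grade_involution (contract v \<omega> \<and>\<^sub>\<Lambda> \<zeta>) vs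
        + grade_involution (grade_involution \<omega> \<and>\<^sub>\<Lambda> contract v \<zeta>) vs)"
      by (simp add: grade_involution_def wedge_Cons algebra_simps)
    then show ?case
      by (simp add: Cons.IH wedge_Cons contract_grade_involution wedge_minus_left wedge_minus_right form_apply)
  qed
qed

text \<open>
  Both sides have the same interior products, because these are graded derivations and the grading
  involution is multiplicative.
\<close>

lemma wedge_assoc: "(\<omega> \<and>\<^sub>\<Lambda> \<zeta>) \<and>\<^sub>\<Lambda> \<xi> = \<omega> \<and>\<^sub>\<Lambda> \<zeta> \<and>\<^sub>\<Lambda> \<xi>"
proof
  show "((\<omega> \<and>\<^sub>\<Lambda> \<zeta>) \<and>\<^sub>\<Lambda> \<xi>) vs = (\<omega> \<and>\<^sub>\<Lambda> \<zeta> \<and>\<^sub>\<Lambda> \<xi>) vs" for vs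
  proof (induction vs arbitrary: \<omega> \<zeta> \<xi>)
    case Nil
    then show ?case by (simp add: wedge_Nil)
  next
    case (Cons v vs)
    then show ?case
      by (simp add: wedge_Cons contract_wedge wedge_add_left wedge_add_right grade_involution_wedge form_apply)
  qed
qed

definition homogeneous :: "nat \<Rightarrow> 'v form \<Rightarrow> bool"
  where "homogeneous k \<omega> \<longleftrightarrow> (\<forall>vs. length vs \<noteq> k \<longrightarrow> \<omega> vs = 0)"

lemma homogeneous_contract: "homogeneous (Suc k) \<omega> \<Longrightarrow> homogeneous k (contract v \<omega>)"
  by (simp add: homogeneous_def contract_def)

lemma contract_homogeneous_0: "homogeneous 0 \<omega> \<Longrightarrow> contract v \<omega> = 0"
  by (simp add: homogeneous_def contract_def fun_eq_iff form_apply)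

lemma grade_involution_homogeneous: "homogeneous k \<omega> \<Longrightarrow> grade_involution \<omega> = (-1) ^ k *\<^sub>C \<omega>"
  by (auto simp: homogeneous_def grade_involution_def fun_eq_iff form_apply)

lemma homogeneous_one_form0: "homogeneous 0 one_form0"
  by (simp add: homogeneous_def one_form0_def)

lemma homogeneous_wedge:
  assumes "homogeneous a \<omega>" "homogeneous b \<zeta>" shows "homogeneous (a + b) (\<omega> \<and>\<^sub>\<Lambda> \<zeta>)"
  unfolding homogeneous_def
proof (intro allI impI)
  fix vs :: "'a list" assume len: "length vs \<noteq> a + b"
  have "\<omega> (nths vs S) * \<zeta> (nths vs ({..<length vs} - S)) = 0" if "S \<subseteq> {..<length vs}" for S
  proof -
    have "{i. i < length vs \<and> i \<in> S} = S" "{i. i < length vs \<and> i \<in> {..<length vs} - S} = {..<length vs} - S"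
      using that by auto
    then have "length (nths vs S) + length (nths vs ({..<length vs} - S)) = length vs"
      using card_mono[OF _ that] finite_subset[OF that] by (simp add: length_nths card_Diff_subset that)
    then show ?thesis using assms len unfolding homogeneous_def by (metis mult_eq_0_iff)
  qed
  then show "(\<omega> \<and>\<^sub>\<Lambda> \<zeta>) vs = 0"
    unfolding wedge_def by (intro sum.neutral) (simp add: mult.assoc)
qed

lemma homogeneous_scaleC: "homogeneous k \<omega> \<Longrightarrow> homogeneous k (c *\<^sub>C \<omega>)"
  by (simp add: homogeneous_def form_apply)

lemma homogeneous_cnj_form [simp]: "homogeneous k (cnj_form \<omega>) \<longleftrightarrow> homogeneous k \<omega>"
  by (simp add: homogeneous_def cnj_form_def)

text \<open>
  Graded commutativity holds for arbitrary homogeneous functions on lists: the two summands of the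
  derivation rule are exchanged, and contracting one factor lowers its degree by one, which
  accounts for the sign.
\<close>

lemma wedge_commute:
  assumes "homogeneous a \<omega>" "homogeneous b \<zeta>"
  shows "\<omega> \<and>\<^sub>\<Lambda> \<zeta> = (-1) ^ (a * b) *\<^sub>C (\<zeta> \<and>\<^sub>\<Lambda> \<omega>)"
proof
  show "(\<omega> \<and>\<^sub>\<Lambda> \<zeta>) vs = ((-1) ^ (a * b) *\<^sub>C (\<zeta> \<and>\<^sub>\<Lambda> \<omega>)) vs" for vs
    using assms
  proof (induction vs arbitrary: a b \<omega> \<zeta>)
    case Nil
    then show ?case
      by (cases "a = 0 \<or> b = 0") (auto simp: wedge_Nil homogeneous_def form_apply)
  next
    case (Cons v vs)
    note g = grade_involution_homogeneous[OF Cons.prems(1)] grade_involution_homogeneous[OF Cons.prems(2)]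
    have 1: "(contract v \<omega> \<and>\<^sub>\<Lambda> \<zeta>) vs = (-1) ^ (a * b + b) * (\<zeta> \<and>\<^sub>\<Lambda> contract v \<omega>) vs"
    proof (cases a)
      case 0
      then have "contract v \<omega> = 0" using Cons.prems(1) by (simp add: contract_homogeneous_0)
      then show ?thesis by (simp add: form_apply)
    next
      case (Suc a')
      then have "homogeneous a' (contract v \<omega>)" using Cons.prems(1) by (simp add: homogeneous_contract)
      moreover have "(-1 :: complex) ^ (a * b + b) = (-1) ^ (a' * b)"
        by (simp add: Suc power_add mult.commute mult.left_commute)
      ultimately show ?thesis using Cons.IH[of a' "contract v \<omega>" b \<zeta>] Cons.prems(2)
        by (simp only: scaleC_form_apply)
    qed
    have 2: "(\<omega> \<and>\<^sub>\<Lambda> contract v \<zeta>) vs = (-1) ^ (a * b + a) * (contract v \<zeta> \<and>\<^sub>\<Lambda> \<omega>) vs"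
    proof (cases b)
      case 0
      then have "contract v \<zeta> = 0" using Cons.prems(2) by (simp add: contract_homogeneous_0)
      then show ?thesis by (simp add: form_apply)
    next
      case (Suc b')
      then have "homogeneous b' (contract v \<zeta>)" using Cons.prems(2) by (simp add: homogeneous_contract)
      moreover have "(-1 :: complex) ^ (a * b + a) = (-1) ^ (a * b')"
        by (simp add: Suc power_add mult.commute mult.left_commute)
      ultimately show ?thesis using Cons.IH[of a \<omega> b' "contract v \<zeta>"] Cons.prems(1)
        by (simp only: scaleC_form_apply)
    qed
    show ?case
      unfolding wedge_Cons g wedge_scaleC_left scaleC_form_apply 1 2 distrib_left
      by (simp add: power_add)
  qed
qed

lemma wedge_one_left [simp]: "one_form0 \<and>\<^sub>\<Lambda> \<omega> = \<omega>"
proof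
  have "grade_involution one_form0 = (one_form0 :: 'a form)"
    by (simp add: grade_involution_def one_form0_def fun_eq_iff form_apply)
  moreover have "contract v one_form0 = 0" for v :: 'a
    by (simp add: contract_def one_form0_def fun_eq_iff form_apply)
  ultimately show "(one_form0 \<and>\<^sub>\<Lambda> \<omega>) vs = \<omega> vs" for vs
    by (induction vs arbitrary: \<omega>) (simp_all add: wedge_Nil wedge_Cons zero_fun_apply, simp_all add: one_form0_def contract_def)
qed

lemma wedge_one_right [simp]: "\<omega> \<and>\<^sub>\<Lambda> one_form0 = \<omega>"
proof
  have "contract v one_form0 = 0" for v :: 'a
    by (simp add: contract_def one_form0_def fun_eq_iff form_apply)
  then show "(\<omega> \<and>\<^sub>\<Lambda> one_form0) vs = \<omega> vs" for vs
    by (induction vs arbitrary: \<omega>) (simp_all add: wedge_Nil wedge_Cons zero_fun_apply, simp_all add: one_form0_def contract_def)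
qed

lemma wedge_1_swap:
  assumes "homogeneous 1 \<beta>" "homogeneous 1 \<gamma>" shows "\<beta> \<and>\<^sub>\<Lambda> \<gamma> = - (\<gamma> \<and>\<^sub>\<Lambda> \<beta>)"
  using wedge_commute[OF assms] by (simp add: scaleC_minus_one)

lemma wedge_1_square:
  assumes "homogeneous 1 \<beta>" shows "\<beta> \<and>\<^sub>\<Lambda> \<beta> = 0"
proof
  fix vs
  have "(\<beta> \<and>\<^sub>\<Lambda> \<beta>) vs = - (\<beta> \<and>\<^sub>\<Lambda> \<beta>) vs"
    using fun_cong[OF wedge_1_swap[OF assms assms], of vs] by (simp add: form_apply)
  then show "(\<beta> \<and>\<^sub>\<Lambda> \<beta>) vs = 0 vs" by (simp add: form_apply)
qed

lemma cnj_form_wedge: "cnj_form (\<omega> \<and>\<^sub>\<Lambda> \<zeta>) = cnj_form \<omega> \<and>\<^sub>\<Lambda> cnj_form \<zeta>"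
  by (simp add: cnj_form_def wedge_def fun_eq_iff form_apply)

lemma cnj_form_add: "cnj_form (\<omega> + \<zeta>) = cnj_form \<omega> + cnj_form \<zeta>"
  by (simp add: cnj_form_def fun_eq_iff form_apply)

lemma cnj_form_scaleC: "cnj_form (c *\<^sub>C \<omega>) = cnj c *\<^sub>C cnj_form \<omega>"
  by (simp add: cnj_form_def fun_eq_iff form_apply)

lemma cnj_form_cnj_form [simp]: "cnj_form (cnj_form \<omega>) = \<omega>"
  by (simp add: cnj_form_def)

lemma cnj_form_0 [simp]: "cnj_form 0 = 0"
  by (simp add: cnj_form_def fun_eq_iff form_apply)

lemma cnj_form_one_form0 [simp]: "cnj_form one_form0 = one_form0"
  by (simp add: cnj_form_def one_form0_def fun_eq_iff form_apply)

lemma wedge_list_Nil [simp]: "wedge_list [] = one_form0"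
  by (simp add: wedge_list_def)

lemma wedge_list_Cons [simp]: "wedge_list (\<omega> # \<omega>s) = \<omega> \<and>\<^sub>\<Lambda> wedge_list \<omega>s"
  by (simp add: wedge_list_def)

lemma wedge_list_append: "wedge_list (\<omega>s @ \<zeta>s) = wedge_list \<omega>s \<and>\<^sub>\<Lambda> wedge_list \<zeta>s"
  by (induction \<omega>s) (simp_all add: wedge_assoc)

lemma cnj_form_wedge_list: "cnj_form (wedge_list \<omega>s) = wedge_list (map cnj_form \<omega>s)"
  by (induction \<omega>s) (simp_all add: cnj_form_wedge)

lemma homogeneous_wedge_list:
  "(\<And>\<omega>. \<omega> \<in> set \<omega>s \<Longrightarrow> homogeneous 1 \<omega>) \<Longrightarrow> homogeneous (length \<omega>s) (wedge_list \<omega>s)"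
proof (induction \<omega>s)
  case Nil
  then show ?case by (simp add: homogeneous_one_form0)
next
  case (Cons \<omega> \<omega>s)
  then show ?case using homogeneous_wedge[of 1 \<omega> "length \<omega>s" "wedge_list \<omega>s"] by simp
qed

section \<open>Covectors, forms and pullbacks\<close>

lemma form_span_induct [consumes 1, case_names base zero add scale]:
  assumes "x \<in> complex_vector.span S" and "\<And>s. s \<in> S \<Longrightarrow> P s" and "P 0"
    and "\<And>x y. P x \<Longrightarrow> P y \<Longrightarrow> P (x + y)" and "\<And>c x. P x \<Longrightarrow> P (c *\<^sub>C x)"
  shows "P x"
  using assms(1)
  by (rule complex_vector.span_induct) (auto simp: complex_vector.subspace_def assms(2-))

lemma homogeneous_0 [simp]: "homogeneous k 0"
  by (simp add: homogeneous_def form_apply)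

lemma homogeneous_add: "homogeneous k \<omega> \<Longrightarrow> homogeneous k \<zeta> \<Longrightarrow> homogeneous k (\<omega> + \<zeta>)"
  by (simp add: homogeneous_def form_apply)

lemma homogeneous_span:
  assumes "\<omega> \<in> complex_vector.span S" "\<And>s. s \<in> S \<Longrightarrow> homogeneous k s"
  shows "homogeneous k \<omega>"
  using assms by (induction rule: form_span_induct) (simp_all add: homogeneous_add homogeneous_scaleC)

lemma covectors_homogeneous: "\<beta> \<in> covectors W \<Longrightarrow> homogeneous 1 \<beta>"
  by (auto simp: covectors_def homogeneous_def)

lemma subspace_covectors: "complex_vector.subspace (covectors W)"
  by (auto simp: complex_vector.subspace_def covectors_def form_apply algebra_simps)

lemma homogeneous_covector_list: "set \<beta>s \<subseteq> covectors W \<Longrightarrow> homogeneous (length \<beta>s) (wedge_list \<beta>s)"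
  by (rule homogeneous_wedge_list) (use covectors_homogeneous in blast)

text \<open>
  Separating the holomorphic from the antiholomorphic factors makes the action of conjugation and
  of wedge products on the spaces of forms visible.
\<close>

lemma forms_eq:
  "forms W p q = complex_vector.span {wedge_list \<beta>s \<and>\<^sub>\<Lambda> cnj_form (wedge_list \<gamma>s) |\<beta>s \<gamma>s.
    length \<beta>s = p \<and> set \<beta>s \<subseteq> covectors W \<and> length \<gamma>s = q \<and> set \<gamma>s \<subseteq> covectors W}"
  by (simp add: forms_def wedge_list_append cnj_form_wedge_list)

lemma forms_0_eq:
  "forms W k 0 = complex_vector.span {wedge_list \<beta>s |\<beta>s. length \<beta>s = k \<and> set \<beta>s \<subseteq> covectors W}"
  unfolding forms_eq by (rule arg_cong[of _ _ complex_vector.span]) auto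

lemma forms_add: "\<omega> \<in> forms W p q \<Longrightarrow> \<zeta> \<in> forms W p q \<Longrightarrow> \<omega> + \<zeta> \<in> forms W p q"
  by (simp add: forms_def complex_vector.span_add)

lemma forms_scaleC: "\<omega> \<in> forms W p q \<Longrightarrow> c *\<^sub>C \<omega> \<in> forms W p q"
  by (simp add: forms_def complex_vector.span_scale)

lemma forms_0: "0 \<in> forms W p q"
  by (simp add: forms_def complex_vector.span_zero)

lemma wedge_list_cnj_in_forms:
  assumes "set \<beta>s \<subseteq> covectors W" "set \<gamma>s \<subseteq> covectors W" "length \<beta>s = p" "length \<gamma>s = q"
  shows "wedge_list \<beta>s \<and>\<^sub>\<Lambda> cnj_form (wedge_list \<gamma>s) \<in> forms W p q"
  unfolding forms_eq by (rule complex_vector.span_base) (use assms in blast)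

lemma homogeneous_forms: "\<omega> \<in> forms W p q \<Longrightarrow> homogeneous (p + q) \<omega>"
  unfolding forms_eq
  by (erule homogeneous_span) (auto intro!: homogeneous_wedge homogeneous_covector_list)

lemma forms_cnj_form:
  assumes "\<omega> \<in> forms W p q" shows "cnj_form \<omega> \<in> forms W q p"
  using assms unfolding forms_eq[of W p q]
proof (induction rule: form_span_induct)
  case (base s)
  then obtain \<beta>s \<gamma>s where s: "s = wedge_list \<beta>s \<and>\<^sub>\<Lambda> cnj_form (wedge_list \<gamma>s)"
    and l: "length \<beta>s = p" "set \<beta>s \<subseteq> covectors W" "length \<gamma>s = q" "set \<gamma>s \<subseteq> covectors W" by auto
  have "homogeneous p (cnj_form (wedge_list \<beta>s))" "homogeneous q (wedge_list \<gamma>s)"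
    using l homogeneous_covector_list by auto
  from wedge_commute[OF this] show ?case
    unfolding s using l by (simp add: cnj_form_wedge forms_scaleC wedge_list_cnj_in_forms)
qed (simp_all add: cnj_form_add cnj_form_scaleC forms_add forms_scaleC forms_0)

text \<open>
  In positive degree a scalar can be absorbed into one of the factors, so the convention for
  degree \<open>0\<close> extends to a description that is uniform in the degree.
\<close>

lemma decomposable_eq:
  "decomposable W k = {c *\<^sub>C wedge_list \<beta>s |c \<beta>s. length \<beta>s = k \<and> set \<beta>s \<subseteq> covectors W}"
proof (cases k)
  case 0
  then show ?thesis by (auto simp: decomposable_def)
next
  case (Suc k')
  have "\<exists>\<gamma>s. c *\<^sub>C wedge_list \<beta>s = wedge_list \<gamma>s \<and> length \<gamma>s = k \<and> set \<gamma>s \<subseteq> covectors W"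
    if "length \<beta>s = k" "set \<beta>s \<subseteq> covectors W" for c \<beta>s
  proof -
    from that Suc obtain \<beta> \<beta>s' where "\<beta>s = \<beta> # \<beta>s'" by (cases \<beta>s) auto
    with that subspace_covectors[of W] show ?thesis
      by (intro exI[of _ "(c *\<^sub>C \<beta>) # \<beta>s'"]) (auto simp: wedge_scaleC_left complex_vector.subspace_def)
  qed
  moreover have "wedge_list \<beta>s = 1 *\<^sub>C wedge_list \<beta>s" for \<beta>s :: "'a form list" by (simp only: scaleC_one)
  ultimately show ?thesis using Suc unfolding decomposable_def by (simp del: complex_vector.scale_one) blast
qed

lemma decomposable_scaleC: "\<psi> \<in> decomposable W k \<Longrightarrow> c *\<^sub>C \<psi> \<in> decomposable W k"
  unfolding decomposable_eq by (force simp: scaleC_scaleC)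

lemma zero_decomposable: "0 \<in> decomposable W k"
proof -
  have "replicate k 0 = replicate k (0 :: 'b form)" "set (replicate k 0) \<subseteq> covectors W" for W :: "'b::complex_vector set"
    using subspace_covectors[of W] by (auto simp: complex_vector.subspace_0)
  then have "0 *\<^sub>C wedge_list (replicate k 0) \<in> decomposable W k"
    unfolding decomposable_eq by (metis (mono_tags, lifting) length_replicate mem_Collect_eq)
  then show ?thesis by simp
qed

lemma decomposable_in_forms: "\<psi> \<in> decomposable W k \<Longrightarrow> \<psi> \<in> forms W k 0"
  unfolding decomposable_def forms_0_eq
  by (force split: if_splits intro: complex_vector.span_scale complex_vector.span_base)

lemma decomposable_wedge_cnj_in_forms:
  assumes "\<psi> \<in> decomposable W p" "\<phi> \<in> decomposable W q"
  shows "\<psi> \<and>\<^sub>\<Lambda> cnj_form \<phi> \<in> forms W p q"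
  using assms unfolding decomposable_eq
  by (auto simp: cnj_form_scaleC wedge_scaleC_left wedge_scaleC_right intro!: forms_scaleC wedge_list_cnj_in_forms)

lemma forms_wedge:
  assumes "\<omega> \<in> forms W a b" "\<zeta> \<in> forms W c d"
  shows "\<omega> \<and>\<^sub>\<Lambda> \<zeta> \<in> forms W (a + c) (b + d)"
  using assms(1) unfolding forms_eq[of W a b]
proof (induction rule: form_span_induct)
  case (base s)
  then obtain \<beta>s \<gamma>s where s: "s = wedge_list \<beta>s \<and>\<^sub>\<Lambda> cnj_form (wedge_list \<gamma>s)"
    and l: "length \<beta>s = a" "set \<beta>s \<subseteq> covectors W" "length \<gamma>s = b" "set \<gamma>s \<subseteq> covectors W" by auto
  show ?case
    using assms(2) unfolding forms_eq[of W c d]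
  proof (induction rule: form_span_induct)
    case (base t)
    then obtain \<beta>s' \<gamma>s' where t: "t = wedge_list \<beta>s' \<and>\<^sub>\<Lambda> cnj_form (wedge_list \<gamma>s')"
      and l': "length \<beta>s' = c" "set \<beta>s' \<subseteq> covectors W" "length \<gamma>s' = d" "set \<gamma>s' \<subseteq> covectors W" by auto
    have "homogeneous b (cnj_form (wedge_list \<gamma>s))" "homogeneous c (wedge_list \<beta>s')"
      using l l' homogeneous_covector_list by auto
    then have "cnj_form (wedge_list \<gamma>s) \<and>\<^sub>\<Lambda> wedge_list \<beta>s'
        = (-1) ^ (b * c) *\<^sub>C (wedge_list \<beta>s' \<and>\<^sub>\<Lambda> cnj_form (wedge_list \<gamma>s))"
      by (rule wedge_commute)
    then have "s \<and>\<^sub>\<Lambda> t = (-1) ^ (b * c) *\<^sub>C (wedge_list (\<beta>s @ \<beta>s') \<and>\<^sub>\<Lambda> cnj_form (wedge_list (\<gamma>s @ \<gamma>s')))"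
      unfolding s t wedge_list_append cnj_form_wedge
      by (metis wedge_assoc wedge_scaleC_left wedge_scaleC_right)
    then show ?case
      using l l' by (auto intro!: forms_scaleC wedge_list_cnj_in_forms)
  qed (simp_all add: wedge_add_right wedge_scaleC_right forms_add forms_scaleC forms_0)
qed (simp_all add: wedge_add_left wedge_scaleC_left forms_add forms_scaleC forms_0)

lemma forms_1_0: "forms W 1 0 = covectors W"
proof -
  have "{wedge_list \<beta>s |\<beta>s. length \<beta>s = 1 \<and> set \<beta>s \<subseteq> covectors W} = covectors W" (is "?A = _")
  proof (intro set_eqI iffI)
    fix \<beta> assume "\<beta> \<in> ?A"
    then show "\<beta> \<in> covectors W" by (auto simp: length_Suc_conv)
  next
    fix \<beta> assume "\<beta> \<in> covectors W"
    then show "\<beta> \<in> ?A" by (intro CollectI exI[of _ "[\<beta>]"]) simp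
  qed
  then show ?thesis unfolding forms_0_eq using subspace_covectors[of W] by simp
qed

definition complex_linear_on :: "'v::complex_vector set \<Rightarrow> ('v \<Rightarrow> 'w::complex_vector) \<Rightarrow> 'w set \<Rightarrow> bool"
  where "complex_linear_on W f W' \<longleftrightarrow> f ` W \<subseteq> W' \<and>
    (\<forall>x\<in>W. \<forall>y\<in>W. f (x + y) = f x + f y) \<and> (\<forall>c. \<forall>x\<in>W. f (c *\<^sub>C x) = c *\<^sub>C f x)"

text \<open>
  The value \<open>0\<close> off \<open>W\<close> follows the encoding of forms on
  \<open>W\<close>. With \<open>W = UNIV\<close> this covers the immersion of forms, and with a
  section of the projection it covers the restriction to a hyperplane.
\<close>

definition pull_back :: "'v set \<Rightarrow> ('v \<Rightarrow> 'w) \<Rightarrow> 'w form \<Rightarrow> 'v form"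
  where "pull_back W f \<omega> = (\<lambda>vs. if set vs \<subseteq> W then \<omega> (map f vs) else 0)"

text \<open>
  A list leaves \<open>W\<close> iff the part given to one of the two factors does, for every
  shuffle.
\<close>

lemma pull_back_wedge: "pull_back W f (\<omega> \<and>\<^sub>\<Lambda> \<zeta>) = pull_back W f \<omega> \<and>\<^sub>\<Lambda> pull_back W f \<zeta>"
proof
  fix vs :: "'a list"
  show "pull_back W f (\<omega> \<and>\<^sub>\<Lambda> \<zeta>) vs = (pull_back W f \<omega> \<and>\<^sub>\<Lambda> pull_back W f \<zeta>) vs"
  proof (cases "set vs \<subseteq> W")
    case True
    then have "set (nths vs S) \<subseteq> W" for S using set_nths_subset[of vs S] by auto
    with True show ?thesis by (simp add: pull_back_def wedge_def nths_map)
  next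
    case False
    then obtain i where i: "i < length vs" "vs ! i \<notin> W" by (metis in_set_conv_nth subsetI)
    have "pull_back W f \<omega> (nths vs S) * pull_back W f \<zeta> (nths vs ({..<length vs} - S)) = 0" for S
    proof (cases "i \<in> S")
      case True
      with i have "\<not> set (nths vs S) \<subseteq> W" by (auto simp: set_nths)
      then show ?thesis by (simp add: pull_back_def)
    next
      case False
      with i have "\<not> set (nths vs ({..<length vs} - S)) \<subseteq> W" by (auto simp: set_nths)
      then show ?thesis by (simp add: pull_back_def)
    qed
    then have "(pull_back W f \<omega> \<and>\<^sub>\<Lambda> pull_back W f \<zeta>) vs = 0"
      unfolding wedge_def mult.assoc by (intro sum.neutral) simp
    then show ?thesis using False by (simp add: pull_back_def)
  qed
qed

lemma pull_back_add: "pull_back W f (\<omega> + \<zeta>) = pull_back W f \<omega> + pull_back W f \<zeta>"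
  by (simp add: pull_back_def fun_eq_iff form_apply)

lemma pull_back_scaleC: "pull_back W f (c *\<^sub>C \<omega>) = c *\<^sub>C pull_back W f \<omega>"
  by (simp add: pull_back_def fun_eq_iff form_apply)

lemma pull_back_0 [simp]: "pull_back W f 0 = 0"
  by (simp add: pull_back_def fun_eq_iff form_apply)

lemma pull_back_one_form0 [simp]: "pull_back W f one_form0 = one_form0"
  by (simp add: pull_back_def one_form0_def fun_eq_iff form_apply)

lemma pull_back_cnj_form: "pull_back W f (cnj_form \<omega>) = cnj_form (pull_back W f \<omega>)"
  by (simp add: pull_back_def cnj_form_def fun_eq_iff form_apply)

lemma pull_back_wedge_list: "pull_back W f (wedge_list \<omega>s) = wedge_list (map (pull_back W f) \<omega>s)"
  by (induction \<omega>s) (simp_all add: pull_back_wedge)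

lemma pull_back_covectors:
  assumes "complex_linear_on W f W'" "complex_vector.subspace W" "\<beta> \<in> covectors W'"
  shows "pull_back W f \<beta> \<in> covectors W"
proof -
  have W: "x + y \<in> W" "c *\<^sub>C x \<in> W" if "x \<in> W" "y \<in> W" for x y c
    using assms(2) that by (auto simp: complex_vector.subspace_def)
  have f: "f x \<in> W'" if "x \<in> W" for x using assms(1) that by (auto simp: complex_linear_on_def)
  show ?thesis
    using assms(1,3) W f unfolding covectors_def pull_back_def complex_linear_on_def
    by (auto simp add: image_subset_iff)
qed

lemma pull_back_decomposable:
  assumes "complex_linear_on W f W'" "complex_vector.subspace W" "\<psi> \<in> decomposable W' k"
  shows "pull_back W f \<psi> \<in> decomposable W k"
proof -
  obtain c \<beta>s where \<beta>s: "\<psi> = c *\<^sub>C wedge_list \<beta>s" "length \<beta>s = k" "set \<beta>s \<subseteq> covectors W'"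
    using assms(3) by (auto simp: decomposable_eq)
  have "set (map (pull_back W f) \<beta>s) \<subseteq> covectors W"
    using pull_back_covectors[OF assms(1,2)] \<beta>s(3) by auto
  moreover have "pull_back W f \<psi> = c *\<^sub>C wedge_list (map (pull_back W f) \<beta>s)"
    by (simp add: \<beta>s(1) pull_back_scaleC pull_back_wedge_list)
  ultimately show ?thesis
    unfolding decomposable_eq using \<beta>s(2) by (metis (mono_tags, lifting) length_map mem_Collect_eq)
qed

lemma pull_back_forms:
  assumes "complex_linear_on W f W'" "complex_vector.subspace W" "\<omega> \<in> forms W' p q"
  shows "pull_back W f \<omega> \<in> forms W p q"
  using assms(3) unfolding forms_eq[of W' p q]
proof (induction rule: form_span_induct)
  case (base s)
  then obtain \<beta>s \<gamma>s where s: "s = wedge_list \<beta>s \<and>\<^sub>\<Lambda> cnj_form (wedge_list \<gamma>s)"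
    and l: "length \<beta>s = p" "set \<beta>s \<subseteq> covectors W'" "length \<gamma>s = q" "set \<gamma>s \<subseteq> covectors W'" by auto
  show ?case unfolding s pull_back_wedge pull_back_cnj_form pull_back_wedge_list
    by (rule wedge_list_cnj_in_forms) (use l pull_back_covectors[OF assms(1,2)] in auto)
qed (simp_all add: pull_back_add pull_back_scaleC forms_add forms_scaleC forms_0)

lemma real_formsI: "\<omega> \<in> forms W p p \<Longrightarrow> cnj_form \<omega> = \<omega> \<Longrightarrow> \<omega> \<in> real_forms W p"
  by (simp add: real_forms_def)

lemma real_formsD: "\<omega> \<in> real_forms W p \<Longrightarrow> \<omega> \<in> forms W p p" "\<omega> \<in> real_forms W p \<Longrightarrow> cnj_form \<omega> = \<omega>"
  by (simp_all add: real_forms_def)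

lemma real_forms_add: "\<omega> \<in> real_forms W p \<Longrightarrow> \<zeta> \<in> real_forms W p \<Longrightarrow> \<omega> + \<zeta> \<in> real_forms W p"
  by (simp add: real_forms_def forms_add cnj_form_add)

lemma real_forms_scale: "\<omega> \<in> real_forms W p \<Longrightarrow> complex_of_real r *\<^sub>C \<omega> \<in> real_forms W p"
  by (simp add: real_forms_def forms_scaleC cnj_form_scaleC)

lemma real_forms_0: "0 \<in> real_forms W p"
  by (simp add: real_forms_def forms_0)

lemma real_forms_diff:
  assumes "\<omega> \<in> real_forms W p" "\<zeta> \<in> real_forms W p" shows "\<omega> - \<zeta> \<in> real_forms W p"
  using real_forms_add[OF assms(1) real_forms_scale[OF assms(2), of "-1"]]
  by (simp add: scaleC_minus_one)

lemma pull_back_real_forms: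
  assumes "complex_linear_on W f W'" "complex_vector.subspace W" "\<omega> \<in> real_forms W' p"
  shows "pull_back W f \<omega> \<in> real_forms W p"
  using assms pull_back_forms[OF assms(1,2)] by (simp add: real_forms_def pull_back_cnj_form[symmetric])

section \<open>Products of one-forms\<close>

text \<open>
  Gaussian elimination in one column: a product of one-forms either avoids the direction
  \<open>a\<close> altogether or can be rewritten so that \<open>a\<close> occurs in a single
  factor, which is moved to the front. The other factors are made to lie in \<open>S\<close> by
  subtracting multiples of this pivot; that changes nothing, since the pivot squares to zero. In
  this way a decomposable form is split into parts that are again decomposable.
\<close>

lemma wedge_list_pivot:
  assumes S: "complex_vector.subspace S" and hom: "\<And>s. s \<in> S \<Longrightarrow> homogeneous 1 s"
    and a: "homogeneous 1 a" and "set \<beta>s \<subseteq> complex_vector.span (insert a S)"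
  shows "(\<exists>\<gamma>s. length \<gamma>s = length \<beta>s \<and> set \<gamma>s \<subseteq> S \<and> wedge_list \<beta>s = wedge_list \<gamma>s) \<or>
    (\<exists>c s \<gamma>s. s \<in> S \<and> set \<gamma>s \<subseteq> S \<and> length \<beta>s = Suc (length \<gamma>s) \<and>
      wedge_list \<beta>s = c *\<^sub>C ((a + s) \<and>\<^sub>\<Lambda> wedge_list \<gamma>s))"
  using assms(4)
proof (induction \<beta>s)
  case Nil
  then show ?case by auto
next
  case (Cons \<beta> \<beta>s)
  have "complex_vector.span S = S" using S by simp
  moreover have "\<beta> \<in> complex_vector.span (insert a S)" using Cons.prems by simp
  ultimately obtain x where x: "\<beta> - x *\<^sub>C a \<in> S"
    by (metis complex_vector.span_breakdown_eq)
  define \<beta>' where "\<beta>' = \<beta> - x *\<^sub>C a"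
  then have \<beta>: "\<beta> = x *\<^sub>C a + \<beta>'" "\<beta>' \<in> S" using x by simp_all
  from Cons have "(\<exists>\<gamma>s. length \<gamma>s = length \<beta>s \<and> set \<gamma>s \<subseteq> S \<and> wedge_list \<beta>s = wedge_list \<gamma>s) \<or>
    (\<exists>c s \<gamma>s. s \<in> S \<and> set \<gamma>s \<subseteq> S \<and> length \<beta>s = Suc (length \<gamma>s) \<and>
      wedge_list \<beta>s = c *\<^sub>C ((a + s) \<and>\<^sub>\<Lambda> wedge_list \<gamma>s))" by simp
  then consider (inside) \<gamma>s where "length \<gamma>s = length \<beta>s" "set \<gamma>s \<subseteq> S" "wedge_list \<beta>s = wedge_list \<gamma>s"
    | (pivot) c s \<gamma>s where "s \<in> S" "set \<gamma>s \<subseteq> S" "length \<beta>s = Suc (length \<gamma>s)"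
      "wedge_list \<beta>s = c *\<^sub>C ((a + s) \<and>\<^sub>\<Lambda> wedge_list \<gamma>s)" by blast
  then show ?case
  proof cases
    case inside
    show ?thesis
    proof (cases "x = 0")
      case True
      then show ?thesis using inside \<beta> by (intro disjI1 exI[of _ "\<beta>' # \<gamma>s"]) simp
    next
      case False
      then have "\<beta> = x *\<^sub>C (a + (1 / x) *\<^sub>C \<beta>')"
        by (simp add: \<beta> scaleC_add_right scaleC_scaleC scaleC_one)
      moreover have "(1 / x) *\<^sub>C \<beta>' \<in> S" using S \<beta>(2) by (simp add: complex_vector.subspace_scale)
      ultimately show ?thesis using inside
        by (intro disjI2 exI[of _ x] exI[of _ "(1 / x) *\<^sub>C \<beta>'"] exI[of _ \<gamma>s]) (simp add: wedge_scaleC_left)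
    qed
  next
    case pivot
    define u where "u = \<beta>' - x *\<^sub>C s"
    have u: "u \<in> S" unfolding u_def using S \<beta>(2) pivot(1)
      by (simp add: complex_vector.subspace_diff complex_vector.subspace_scale)
    have as: "homogeneous 1 (a + s)" using a hom[OF pivot(1)] by (rule homogeneous_add)
    have "\<beta> = x *\<^sub>C (a + s) + u" by (simp add: \<beta> u_def scaleC_add_right)
    then have "wedge_list (\<beta> # \<beta>s) = (c * x) *\<^sub>C (((a + s) \<and>\<^sub>\<Lambda> (a + s)) \<and>\<^sub>\<Lambda> wedge_list \<gamma>s)
        + c *\<^sub>C ((u \<and>\<^sub>\<Lambda> (a + s)) \<and>\<^sub>\<Lambda> wedge_list \<gamma>s)"
      by (simp only: wedge_list_Cons pivot(4) wedge_add_left[of "x *\<^sub>C (a + s)" u] wedge_scaleC_left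
          wedge_scaleC_right scaleC_scaleC wedge_assoc mult.commute scaleC_add_right[of c])
    also have "\<dots> = c *\<^sub>C - ((a + s) \<and>\<^sub>\<Lambda> u \<and>\<^sub>\<Lambda> wedge_list \<gamma>s)"
      by (simp only: wedge_1_square[OF as] wedge_1_swap[OF hom[OF u] as] wedge_minus_left wedge_assoc
          wedge_zero_left complex_vector.scale_zero_right add_0)
    also have "\<dots> = (- c) *\<^sub>C ((a + s) \<and>\<^sub>\<Lambda> wedge_list (u # \<gamma>s))"
      by simp
    finally show ?thesis using pivot u
      by (intro disjI2 exI[of _ "- c"] exI[of _ s] exI[of _ "u # \<gamma>s"]) simp
  qed
qed

text \<open>
  Products of one-forms from the span of \<open>bs\<close> vanish above degree \<open>length
  bs\<close>, and in that degree they are multiples of a single form. Both statements are proved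
  together by eliminating one element of \<open>bs\<close> after the other; the vanishing kills
  the part of the pivot factor that lies in the smaller span.
\<close>

lemma wedge_list_top_degree:
  assumes "\<And>b. b \<in> set bs \<Longrightarrow> homogeneous 1 b" "set \<beta>s \<subseteq> complex_vector.span (set bs)"
  shows "length bs < length \<beta>s \<Longrightarrow> wedge_list \<beta>s = 0"
    and "length bs = length \<beta>s \<Longrightarrow> \<exists>c. wedge_list \<beta>s = c *\<^sub>C wedge_list bs"
  using assms
proof (induction bs arbitrary: \<beta>s)
  case Nil
  {
    case 1
    then obtain \<beta> \<beta>s' where "\<beta>s = \<beta> # \<beta>s'" by (cases \<beta>s) auto
    moreover from this 1 have "\<beta> = 0" by simp
    ultimately show ?case by simp
  next
    case 2
    then show ?case by (auto intro!: exI[of _ 1] simp: scaleC_one)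
  }
next
  case (Cons b bs)
  let ?S = "complex_vector.span (set bs)"
  have hom: "homogeneous 1 s" if "s \<in> ?S" and "\<And>b'. b' \<in> set (b # bs) \<Longrightarrow> homogeneous 1 b'" for s
    using that by (auto intro: homogeneous_span)
  have pivot: "(\<exists>\<gamma>s. length \<gamma>s = length \<beta>s \<and> set \<gamma>s \<subseteq> ?S \<and> wedge_list \<beta>s = wedge_list \<gamma>s) \<or>
    (\<exists>c s \<gamma>s. s \<in> ?S \<and> set \<gamma>s \<subseteq> ?S \<and> length \<beta>s = Suc (length \<gamma>s) \<and>
      wedge_list \<beta>s = c *\<^sub>C ((b + s) \<and>\<^sub>\<Lambda> wedge_list \<gamma>s))"
    if h: "\<forall>b'\<in>set (b # bs). homogeneous 1 b'"
      and "set \<beta>s \<subseteq> complex_vector.span (set (b # bs))" for \<beta>s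
  proof (rule wedge_list_pivot)
    show "set \<beta>s \<subseteq> complex_vector.span (insert b ?S)"
    proof -
      have "set (b # bs) \<subseteq> insert b ?S" by (auto intro: complex_vector.span_base)
      then show ?thesis using that(2) complex_vector.span_mono by blast
    qed
  qed (use hom h in auto)
  {
    case 1
    have hbs: "\<And>b'. b' \<in> set bs \<Longrightarrow> homogeneous 1 b'" using 1 by simp
    have "\<forall>b'\<in>set (b # bs). homogeneous 1 b'" using 1(2) by blast
    from pivot[OF this 1(3)] show ?case
    proof (elim disjE exE conjE)
      fix \<gamma>s assume "length \<gamma>s = length \<beta>s" "set \<gamma>s \<subseteq> ?S" "wedge_list \<beta>s = wedge_list \<gamma>s"
      then show ?thesis using Cons.IH(1)[of \<gamma>s] 1(1) hbs by simp
    next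
      fix c s \<gamma>s assume "set \<gamma>s \<subseteq> ?S" "length \<beta>s = Suc (length \<gamma>s)"
        "wedge_list \<beta>s = c *\<^sub>C ((b + s) \<and>\<^sub>\<Lambda> wedge_list \<gamma>s)"
      then show ?thesis using Cons.IH(1)[of \<gamma>s] 1(1) hbs by simp
    qed
  next
    case 2
    have hbs: "\<And>b'. b' \<in> set bs \<Longrightarrow> homogeneous 1 b'" using 2 by simp
    have "\<forall>b'\<in>set (b # bs). homogeneous 1 b'" using 2(2) by blast
    from pivot[OF this 2(3)] show ?case
    proof (elim disjE exE conjE)
      fix \<gamma>s assume "length \<gamma>s = length \<beta>s" "set \<gamma>s \<subseteq> ?S" "wedge_list \<beta>s = wedge_list \<gamma>s"
      then show ?thesis using Cons.IH(1)[of \<gamma>s] 2(1) hbs by (intro exI[of _ 0]) simp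
    next
      fix c s \<gamma>s assume s: "s \<in> ?S" "set \<gamma>s \<subseteq> ?S" "length \<beta>s = Suc (length \<gamma>s)"
        "wedge_list \<beta>s = c *\<^sub>C ((b + s) \<and>\<^sub>\<Lambda> wedge_list \<gamma>s)"
      then obtain d where d: "wedge_list \<gamma>s = d *\<^sub>C wedge_list bs"
        using Cons.IH(2)[of \<gamma>s] 2(1) hbs by auto
      have "s \<and>\<^sub>\<Lambda> wedge_list \<gamma>s = 0"
        using Cons.IH(1)[of "s # \<gamma>s"] s 2(1) hbs by simp
      then show ?thesis
        by (intro exI[of _ "c * d"]) (auto simp add: s(4) wedge_add_left d wedge_scaleC_right scaleC_scaleC)
    qed
  }
qed

section \<open>Coframes and non-negative top forms\<close>

text \<open>
  The factor \<open>\<i> ^ (k\<^sup>2)\<close> makes the product real for \<open>\<psi>\<close> of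
  degree \<open>k\<close>. It is the normalisation used for strongly positive forms, and also the
  one used for the test forms of the other cones.
\<close>

definition hermitian_square :: "nat \<Rightarrow> 'v form \<Rightarrow> 'v form"
  where "hermitian_square k \<psi> = \<i> ^ (k\<^sup>2) *\<^sub>C (\<psi> \<and>\<^sub>\<Lambda> cnj_form \<psi>)"

lemma hermitian_square_scaleC:
  "hermitian_square k (c *\<^sub>C \<psi>) = complex_of_real ((cmod c)\<^sup>2) *\<^sub>C hermitian_square k \<psi>"
  unfolding hermitian_square_def cnj_form_scaleC wedge_scaleC_left wedge_scaleC_right scaleC_scaleC
  by (intro arg_cong2[of _ _ _ _ scaleC] refl) (simp add: complex_norm_square algebra_simps flip: of_real_power)

lemma i_power_square_add: "\<i> ^ ((p + q)\<^sup>2) = \<i> ^ (p\<^sup>2) * \<i> ^ (q\<^sup>2) * (-1) ^ (p * q)"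
proof -
  have "(p + q)\<^sup>2 = p\<^sup>2 + q\<^sup>2 + 2 * (p * q)" by (simp add: power2_eq_square algebra_simps)
  then show ?thesis by (simp only: power_add power_mult) simp
qed

lemma i_power_square_Suc: "\<i> ^ ((Suc k)\<^sup>2) * (-1) ^ k = \<i> * \<i> ^ (k\<^sup>2)"
  using i_power_square_add[of 1 k] by (simp add: mult.assoc)

text \<open>
  Moving \<open>cnj_form \<psi>\<close> past \<open>\<eta>\<close> costs \<open>(-1) ^ (p *
  q)\<close>, which is the discrepancy between \<open>\<i> ^ ((p + q)\<^sup>2)\<close> and
  \<open>\<i> ^ (p\<^sup>2) * \<i> ^ (q\<^sup>2)\<close>.
\<close>

lemma hermitian_square_wedge:
  assumes "homogeneous p \<psi>" "homogeneous q \<eta>"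
  shows "\<i> ^ (q\<^sup>2) *\<^sub>C (hermitian_square p \<psi> \<and>\<^sub>\<Lambda> \<eta> \<and>\<^sub>\<Lambda> cnj_form \<eta>) = hermitian_square (p + q) (\<psi> \<and>\<^sub>\<Lambda> \<eta>)"
proof -
  have "cnj_form \<psi> \<and>\<^sub>\<Lambda> \<eta> = (-1) ^ (p * q) *\<^sub>C (\<eta> \<and>\<^sub>\<Lambda> cnj_form \<psi>)"
    by (rule wedge_commute) (simp_all add: assms)
  then have "(\<psi> \<and>\<^sub>\<Lambda> cnj_form \<psi>) \<and>\<^sub>\<Lambda> \<eta> \<and>\<^sub>\<Lambda> cnj_form \<eta>
      = (-1) ^ (p * q) *\<^sub>C ((\<psi> \<and>\<^sub>\<Lambda> \<eta>) \<and>\<^sub>\<Lambda> cnj_form (\<psi> \<and>\<^sub>\<Lambda> \<eta>))"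
    by (metis cnj_form_wedge wedge_assoc wedge_scaleC_left wedge_scaleC_right)
  then show ?thesis
    by (simp add: hermitian_square_def wedge_scaleC_left scaleC_scaleC i_power_square_add algebra_simps)
qed

lemma cnj_form_hermitian_square:
  assumes "homogeneous k \<psi>" shows "cnj_form (hermitian_square k \<psi>) = hermitian_square k \<psi>"
proof -
  have "cnj_form \<psi> \<and>\<^sub>\<Lambda> \<psi> = (-1) ^ (k * k) *\<^sub>C (\<psi> \<and>\<^sub>\<Lambda> cnj_form \<psi>)"
    by (rule wedge_commute) (simp_all add: assms)
  moreover have "(- \<i>) ^ (k\<^sup>2) * (-1) ^ (k * k) = \<i> ^ (k\<^sup>2)"
    by (simp add: power2_eq_square flip: power_mult_distrib)
  ultimately show ?thesis
    by (simp add: hermitian_square_def cnj_form_scaleC cnj_form_wedge scaleC_scaleC)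
qed

definition volume_form :: "'v form list \<Rightarrow> 'v form"
  where "volume_form bs = wedge_list (map (\<lambda>\<beta>. \<i> *\<^sub>C (\<beta> \<and>\<^sub>\<Lambda> cnj_form \<beta>)) bs)"

lemma volume_form_eq:
  assumes "\<And>b. b \<in> set bs \<Longrightarrow> homogeneous 1 b"
  shows "volume_form bs = hermitian_square (length bs) (wedge_list bs)"
  using assms
proof (induction bs)
  case Nil
  then show ?case by (simp add: volume_form_def hermitian_square_def scaleC_one)
next
  case (Cons b bs)
  let ?k = "length bs" and ?B = "wedge_list bs"
  have "homogeneous 1 b" "homogeneous ?k ?B" using Cons.prems by (auto intro!: homogeneous_wedge_list)
  from hermitian_square_wedge[OF this]
  have "hermitian_square 1 b \<and>\<^sub>\<Lambda> hermitian_square ?k ?B = hermitian_square (Suc ?k) (b \<and>\<^sub>\<Lambda> ?B)"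
    by (simp add: hermitian_square_def[of ?k] wedge_scaleC_right)
  moreover have "volume_form (b # bs) = hermitian_square 1 b \<and>\<^sub>\<Lambda> volume_form bs"
    by (simp add: volume_form_def hermitian_square_def)
  ultimately show ?case using Cons by simp
qed

text \<open>
  A basis of the \<open>(1,0)\<close>-forms, as a list so that it defines a top form.
\<close>

definition coframe :: "'v::complex_vector set \<Rightarrow> 'v form list \<Rightarrow> bool"
  where "coframe W bs \<longleftrightarrow> distinct bs \<and> complex_vector.independent (set bs) \<and>
    complex_vector.span (set bs) = covectors W"

lemma coframe_covectors: "coframe W bs \<Longrightarrow> b \<in> set bs \<Longrightarrow> b \<in> covectors W"
  unfolding coframe_def using complex_vector.span_base by blast

lemma coframe_homogeneous: "coframe W bs \<Longrightarrow> b \<in> set bs \<Longrightarrow> homogeneous 1 b"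
  using coframe_covectors covectors_homogeneous by blast

lemma coframe_length_le: "coframe W bs \<Longrightarrow> coframe W bs' \<Longrightarrow> length bs \<le> length bs'"
proof -
  assume b: "coframe W bs" "coframe W bs'"
  then have "card (set bs) \<le> card (set bs')"
    using complex_vector.independent_span_bound[of "set bs'" "set bs"] complex_vector.span_base
    unfolding coframe_def by blast
  then show ?thesis using b by (simp add: coframe_def distinct_card)
qed

text \<open>
  A form of degree \<open>(m,0)\<close> is a multiple \<open>c\<close> of the product of the
  coframe, so that its Hermitian square is \<open>\<bar>c\<bar>\<^sup>2\<close> times the volume
  form.
\<close>

lemma hermitian_square_top_degree:
  assumes "coframe W bs" "\<omega> \<in> forms W (length bs) 0"
  shows "\<exists>r\<ge>0. hermitian_square (length bs) \<omega> = complex_of_real r *\<^sub>C volume_form bs"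
proof -
  have "\<exists>c. \<omega> = c *\<^sub>C wedge_list bs"
    using assms(2) unfolding forms_0_eq
  proof (induction rule: form_span_induct)
    case (base s)
    then obtain \<beta>s where \<beta>s: "s = wedge_list \<beta>s" "length \<beta>s = length bs" "set \<beta>s \<subseteq> covectors W"
      by blast
    have "set \<beta>s \<subseteq> complex_vector.span (set bs)" using \<beta>s(3) assms(1) by (simp add: coframe_def)
    from wedge_list_top_degree(2)[OF coframe_homogeneous[OF assms(1)] this \<beta>s(2)[symmetric]] \<beta>s(1)
    show ?case by simp
  next
    case zero
    then show ?case by (intro exI[of _ 0]) simp
  next
    case (add x y)
    then show ?case by (metis scaleC_add_left)
  next
    case (scale c x)
    then show ?case by (metis scaleC_scaleC)
  qed
  then obtain c where "\<omega> = c *\<^sub>C wedge_list bs" by blast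
  then show ?thesis
    using volume_form_eq[of bs] coframe_homogeneous[OF assms(1)]
    by (intro exI[of _ "(cmod c)\<^sup>2"]) (simp add: hermitian_square_scaleC)
qed

text \<open>
  Non-negativity can be tested in any coframe, because the volume form of another coframe is a
  Hermitian square of top degree.
\<close>

lemma nonneg_top_iff:
  assumes "coframe W bs"
  shows "nonneg_top W \<omega> \<longleftrightarrow> (\<exists>r\<ge>0. \<omega> = complex_of_real r *\<^sub>C volume_form bs)"
proof
  assume "nonneg_top W \<omega>"
  then obtain \<beta>s r where \<beta>s: "coframe W \<beta>s" and r: "0 \<le> r" "\<omega> = complex_of_real r *\<^sub>C volume_form \<beta>s"
    unfolding nonneg_top_def coframe_def volume_form_def by blast
  have len: "length \<beta>s = length bs" using coframe_length_le[OF assms \<beta>s] coframe_length_le[OF \<beta>s assms] by simp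
  have "set \<beta>s \<subseteq> covectors W" using coframe_covectors[OF \<beta>s] by blast
  then have "wedge_list \<beta>s \<in> forms W (length bs) 0"
    unfolding forms_0_eq using len by (intro complex_vector.span_base) blast
  from hermitian_square_top_degree[OF assms this] obtain s where
    "s \<ge> 0" "volume_form \<beta>s = complex_of_real s *\<^sub>C volume_form bs"
    using volume_form_eq[of \<beta>s] coframe_homogeneous[OF \<beta>s] len by auto
  then show "\<exists>r\<ge>0. \<omega> = complex_of_real r *\<^sub>C volume_form bs"
    using r by (intro exI[of _ "r * s"]) (simp add: scaleC_scaleC)
next
  assume "\<exists>r\<ge>0. \<omega> = complex_of_real r *\<^sub>C volume_form bs"
  then show "nonneg_top W \<omega>"
    using assms unfolding nonneg_top_def coframe_def volume_form_def by blast
qed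

lemma nonneg_top_coframe: "nonneg_top W \<omega> \<Longrightarrow> \<exists>bs. coframe W bs"
  unfolding nonneg_top_def coframe_def by blast

lemma nonneg_top_add:
  assumes "nonneg_top W \<omega>" "nonneg_top W \<zeta>" shows "nonneg_top W (\<omega> + \<zeta>)"
proof -
  obtain bs where bs: "coframe W bs" using nonneg_top_coframe[OF assms(1)] by blast
  from assms obtain r s where "r \<ge> 0" "\<omega> = complex_of_real r *\<^sub>C volume_form bs"
    "s \<ge> 0" "\<zeta> = complex_of_real s *\<^sub>C volume_form bs"
    unfolding nonneg_top_iff[OF bs] by blast
  then show ?thesis
    unfolding nonneg_top_iff[OF bs] by (intro exI[of _ "r + s"]) (simp add: scaleC_add_left)
qed

lemma nonneg_top_scale:
  assumes "nonneg_top W \<omega>" "0 \<le> r" shows "nonneg_top W (complex_of_real r *\<^sub>C \<omega>)"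
proof -
  obtain bs where bs: "coframe W bs" using nonneg_top_coframe[OF assms(1)] by blast
  from assms obtain s where "s \<ge> 0" "\<omega> = complex_of_real s *\<^sub>C volume_form bs"
    unfolding nonneg_top_iff[OF bs] by blast
  then show ?thesis
    unfolding nonneg_top_iff[OF bs] using assms(2) by (intro exI[of _ "r * s"]) (simp add: scaleC_scaleC)
qed

lemma form_sum_apply: "(\<Sum>x\<in>A. f x :: 'v form) vs = (\<Sum>x\<in>A. f x vs)"
  by (induction A rule: infinite_finite_induct) (simp_all add: form_apply)

lemma covector_0:
  assumes "\<beta> \<in> covectors W" "complex_vector.subspace W" shows "\<beta> [0] = 0"
proof -
  have "\<beta> [0 *\<^sub>C 0] = 0 * \<beta> [0]"
    using assms complex_vector.subspace_0 unfolding covectors_def by blast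
  then show ?thesis by simp
qed

lemma covector_sum:
  assumes "\<beta> \<in> covectors W" "complex_vector.subspace W" "\<And>x. x \<in> A \<Longrightarrow> g x \<in> W"
  shows "\<beta> [\<Sum>x\<in>A. f x *\<^sub>C g x] = (\<Sum>x\<in>A. f x * \<beta> [g x])"
  using assms(3)
proof (induction A rule: infinite_finite_induct)
  case (insert x A)
  have "(\<Sum>x\<in>A. f x *\<^sub>C g x) \<in> W" "f x *\<^sub>C g x \<in> W"
    using insert.prems assms(2) by (auto intro!: complex_vector.subspace_sum complex_vector.subspace_scale)
  then show ?case using insert assms(1) by (simp add: covectors_def)
qed (simp_all add: covector_0[OF assms(1,2)])

text \<open>
  The dual basis of a basis of \<open>W\<close>.
\<close>

lemma coframe_exists:
  fixes W :: "'v::complex_vector set"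
  assumes W: "complex_vector.subspace W" and dim: "complex_vector.dim W = k" "0 < k"
  shows "\<exists>bs. coframe W bs \<and> length bs = k"
proof -
  obtain B where B: "B \<subseteq> W" "complex_vector.independent B" "W \<subseteq> complex_vector.span B" "card B = k"
    using complex_vector.basis_exists[of W] dim by metis
  have finB: "finite B" using B(4) dim(2) card_ge_0_finite by metis
  have span: "complex_vector.span B = W"
    using B W by (simp add: complex_vector.span_minimal subset_antisym)
  let ?coord = "\<lambda>b v. complex_vector.representation B v b"
  define dual :: "'v \<Rightarrow> 'v form" where
    "dual b = (\<lambda>vs. if length vs = 1 \<and> set vs \<subseteq> W then ?coord b (hd vs) else 0)" for b
  have cov: "dual b \<in> covectors W" for b
    using W unfolding covectors_def dual_def
    by (auto simp: complex_vector.representation_add complex_vector.representation_scale B span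
        complex_vector.subspace_add complex_vector.subspace_scale)
  have delta: "dual b [c] = (if b = c then 1 else 0)" if "c \<in> B" for b c
    using that B by (auto simp: dual_def complex_vector.representation_basis)
  have expand: "\<beta> = (\<Sum>b\<in>B. \<beta> [b] *\<^sub>C dual b)" if \<beta>: "\<beta> \<in> covectors W" for \<beta>
  proof
    fix vs
    show "\<beta> vs = (\<Sum>b\<in>B. \<beta> [b] *\<^sub>C dual b) vs"
    proof (cases "length vs = 1 \<and> set vs \<subseteq> W")
      case True
      then obtain v where v: "vs = [v]" "v \<in> W" by (auto simp: length_Suc_conv)
      have "v = (\<Sum>b\<in>B. ?coord b v *\<^sub>C b)"
        using complex_vector.sum_representation_eq[of B v B] B finB span v by simp
      then have "\<beta> [v] = \<beta> [\<Sum>b\<in>B. ?coord b v *\<^sub>C b]" by simp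
      also have "\<dots> = (\<Sum>b\<in>B. ?coord b v * \<beta> [b])"
        using B by (intro covector_sum[OF \<beta> W]) auto
      finally show ?thesis using v by (simp add: form_sum_apply form_apply dual_def mult.commute)
    next
      case False
      then have "\<beta> vs = 0" using \<beta> by (simp add: covectors_def)
      moreover have "dual b vs = 0" for b unfolding dual_def by (rule if_not_P) (rule False)
      ultimately show ?thesis by (simp add: form_sum_apply form_apply)
    qed
  qed
  have inj: "inj_on dual B"
  proof (rule inj_onI)
    fix b c assume bc: "b \<in> B" "c \<in> B" "dual b = dual c"
    show "b = c"
    proof (rule ccontr)
      assume "b \<noteq> c"
      then have "dual b [b] = 1" "dual c [b] = 0" using bc(1) delta by auto
      then show False using bc(3) by simp
    qed
  qed
  obtain ds where ds: "distinct ds" "set ds = B" using finite_distinct_list[OF finB] by blast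
  have "coframe W (map dual ds)"
    unfolding coframe_def
  proof (intro conjI)
    show "distinct (map dual ds)" using ds inj by (simp add: distinct_map)
    show "complex_vector.independent (set (map dual ds))"
    proof (rule complex_vector.independent_if_scalars_zero)
      show "finite (set (map dual ds))" by simp
      fix f \<beta> assume sum: "(\<Sum>\<beta>\<in>set (map dual ds). f \<beta> *\<^sub>C \<beta>) = 0" and "\<beta> \<in> set (map dual ds)"
      then obtain c where c: "c \<in> B" "\<beta> = dual c" using ds by auto
      have "0 = (\<Sum>\<beta>\<in>dual ` B. f \<beta> *\<^sub>C \<beta>) [c]" using sum ds by (simp add: form_apply)
      also have "\<dots> = (\<Sum>b\<in>B. f (dual b) * dual b [c])"
        by (simp add: sum.reindex[OF inj] form_sum_apply form_apply)
      also have "\<dots> = f (dual c)" using c finB by (simp add: delta if_distrib cong: if_cong)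
      finally show "f \<beta> = 0" using c by simp
    qed
    show "complex_vector.span (set (map dual ds)) = covectors W"
    proof
      show "complex_vector.span (set (map dual ds)) \<subseteq> covectors W"
        using cov by (intro complex_vector.span_minimal subspace_covectors) auto
      show "covectors W \<subseteq> complex_vector.span (set (map dual ds))"
      proof
        fix \<beta> assume "\<beta> \<in> covectors W"
        moreover have "(\<Sum>b\<in>B. \<beta> [b] *\<^sub>C dual b) \<in> complex_vector.span (set (map dual ds))"
          using ds by (intro complex_vector.span_sum complex_vector.span_scale complex_vector.span_base) auto
        ultimately show "\<beta> \<in> complex_vector.span (set (map dual ds))" using expand by metis
      qed
    qed
  qed
  moreover have "length (map dual ds) = k" using ds B(4) distinct_card[OF ds(1)] by simp
  ultimately show ?thesis by blast
qed

section \<open>Projecting onto a complex hyperplane\<close>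

locale complex_hyperplane =
  fixes h :: "'v::complex_vector set" and v0 :: 'v and m :: nat
  assumes subspace_h: "complex_vector.subspace h" and dim_h: "complex_vector.dim h = m"
    and dim_UNIV: "complex_vector.dim (UNIV :: 'v set) = Suc m" and dim_pos: "0 < m" and v0_notin: "v0 \<notin> h"
begin

abbreviation proj :: "'v \<Rightarrow> 'v" where "proj \<equiv> hyperplane_part v0 h"

abbreviation rho :: "'v form \<Rightarrow> 'v form" where "rho \<equiv> immersion v0 h"

text \<open>
  Adding \<open>v0\<close> to a basis of \<open>h\<close> gives \<open>Suc m\<close> independent
  vectors, and one more independent vector would exceed the dimension of the space.
\<close>

lemma hyperplane_decomp: "\<exists>c w. w \<in> h \<and> v = c *\<^sub>C v0 + w"
proof -
  obtain B where B: "B \<subseteq> h" "complex_vector.independent B" "h \<subseteq> complex_vector.span B" "card B = m"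
    using complex_vector.basis_exists[of h] dim_h by metis
  have finB: "finite B" using B(4) dim_pos card_ge_0_finite by metis
  have span: "complex_vector.span B = h"
    using B subspace_h by (simp add: complex_vector.span_minimal subset_antisym)
  obtain C :: "'v set" where C: "UNIV \<subseteq> complex_vector.span C" "card C = complex_vector.dim (UNIV :: 'v set)"
    by (rule complex_vector.basis_exists)
  note C = C(1) C(2)[unfolded dim_UNIV]
  have finC: "finite C" using C(2) card_ge_0_finite by (metis zero_less_Suc)
  have indep: "complex_vector.independent (insert v0 B)"
    using B(2) v0_notin span by (simp add: complex_vector.independent_insertI)
  have "v0 \<notin> B" using v0_notin B(1) by blast
  have "v \<in> complex_vector.span (insert v0 B)"
  proof (rule ccontr)
    assume v: "v \<notin> complex_vector.span (insert v0 B)"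
    then have "complex_vector.independent (insert v (insert v0 B))"
      using indep by (rule complex_vector.independent_insertI)
    then have "card (insert v (insert v0 B)) \<le> card C"
      using complex_vector.independent_span_bound[OF finC] C(1) by blast
    moreover have "v \<notin> insert v0 B" using v complex_vector.span_base by blast
    ultimately show False using finB \<open>v0 \<notin> B\<close> B(4) C(2) by simp
  qed
  then obtain c where "v - c *\<^sub>C v0 \<in> h" using complex_vector.span_breakdown_eq span by metis
  then show ?thesis by (intro exI[of _ c] exI[of _ "v - c *\<^sub>C v0"]) simp
qed

lemma proj_eq:
  assumes "w \<in> h" shows "proj (c *\<^sub>C v0 + w) = w"
  unfolding hyperplane_part_def
proof (rule the_equality)
  show "w \<in> h \<and> (\<exists>d. c *\<^sub>C v0 + w = d *\<^sub>C v0 + w)" using assms by blast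
  fix w' assume "w' \<in> h \<and> (\<exists>d. c *\<^sub>C v0 + w = d *\<^sub>C v0 + w')"
  then obtain d where w': "w' \<in> h" "c *\<^sub>C v0 + w = d *\<^sub>C v0 + w'" by blast
  then have eq: "(c - d) *\<^sub>C v0 = w' - w"
    by (simp add: complex_vector.scale_left_diff_distrib algebra_simps)
  have "c = d"
  proof (rule ccontr)
    assume "c \<noteq> d"
    then have "v0 = (1 / (c - d)) *\<^sub>C (c - d) *\<^sub>C v0" by (simp add: scaleC_scaleC)
    also have "\<dots> \<in> h" unfolding eq using subspace_h assms w'(1)
      by (intro complex_vector.subspace_scale complex_vector.subspace_diff)
    finally show False using v0_notin by simp
  qed
  then show "w' = w" using w' by simp
qed

lemma proj_decomp: "\<exists>c. v = c *\<^sub>C v0 + proj v" and proj_in: "proj v \<in> h"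
proof -
  obtain c w where w: "w \<in> h" "v = c *\<^sub>C v0 + w" using hyperplane_decomp[of v] by blast
  then have "proj v = w" by (simp add: proj_eq)
  with w show "\<exists>c. v = c *\<^sub>C v0 + proj v" "proj v \<in> h" by auto
qed

lemma proj_h: "w \<in> h \<Longrightarrow> proj w = w"
  using proj_eq[of w 0] by simp

lemma proj_add: "proj (x + y) = proj x + proj y"
proof -
  obtain a b where "x = a *\<^sub>C v0 + proj x" "y = b *\<^sub>C v0 + proj y" using proj_decomp by blast
  then have "x + y = (a *\<^sub>C v0 + proj x) + (b *\<^sub>C v0 + proj y)" by simp
  then have "x + y = (a + b) *\<^sub>C v0 + (proj x + proj y)"
    by (simp only: scaleC_add_left add.assoc add.left_commute)
  moreover have "proj x + proj y \<in> h"
    using subspace_h by (simp add: complex_vector.subspace_add proj_in)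
  ultimately show ?thesis by (simp only: proj_eq)
qed

lemma proj_scaleC: "proj (c *\<^sub>C x) = c *\<^sub>C proj x"
proof -
  obtain a where "x = a *\<^sub>C v0 + proj x" using proj_decomp by blast
  then have "c *\<^sub>C x = c *\<^sub>C (a *\<^sub>C v0 + proj x)" by simp
  then have "c *\<^sub>C x = (c * a) *\<^sub>C v0 + c *\<^sub>C proj x"
    by (simp only: scaleC_add_right scaleC_scaleC)
  moreover have "c *\<^sub>C proj x \<in> h" using subspace_h by (simp add: complex_vector.subspace_scale proj_in)
  ultimately show ?thesis by (simp only: proj_eq)
qed

lemma proj_v0: "proj (c *\<^sub>C v0) = 0"
  using proj_eq[of 0 c] subspace_h by (simp add: complex_vector.subspace_0)

lemma proj_linear: "complex_linear_on UNIV proj h"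
  by (auto simp: complex_linear_on_def proj_in proj_add proj_scaleC)

lemma rho_eq_pull_back: "rho \<eta> = pull_back UNIV proj \<eta>"
  by (simp add: immersion_def pull_back_def)

lemma rho_wedge: "rho (\<omega> \<and>\<^sub>\<Lambda> \<zeta>) = rho \<omega> \<and>\<^sub>\<Lambda> rho \<zeta>"
  by (simp add: rho_eq_pull_back pull_back_wedge)

lemma rho_add: "rho (\<omega> + \<zeta>) = rho \<omega> + rho \<zeta>"
  by (simp add: rho_eq_pull_back pull_back_add)

lemma rho_scaleC: "rho (c *\<^sub>C \<omega>) = c *\<^sub>C rho \<omega>"
  by (simp add: rho_eq_pull_back pull_back_scaleC)

lemma rho_0 [simp]: "rho 0 = 0"
  by (simp add: rho_eq_pull_back)

lemma rho_cnj_form: "rho (cnj_form \<omega>) = cnj_form (rho \<omega>)"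
  by (simp add: rho_eq_pull_back pull_back_cnj_form)

lemma rho_wedge_list: "rho (wedge_list \<beta>s) = wedge_list (map rho \<beta>s)"
  by (simp add: rho_eq_pull_back[abs_def] pull_back_wedge_list)

lemma rho_covectors: "\<beta> \<in> covectors h \<Longrightarrow> rho \<beta> \<in> covectors UNIV"
  unfolding rho_eq_pull_back by (rule pull_back_covectors[OF proj_linear]) auto

lemma rho_decomposable: "\<psi> \<in> decomposable h k \<Longrightarrow> rho \<psi> \<in> decomposable UNIV k"
  unfolding rho_eq_pull_back by (rule pull_back_decomposable[OF proj_linear]) auto

lemma rho_forms: "\<omega> \<in> forms h p q \<Longrightarrow> rho \<omega> \<in> forms UNIV p q"
  unfolding rho_eq_pull_back by (rule pull_back_forms[OF proj_linear]) auto

lemma rho_real_forms: "\<omega> \<in> real_forms h p \<Longrightarrow> rho \<omega> \<in> real_forms UNIV p"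
  unfolding rho_eq_pull_back by (rule pull_back_real_forms[OF proj_linear]) auto

lemma homogeneous_rho: "homogeneous k \<omega> \<Longrightarrow> homogeneous k (rho \<omega>)"
  by (simp add: homogeneous_def immersion_def)

text \<open>
  The image of the immersion on covectors is the annihilator of \<open>v0\<close>; hence a
  covector outside that image does not vanish on \<open>v0\<close>.
\<close>

lemma covector_rhoI:
  assumes \<beta>: "\<beta> \<in> covectors UNIV" and "\<beta> [v0] = 0"
  shows "\<beta> \<in> rho ` covectors h"
proof
  have "complex_linear_on h id UNIV" by (simp add: complex_linear_on_def)
  then show "pull_back h id \<beta> \<in> covectors h" using pull_back_covectors subspace_h \<beta> by blast
  show "\<beta> = rho (pull_back h id \<beta>)"
  proof
    fix vs
    have eval: "rho (pull_back h id \<beta>) vs = \<beta> (map proj vs)"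
      by (auto simp: immersion_def pull_back_def proj_in)
    show "\<beta> vs = rho (pull_back h id \<beta>) vs"
    proof (cases "length vs = 1")
      case True
      then obtain v where v: "vs = [v]" by (auto simp: length_Suc_conv)
      obtain c where "v = c *\<^sub>C v0 + proj v" using proj_decomp by blast
      then have "\<beta> [v] = \<beta> [c *\<^sub>C v0 + proj v]" by simp
      also have "\<dots> = \<beta> [proj v]" using assms by (simp add: covectors_def)
      finally show ?thesis using v eval by simp
    next
      case False
      then show ?thesis using \<beta> by (simp add: eval covectors_def)
    qed
  qed
qed

end

locale hyperplane_splitting = complex_hyperplane +
  fixes \<alpha> :: "'a form"
  assumes \<alpha>_covector: "\<alpha> \<in> covectors UNIV" and \<alpha>_v0: "\<alpha> [v0] \<noteq> 0"
begin

abbreviation volume_lift :: "'a form \<Rightarrow> 'a form"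
  where "volume_lift \<omega> \<equiv> \<alpha> \<and>\<^sub>\<Lambda> cnj_form \<alpha> \<and>\<^sub>\<Lambda> rho \<omega>"

abbreviation assemble :: "'a form \<Rightarrow> 'a form \<Rightarrow> 'a form \<Rightarrow> 'a form \<Rightarrow> 'a form"
  where "assemble X E F T \<equiv> rho X + \<alpha> \<and>\<^sub>\<Lambda> rho E + cnj_form \<alpha> \<and>\<^sub>\<Lambda> rho F + volume_lift T"

lemma \<alpha>_homogeneous: "homogeneous 1 \<alpha>"
  using covectors_homogeneous \<alpha>_covector by blast

lemma \<alpha>_square: "\<alpha> \<and>\<^sub>\<Lambda> \<alpha> = 0" "cnj_form \<alpha> \<and>\<^sub>\<Lambda> cnj_form \<alpha> = 0"
  using \<alpha>_homogeneous by (simp_all add: wedge_1_square)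

lemma \<alpha>_square_wedge: "\<alpha> \<and>\<^sub>\<Lambda> \<alpha> \<and>\<^sub>\<Lambda> \<omega> = 0" "cnj_form \<alpha> \<and>\<^sub>\<Lambda> cnj_form \<alpha> \<and>\<^sub>\<Lambda> \<omega> = 0"
  by (simp_all add: \<alpha>_square flip: wedge_assoc)

lemma \<alpha>_swap: "cnj_form \<alpha> \<and>\<^sub>\<Lambda> \<alpha> \<and>\<^sub>\<Lambda> \<omega> = - (\<alpha> \<and>\<^sub>\<Lambda> cnj_form \<alpha> \<and>\<^sub>\<Lambda> \<omega>)"
proof -
  have "cnj_form \<alpha> \<and>\<^sub>\<Lambda> \<alpha> = - (\<alpha> \<and>\<^sub>\<Lambda> cnj_form \<alpha>)"
    using \<alpha>_homogeneous by (intro wedge_1_swap) simp_all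
  then show ?thesis by (simp add: wedge_minus_left flip: wedge_assoc)
qed

lemma wedge_\<alpha>_move:
  assumes "homogeneous k \<omega>"
  shows "\<omega> \<and>\<^sub>\<Lambda> \<alpha> \<and>\<^sub>\<Lambda> \<zeta> = (-1) ^ k *\<^sub>C (\<alpha> \<and>\<^sub>\<Lambda> \<omega> \<and>\<^sub>\<Lambda> \<zeta>)"
    and "\<omega> \<and>\<^sub>\<Lambda> cnj_form \<alpha> \<and>\<^sub>\<Lambda> \<zeta> = (-1) ^ k *\<^sub>C (cnj_form \<alpha> \<and>\<^sub>\<Lambda> \<omega> \<and>\<^sub>\<Lambda> \<zeta>)"
proof -
  have "\<omega> \<and>\<^sub>\<Lambda> \<alpha> = (-1) ^ k *\<^sub>C (\<alpha> \<and>\<^sub>\<Lambda> \<omega>)" "\<omega> \<and>\<^sub>\<Lambda> cnj_form \<alpha> = (-1) ^ k *\<^sub>C (cnj_form \<alpha> \<and>\<^sub>\<Lambda> \<omega>)"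
    using wedge_commute[OF assms \<alpha>_homogeneous] wedge_commute[OF assms, of 1 "cnj_form \<alpha>"] \<alpha>_homogeneous
    by simp_all
  then show "\<omega> \<and>\<^sub>\<Lambda> \<alpha> \<and>\<^sub>\<Lambda> \<zeta> = (-1) ^ k *\<^sub>C (\<alpha> \<and>\<^sub>\<Lambda> \<omega> \<and>\<^sub>\<Lambda> \<zeta>)"
    "\<omega> \<and>\<^sub>\<Lambda> cnj_form \<alpha> \<and>\<^sub>\<Lambda> \<zeta> = (-1) ^ k *\<^sub>C (cnj_form \<alpha> \<and>\<^sub>\<Lambda> \<omega> \<and>\<^sub>\<Lambda> \<zeta>)"
    by (metis wedge_assoc wedge_scaleC_left)+
qed

lemma covectors_UNIV_span: "covectors UNIV \<subseteq> complex_vector.span (insert \<alpha> (rho ` covectors h))"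
proof
  fix \<beta> :: "'a form" assume \<beta>: "\<beta> \<in> covectors UNIV"
  let ?c = "\<beta> [v0] / \<alpha> [v0]"
  have "\<beta> - ?c *\<^sub>C \<alpha> \<in> covectors UNIV"
    using \<beta> \<alpha>_covector subspace_covectors
    by (intro complex_vector.subspace_diff complex_vector.subspace_scale) auto
  then have "\<beta> - ?c *\<^sub>C \<alpha> \<in> rho ` covectors h"
    using \<alpha>_v0 by (intro covector_rhoI) (auto simp: form_apply)
  then show "\<beta> \<in> complex_vector.span (insert \<alpha> (rho ` covectors h))"
    unfolding complex_vector.span_breakdown_eq by (intro exI[of _ ?c] complex_vector.span_base)
qed

lemma subspace_rho_covectors: "complex_vector.subspace (rho ` covectors h)"
proof -
  have "complex_vector.subspace (covectors h)" by (rule subspace_covectors)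
  then show ?thesis
    unfolding complex_vector.subspace_def by (auto simp flip: rho_add rho_scaleC intro: image_eqI[of _ _ 0])
qed

section \<open>Splitting forms along the hyperplane\<close>

text \<open>
  The pivot lemma with direction \<open>\<alpha>\<close> over the covectors of the hyperplane: in
  the pivot factor \<open>\<alpha> + s\<close> the summand \<open>\<alpha>\<close> gives
  \<open>\<psi>1\<close> and the summand \<open>s\<close> gives \<open>\<psi>2\<close>.
\<close>

lemma decomposable_split:
  assumes "\<psi> \<in> decomposable UNIV (Suc k)"
  shows "\<exists>\<psi>2\<in>decomposable h (Suc k). \<exists>\<psi>1\<in>decomposable h k. \<psi> = rho \<psi>2 + \<alpha> \<and>\<^sub>\<Lambda> rho \<psi>1"
proof -
  obtain c \<beta>s where \<psi>: "\<psi> = c *\<^sub>C wedge_list \<beta>s" and \<beta>s: "length \<beta>s = Suc k" "set \<beta>s \<subseteq> covectors UNIV"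
    using assms unfolding decomposable_eq by blast
  have lift: "\<exists>\<delta>s. \<gamma>s = map rho \<delta>s \<and> set \<delta>s \<subseteq> covectors h" if "set \<gamma>s \<subseteq> rho ` covectors h" for \<gamma>s
    using that
  proof (induction \<gamma>s)
    case (Cons \<gamma> \<gamma>s)
    then obtain \<delta> \<delta>s where "\<gamma> = rho \<delta>" "\<delta> \<in> covectors h" "\<gamma>s = map rho \<delta>s" "set \<delta>s \<subseteq> covectors h" by auto
    then show ?case by (intro exI[of _ "\<delta> # \<delta>s"]) simp
  qed simp
  have "set \<beta>s \<subseteq> complex_vector.span (insert \<alpha> (rho ` covectors h))"
    using \<beta>s(2) covectors_UNIV_span by blast
  moreover have "homogeneous 1 s" if "s \<in> rho ` covectors h" for s
    using that rho_covectors covectors_homogeneous by blast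
  ultimately have "(\<exists>\<gamma>s. length \<gamma>s = length \<beta>s \<and> set \<gamma>s \<subseteq> rho ` covectors h \<and> wedge_list \<beta>s = wedge_list \<gamma>s) \<or>
    (\<exists>d s \<gamma>s. s \<in> rho ` covectors h \<and> set \<gamma>s \<subseteq> rho ` covectors h \<and> length \<beta>s = Suc (length \<gamma>s) \<and>
      wedge_list \<beta>s = d *\<^sub>C ((\<alpha> + s) \<and>\<^sub>\<Lambda> wedge_list \<gamma>s))"
    by (intro wedge_list_pivot subspace_rho_covectors \<alpha>_homogeneous)
  then show ?thesis
  proof (elim disjE exE conjE)
    fix \<gamma>s assume inside: "length \<gamma>s = length \<beta>s" "set \<gamma>s \<subseteq> rho ` covectors h" "wedge_list \<beta>s = wedge_list \<gamma>s"
    obtain \<delta>s where \<delta>s: "\<gamma>s = map rho \<delta>s" "set \<delta>s \<subseteq> covectors h" using lift[OF inside(2)] by blast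
    have "c *\<^sub>C wedge_list \<delta>s \<in> decomposable h (Suc k)"
      unfolding decomposable_eq using inside(1) \<beta>s(1) \<delta>s by auto
    moreover have "\<psi> = rho (c *\<^sub>C wedge_list \<delta>s) + \<alpha> \<and>\<^sub>\<Lambda> rho 0"
      by (simp add: \<psi> inside(3) \<delta>s(1) rho_scaleC rho_wedge_list)
    ultimately show ?thesis using zero_decomposable by blast
  next
    fix d s \<gamma>s assume pivot: "s \<in> rho ` covectors h" "set \<gamma>s \<subseteq> rho ` covectors h"
      "length \<beta>s = Suc (length \<gamma>s)" "wedge_list \<beta>s = d *\<^sub>C ((\<alpha> + s) \<and>\<^sub>\<Lambda> wedge_list \<gamma>s)"
    obtain \<delta>s where \<delta>s: "\<gamma>s = map rho \<delta>s" "set \<delta>s \<subseteq> covectors h" using lift[OF pivot(2)] by blast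
    obtain \<sigma> where \<sigma>: "\<sigma> \<in> covectors h" "s = rho \<sigma>" using pivot(1) by blast
    have "(c * d) *\<^sub>C wedge_list (\<sigma> # \<delta>s) \<in> decomposable h (Suc k)"
      unfolding decomposable_eq using pivot(3) \<beta>s(1) \<delta>s \<sigma>(1)
      by (intro CollectI exI[of _ "c * d"] exI[of _ "\<sigma> # \<delta>s"]) simp
    moreover have "(c * d) *\<^sub>C wedge_list \<delta>s \<in> decomposable h k"
      unfolding decomposable_eq using pivot(3) \<beta>s(1) \<delta>s by auto
    moreover have "\<psi> = rho ((c * d) *\<^sub>C wedge_list (\<sigma> # \<delta>s)) + \<alpha> \<and>\<^sub>\<Lambda> rho ((c * d) *\<^sub>C wedge_list \<delta>s)"
      by (simp add: \<psi> pivot(4) \<delta>s(1) \<sigma>(2) rho_scaleC rho_wedge rho_wedge_list wedge_add_left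
          wedge_scaleC_right scaleC_add_right scaleC_scaleC add.commute)
    ultimately show ?thesis by blast
  qed
qed

lemma forms_holomorphic_split:
  assumes "\<eta> \<in> forms UNIV (Suc k) 0"
  shows "\<exists>\<eta>2\<in>forms h (Suc k) 0. \<exists>\<eta>1\<in>forms h k 0. \<eta> = rho \<eta>2 + \<alpha> \<and>\<^sub>\<Lambda> rho \<eta>1"
  using assms unfolding forms_0_eq[of UNIV]
proof (induction rule: form_span_induct)
  case (base s)
  then have "s \<in> decomposable UNIV (Suc k)" unfolding decomposable_def by auto
  then show ?case using decomposable_split decomposable_in_forms by metis
next
  case zero
  show ?case by (rule bexI[of _ 0] bexI[of _ 0])+ (simp_all add: forms_0)
next
  case (add x y)
  then obtain x2 x1 y2 y1 where "x2 \<in> forms h (Suc k) 0" "x1 \<in> forms h k 0" "x = rho x2 + \<alpha> \<and>\<^sub>\<Lambda> rho x1"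
    "y2 \<in> forms h (Suc k) 0" "y1 \<in> forms h k 0" "y = rho y2 + \<alpha> \<and>\<^sub>\<Lambda> rho y1" by metis
  then show ?case
    by (intro bexI[of _ "x2 + y2"] bexI[of _ "x1 + y1"])
      (simp_all add: forms_add rho_add wedge_add_right)
next
  case (scale c x)
  then obtain x2 x1 where "x2 \<in> forms h (Suc k) 0" "x1 \<in> forms h k 0" "x = rho x2 + \<alpha> \<and>\<^sub>\<Lambda> rho x1" by metis
  then show ?case
    by (intro bexI[of _ "c *\<^sub>C x2"] bexI[of _ "c *\<^sub>C x1"])
      (simp_all add: forms_scaleC rho_scaleC wedge_scaleC_right scaleC_add_right)
qed

lemma split_product:
  assumes "homogeneous p \<psi>2" "homogeneous k \<psi>1"
  shows "(rho \<psi>2 + \<alpha> \<and>\<^sub>\<Lambda> rho \<psi>1) \<and>\<^sub>\<Lambda> cnj_form (rho \<phi>2 + \<alpha> \<and>\<^sub>\<Lambda> rho \<phi>1) =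
    assemble (\<psi>2 \<and>\<^sub>\<Lambda> cnj_form \<phi>2) (\<psi>1 \<and>\<^sub>\<Lambda> cnj_form \<phi>2) ((-1) ^ p *\<^sub>C (\<psi>2 \<and>\<^sub>\<Lambda> cnj_form \<phi>1)) ((-1) ^ k *\<^sub>C (\<psi>1 \<and>\<^sub>\<Lambda> cnj_form \<phi>1))"
  using wedge_\<alpha>_move(2)[OF homogeneous_rho[OF assms(1)]] wedge_\<alpha>_move(2)[OF homogeneous_rho[OF assms(2)]]
  by (simp add: cnj_form_add cnj_form_wedge wedge_add_left wedge_add_right wedge_assoc rho_wedge rho_cnj_form
      rho_scaleC wedge_scaleC_right add.assoc)

lemma forms_split:
  assumes "\<Omega> \<in> forms UNIV (Suc k) (Suc k)"
  shows "\<exists>X\<in>forms h (Suc k) (Suc k). \<exists>E\<in>forms h k (Suc k). \<exists>F\<in>forms h (Suc k) k. \<exists>T\<in>forms h k k.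
    \<Omega> = assemble X E F T"
  using assms unfolding forms_eq[of UNIV]
proof (induction rule: form_span_induct)
  case (base s)
  then obtain \<beta>s \<gamma>s where s: "s = wedge_list \<beta>s \<and>\<^sub>\<Lambda> cnj_form (wedge_list \<gamma>s)"
    and "length \<beta>s = Suc k" "set \<beta>s \<subseteq> covectors UNIV" "length \<gamma>s = Suc k" "set \<gamma>s \<subseteq> covectors UNIV" by blast
  then have "wedge_list \<beta>s \<in> decomposable UNIV (Suc k)" "wedge_list \<gamma>s \<in> decomposable UNIV (Suc k)"
    unfolding decomposable_def by auto
  then obtain \<psi>2 \<psi>1 \<phi>2 \<phi>1 where
    \<psi>: "\<psi>2 \<in> decomposable h (Suc k)" "\<psi>1 \<in> decomposable h k" "wedge_list \<beta>s = rho \<psi>2 + \<alpha> \<and>\<^sub>\<Lambda> rho \<psi>1" and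
    \<phi>: "\<phi>2 \<in> decomposable h (Suc k)" "\<phi>1 \<in> decomposable h k" "wedge_list \<gamma>s = rho \<phi>2 + \<alpha> \<and>\<^sub>\<Lambda> rho \<phi>1"
    using decomposable_split by metis
  have "homogeneous (Suc k) \<psi>2" "homogeneous k \<psi>1"
    using \<psi> decomposable_in_forms homogeneous_forms by fastforce+
  from split_product[OF this, of \<phi>2 \<phi>1] show ?case
    unfolding s \<psi>(3) \<phi>(3) using \<psi>(1,2) \<phi>(1,2)
    by (meson decomposable_wedge_cnj_in_forms forms_scaleC)
next
  case zero
  show ?case by (rule bexI[of _ 0] bexI[of _ 0])+ (simp_all add: forms_0)
next
  case (add x y)
  from add(1) obtain X E F T where x: "X\<in>forms h (Suc k) (Suc k)" "E\<in>forms h k (Suc k)" "F\<in>forms h (Suc k) k"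
    "T\<in>forms h k k"
    "x = assemble X E F T" by blast
  from add(2) obtain X' E' F' T' where y: "X'\<in>forms h (Suc k) (Suc k)" "E'\<in>forms h k (Suc k)" "F'\<in>forms h (Suc k) k"
    "T'\<in>forms h k k"
    "y = assemble X' E' F' T'" by blast
  show ?case
    by (rule bexI[of _ "X + X'"] bexI[of _ "E + E'"] bexI[of _ "F + F'"] bexI[of _ "T + T'"])+
      (use x y in \<open>simp_all add: forms_add rho_add wedge_add_right\<close>)
next
  case (scale c x)
  from scale obtain X E F T where x: "X\<in>forms h (Suc k) (Suc k)" "E\<in>forms h k (Suc k)" "F\<in>forms h (Suc k) k"
    "T\<in>forms h k k"
    "x = assemble X E F T" by blast
  show ?case
    by (rule bexI[of _ "c *\<^sub>C X"] bexI[of _ "c *\<^sub>C E"] bexI[of _ "c *\<^sub>C F"] bexI[of _ "c *\<^sub>C T"])+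
      (use x in \<open>simp_all add: forms_scaleC rho_scaleC wedge_scaleC_right scaleC_add_right\<close>)
qed

end

section \<open>Reading off the parts of a splitting\<close>

text \<open>
  A form on \<open>h\<close> vanishes on lists with a vector outside \<open>h - {0}\<close>.
  Vanishing outside \<open>h\<close> makes it recoverable from its immersion, and vanishing on
  lists that contain \<open>0\<close> makes every contraction of its immersion with a multiple of
  \<open>v0\<close> zero. Both properties are inherited by products.
\<close>

definition vanishing_off :: "'v set \<Rightarrow> 'v form \<Rightarrow> bool"
  where "vanishing_off A \<omega> \<longleftrightarrow> (\<forall>vs. \<not> set vs \<subseteq> A \<longrightarrow> \<omega> vs = 0)"

lemma vanishing_off_wedge:
  assumes "vanishing_off A \<omega>" "vanishing_off A \<zeta>" shows "vanishing_off A (\<omega> \<and>\<^sub>\<Lambda> \<zeta>)"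
proof -
  have "\<omega> = pull_back A id \<omega>" "\<zeta> = pull_back A id \<zeta>"
    using assms by (auto simp: vanishing_off_def pull_back_def fun_eq_iff)
  then have "\<omega> \<and>\<^sub>\<Lambda> \<zeta> = pull_back A id (\<omega> \<and>\<^sub>\<Lambda> \<zeta>)" by (metis pull_back_wedge)
  moreover have "vanishing_off A (pull_back A id \<xi>)" for \<xi> :: "'a form"
    by (simp add: vanishing_off_def pull_back_def)
  ultimately show ?thesis by metis
qed

lemma vanishing_off_add: "vanishing_off A \<omega> \<Longrightarrow> vanishing_off A \<zeta> \<Longrightarrow> vanishing_off A (\<omega> + \<zeta>)"
  by (simp add: vanishing_off_def form_apply)

lemma vanishing_off_scaleC: "vanishing_off A \<omega> \<Longrightarrow> vanishing_off A (c *\<^sub>C \<omega>)"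
  by (simp add: vanishing_off_def form_apply)

lemma vanishing_off_minus: "vanishing_off A \<omega> \<Longrightarrow> vanishing_off A (- \<omega>)"
  by (simp add: vanishing_off_def form_apply)

lemma vanishing_off_0 [simp]: "vanishing_off A 0"
  by (simp add: vanishing_off_def form_apply)

lemma vanishing_off_cnj_form: "vanishing_off A \<omega> \<Longrightarrow> vanishing_off A (cnj_form \<omega>)"
  by (simp add: vanishing_off_def cnj_form_def)

lemma vanishing_off_wedge_list:
  "(\<And>\<beta>. \<beta> \<in> set \<beta>s \<Longrightarrow> vanishing_off A \<beta>) \<Longrightarrow> vanishing_off A (wedge_list \<beta>s)"
proof (induction \<beta>s)
  case Nil
  then show ?case by (auto simp: vanishing_off_def one_form0_def)
qed (simp add: vanishing_off_wedge)

lemma forms_vanishing_off: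
  assumes "complex_vector.subspace W" "\<omega> \<in> forms W p q" shows "vanishing_off (W - {0}) \<omega>"
proof -
  have cov: "vanishing_off (W - {0}) \<beta>" if \<beta>: "\<beta> \<in> covectors W" for \<beta>
    unfolding vanishing_off_def
  proof (intro allI impI)
    fix vs assume vs: "\<not> set vs \<subseteq> W - {0}"
    show "\<beta> vs = 0"
    proof (cases "length vs = 1 \<and> set vs \<subseteq> W")
      case True
      then have "vs = [0]" using vs by (auto simp: length_Suc_conv)
      then show ?thesis using covector_0[OF \<beta> assms(1)] by simp
    next
      case False
      then show ?thesis using \<beta> by (simp add: covectors_def)
    qed
  qed
  show ?thesis
    using assms(2) unfolding forms_eq
  proof (induction rule: form_span_induct)
    case (base s)
    then show ?case using cov by (auto intro!: vanishing_off_wedge vanishing_off_cnj_form vanishing_off_wedge_list)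
  qed (simp_all add: vanishing_off_add vanishing_off_scaleC)
qed

context complex_hyperplane
begin

abbreviation lives_on_h :: "'v form \<Rightarrow> bool" where "lives_on_h \<equiv> vanishing_off (h - {0})"

lemma vanishing_off_forms: "\<omega> \<in> forms h p q \<Longrightarrow> lives_on_h \<omega>"
  using forms_vanishing_off subspace_h by blast

lemma rho_inj:
  assumes "lives_on_h x" "lives_on_h y" "rho x = rho y"
  shows "x = y"
proof
  fix vs
  show "x vs = y vs"
  proof (cases "set vs \<subseteq> h")
    case True
    then have "map proj vs = vs" by (intro map_idI) (auto simp: proj_h)
    then show ?thesis using fun_cong[OF assms(3), of vs] by (simp add: immersion_def)
  next
    case False
    then have "\<not> set vs \<subseteq> h - {0}" by blast
    then show ?thesis using assms(1,2) unfolding vanishing_off_def by metis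
  qed
qed

lemma rho_minus: "rho (- \<omega>) = - rho \<omega>"
  using rho_scaleC[of "-1" \<omega>] by (simp only: scaleC_minus_one)

end

context hyperplane_splitting
begin

text \<open>
  The section of the projection onto \<open>h\<close> along \<open>v0\<close> whose image is the
  kernel of \<open>\<alpha>\<close>. Pulling back along it removes all terms with a factor
  \<open>\<alpha>\<close> or its conjugate and undoes the immersion.
\<close>

definition section_map :: "'a \<Rightarrow> 'a"
  where "section_map w = w - (\<alpha> [w] / \<alpha> [v0]) *\<^sub>C v0"

definition restrict_ker :: "'a form \<Rightarrow> 'a form"
  where "restrict_ker \<omega> = pull_back h section_map \<omega>"

lemma \<alpha>_add: "\<alpha> [x + y] = \<alpha> [x] + \<alpha> [y]" and \<alpha>_scaleC: "\<alpha> [c *\<^sub>C x] = c * \<alpha> [x]"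
  using \<alpha>_covector by (auto simp: covectors_def)

lemma \<alpha>_other: "length vs \<noteq> 1 \<Longrightarrow> \<alpha> vs = 0"
  using \<alpha>_homogeneous by (simp add: homogeneous_def)

lemma \<alpha>_section_map: "\<alpha> [section_map w] = 0"
proof -
  have "section_map w = w + (- (\<alpha> [w] / \<alpha> [v0])) *\<^sub>C v0"
    by (simp add: section_map_def)
  then show ?thesis using \<alpha>_v0 by (simp only: \<alpha>_add \<alpha>_scaleC) simp
qed

lemma proj_section_map: "w \<in> h \<Longrightarrow> proj (section_map w) = w"
  using proj_eq[of w "- (\<alpha> [w] / \<alpha> [v0])"] by (simp add: section_map_def)

lemma restrict_ker_rho:
  assumes "lives_on_h \<omega>" shows "restrict_ker (rho \<omega>) = \<omega>"
proof
  fix vs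
  show "restrict_ker (rho \<omega>) vs = \<omega> vs"
  proof (cases "set vs \<subseteq> h")
    case True
    then have "map (proj \<circ> section_map) vs = vs" by (intro map_idI) (auto simp: proj_section_map)
    then show ?thesis using True by (simp add: restrict_ker_def pull_back_def immersion_def)
  next
    case False
    then have "\<omega> vs = 0" using assms by (auto simp: vanishing_off_def)
    then show ?thesis using False by (simp add: restrict_ker_def pull_back_def)
  qed
qed

lemma restrict_ker_\<alpha>: "restrict_ker \<alpha> = 0" "restrict_ker (cnj_form \<alpha>) = 0"
proof -
  show *: "restrict_ker \<alpha> = 0"
  proof
    fix vs
    have "\<alpha> (map section_map vs) = 0"
      by (cases "length vs = 1") (auto simp: length_Suc_conv \<alpha>_section_map intro: \<alpha>_other)
    then show "restrict_ker \<alpha> vs = 0 vs" by (simp add: restrict_ker_def pull_back_def form_apply)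
  qed
  then show "restrict_ker (cnj_form \<alpha>) = 0" by (simp add: restrict_ker_def pull_back_cnj_form)
qed

lemma restrict_ker_simps:
  "restrict_ker (\<omega> \<and>\<^sub>\<Lambda> \<zeta>) = restrict_ker \<omega> \<and>\<^sub>\<Lambda> restrict_ker \<zeta>"
  "restrict_ker (\<omega> + \<zeta>) = restrict_ker \<omega> + restrict_ker \<zeta>"
  "restrict_ker (c *\<^sub>C \<omega>) = c *\<^sub>C restrict_ker \<omega>"
  by (simp_all add: restrict_ker_def pull_back_wedge pull_back_add pull_back_scaleC)

lemma restrict_ker_minus: "restrict_ker (- \<omega>) = - restrict_ker \<omega>"
  using restrict_ker_simps(3)[of "-1" \<omega>] by (simp only: scaleC_minus_one)

text \<open>
  For \<open>s = - \<i>\<close> this is twice the contraction with the \<open>(1,0)\<close>-part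
  of \<open>v0\<close>, which annihilates the conjugate of \<open>\<alpha>\<close>; for \<open>s =
  \<i>\<close> it is twice the contraction with the \<open>(0,1)\<close>-part, which annihilates
  \<open>\<alpha>\<close>. Both annihilate the immersed forms.
\<close>

definition contract_v0 :: "complex \<Rightarrow> 'a form \<Rightarrow> 'a form"
  where "contract_v0 s \<omega> = contract v0 \<omega> + s *\<^sub>C contract (\<i> *\<^sub>C v0) \<omega>"

lemma contract_v0_wedge:
  "contract_v0 s (\<omega> \<and>\<^sub>\<Lambda> \<zeta>) = contract_v0 s \<omega> \<and>\<^sub>\<Lambda> \<zeta> + grade_involution \<omega> \<and>\<^sub>\<Lambda> contract_v0 s \<zeta>"
  by (simp add: contract_v0_def contract_wedge wedge_add_left wedge_add_right wedge_scaleC_left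
      wedge_scaleC_right scaleC_add_right)

lemma contract_v0_add: "contract_v0 s (\<omega> + \<zeta>) = contract_v0 s \<omega> + contract_v0 s \<zeta>"
  by (simp add: contract_v0_def contract_add scaleC_add_right)

lemma contract_v0_scaleC: "contract_v0 s (c *\<^sub>C \<omega>) = c *\<^sub>C contract_v0 s \<omega>"
  by (simp add: contract_v0_def contract_scaleC scaleC_add_right scaleC_scaleC mult.commute)

lemma contract_v0_rho:
  assumes "lives_on_h \<omega>" shows "contract_v0 s (rho \<omega>) = 0"
proof -
  have "\<omega> (0 # vs) = 0" for vs using assms by (auto simp: vanishing_off_def)
  then have "contract (c *\<^sub>C v0) (rho \<omega>) = 0" for c
    by (simp add: contract_def immersion_def proj_v0 fun_eq_iff form_apply)
  from this[of 1] this[of \<i>] show ?thesis by (simp add: contract_v0_def)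
qed

lemma contract_v0_\<alpha>:
  "contract_v0 (-\<i>) \<alpha> = (2 * \<alpha> [v0]) *\<^sub>C one_form0" "contract_v0 \<i> \<alpha> = 0"
  "contract_v0 (-\<i>) (cnj_form \<alpha>) = 0" "contract_v0 \<i> (cnj_form \<alpha>) = (2 * cnj (\<alpha> [v0])) *\<^sub>C one_form0"
proof -
  have hol: "contract v \<alpha> = \<alpha> [v] *\<^sub>C one_form0" for v
  proof
    show "contract v \<alpha> vs = (\<alpha> [v] *\<^sub>C one_form0) vs" for vs
      by (cases vs) (simp_all add: contract_def one_form0_def form_apply \<alpha>_other)
  qed
  have anti: "contract v (cnj_form \<alpha>) = cnj (\<alpha> [v]) *\<^sub>C one_form0" for v
  proof -
    have "contract v (cnj_form \<alpha>) = cnj_form (contract v \<alpha>)"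
      by (simp add: contract_def cnj_form_def)
    then show ?thesis by (simp add: hol cnj_form_scaleC)
  qed
  have hol': "contract_v0 s \<alpha> = (\<alpha> [v0] + s * (\<i> * \<alpha> [v0])) *\<^sub>C one_form0"
    and anti': "contract_v0 s (cnj_form \<alpha>) = (cnj (\<alpha> [v0]) + s * cnj (\<i> * \<alpha> [v0])) *\<^sub>C one_form0" for s
    by (simp_all only: contract_v0_def hol anti \<alpha>_scaleC scaleC_scaleC scaleC_add_left)
  show "contract_v0 (-\<i>) \<alpha> = (2 * \<alpha> [v0]) *\<^sub>C one_form0" "contract_v0 \<i> \<alpha> = 0"
    "contract_v0 (-\<i>) (cnj_form \<alpha>) = 0" "contract_v0 \<i> (cnj_form \<alpha>) = (2 * cnj (\<alpha> [v0])) *\<^sub>C one_form0"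
    unfolding hol' anti' by simp_all
qed

text \<open>
  Contracting with the \<open>(1,0)\<close>-part of \<open>v0\<close> strips off
  \<open>\<alpha>\<close>, contracting with the \<open>(0,1)\<close>-part strips off its
  conjugate, and the restriction to the kernel of \<open>\<alpha>\<close> removes whatever still
  contains one of them.
\<close>

lemma split_parts:
  assumes van: "lives_on_h X" "lives_on_h E" "lives_on_h F"
    "lives_on_h T"
    and \<Omega>: "\<Omega> = assemble X E F T"
  shows "restrict_ker \<Omega> = X"
    and "restrict_ker (contract_v0 (-\<i>) \<Omega>) = (2 * \<alpha> [v0]) *\<^sub>C E"
    and "restrict_ker (contract_v0 \<i> \<Omega>) = (2 * cnj (\<alpha> [v0])) *\<^sub>C F"
    and "contract_v0 \<i> (contract_v0 (-\<i>) \<Omega>) = (4 * \<alpha> [v0] * cnj (\<alpha> [v0])) *\<^sub>C rho T"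
proof -
  note hom = \<alpha>_homogeneous \<alpha>_homogeneous[folded homogeneous_cnj_form[of 1 \<alpha>]]
  note grade = hom[THEN grade_involution_homogeneous]
  have hol: "contract_v0 (-\<i>) \<Omega> = (2 * \<alpha> [v0]) *\<^sub>C (rho E + cnj_form \<alpha> \<and>\<^sub>\<Lambda> rho T)"
    by (simp add: \<Omega> contract_v0_add contract_v0_wedge contract_v0_rho van contract_v0_\<alpha> wedge_scaleC_left
        scaleC_add_right)
  have anti: "contract_v0 \<i> \<Omega> = (2 * cnj (\<alpha> [v0])) *\<^sub>C (rho F + - (\<alpha> \<and>\<^sub>\<Lambda> rho T))"
    by (simp add: \<Omega> contract_v0_add contract_v0_wedge contract_v0_rho van contract_v0_\<alpha> wedge_scaleC_left
        wedge_scaleC_right complex_vector.scale_right_diff_distrib grade wedge_minus_left)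
  show "restrict_ker \<Omega> = X"
    by (simp add: \<Omega> restrict_ker_simps restrict_ker_\<alpha> restrict_ker_rho van)
  show "restrict_ker (contract_v0 (-\<i>) \<Omega>) = (2 * \<alpha> [v0]) *\<^sub>C E"
    by (simp add: hol restrict_ker_simps restrict_ker_\<alpha> restrict_ker_rho van)
  show "restrict_ker (contract_v0 \<i> \<Omega>) = (2 * cnj (\<alpha> [v0])) *\<^sub>C F"
    unfolding anti restrict_ker_simps restrict_ker_minus by (simp add: restrict_ker_\<alpha> restrict_ker_rho van)
  show "contract_v0 \<i> (contract_v0 (-\<i>) \<Omega>) = (4 * \<alpha> [v0] * cnj (\<alpha> [v0])) *\<^sub>C rho T"
    by (simp add: hol contract_v0_add contract_v0_scaleC contract_v0_wedge contract_v0_rho van contract_v0_\<alpha>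
        wedge_scaleC_left scaleC_scaleC)
qed

lemma split_unique:
  assumes "lives_on_h X" "lives_on_h E" "lives_on_h F"
    "lives_on_h T"
    and "lives_on_h X'" "lives_on_h E'" "lives_on_h F'"
    "lives_on_h T'"
    and "assemble X E F T
      = assemble X' E' F' T'"
  shows "X = X'" "E = E'" "F = F'" "T = T'"
proof -
  note p = split_parts[OF assms(1-4) refl]
  note p' = split_parts[OF assms(5-8) assms(9)]
  show "X = X'" using p(1) p'(1) by simp
  show "E = E'" using p(2) p'(2) \<alpha>_v0 by simp
  show "F = F'" using p(3) p'(3) \<alpha>_v0 by simp
  have "rho T = rho T'" using p(4) p'(4) \<alpha>_v0 by simp
  then show "T = T'" by (rule rho_inj[OF assms(4,8)])
qed

lemma volume_wedge_inj:
  assumes "lives_on_h x" "lives_on_h y"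
    and "volume_lift x = volume_lift y"
  shows "x = y"
  by (rule split_unique(4)[of 0 0 0 x 0 0 0 y]) (use assms in simp_all)

lemma splits_eq:
  "splits v0 h \<alpha> p \<Omega> \<Xi> \<eta> \<theta> \<longleftrightarrow>
    \<Xi> \<in> forms h p p \<and> \<eta> \<in> forms h (p - 1) p \<and> \<theta> \<in> forms h (p - 1) (p - 1) \<and>
    \<Omega> = assemble \<Xi> \<eta> (cnj_form \<eta>) (\<i> *\<^sub>C \<theta>)"
  by (simp add: splits_def rho_cnj_form rho_scaleC wedge_scaleC_right)

lemma splits_vanishing_off:
  assumes "splits v0 h \<alpha> p \<Omega> \<Xi> \<eta> \<theta>"
  shows "lives_on_h \<Xi>" "lives_on_h \<eta>" "lives_on_h (cnj_form \<eta>)"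
    "lives_on_h (\<i> *\<^sub>C \<theta>)"
  using assms vanishing_off_forms[of \<Xi> p p] vanishing_off_forms[of \<eta> "p - 1" p]
    vanishing_off_forms[of \<theta> "p - 1" "p - 1"]
  by (simp_all add: splits_def vanishing_off_cnj_form vanishing_off_scaleC)

lemma splits_unique:
  assumes "splits v0 h \<alpha> p \<Omega> \<Xi> \<eta> \<theta>" "splits v0 h \<alpha> p \<Omega> \<Xi>' \<eta>' \<theta>'"
  shows "\<Xi> = \<Xi>'" "\<eta> = \<eta>'" "\<theta> = \<theta>'"
proof -
  note s = assms[unfolded splits_eq]
  have eq: "assemble \<Xi> \<eta> (cnj_form \<eta>) (\<i> *\<^sub>C \<theta>)
    = assemble \<Xi>' \<eta>' (cnj_form \<eta>') (\<i> *\<^sub>C \<theta>')"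
    by (rule trans[OF s(1)[THEN conjunct2, THEN conjunct2, THEN conjunct2, symmetric]
          s(2)[THEN conjunct2, THEN conjunct2, THEN conjunct2]])
  note u = split_unique[OF splits_vanishing_off[OF assms(1)] splits_vanishing_off[OF assms(2)] eq]
  show "\<Xi> = \<Xi>'" "\<eta> = \<eta>'" "\<theta> = \<theta>'" using u by simp_all
qed

text \<open>
  Conjugating a splitting of a real form gives another splitting of it, so by uniqueness the part
  behind the conjugate of \<open>\<alpha>\<close> is the conjugate of the part behind
  \<open>\<alpha>\<close>.
\<close>

lemma splits_exists:
  assumes "\<Omega> \<in> real_forms UNIV (Suc k)"
  shows "\<exists>\<Xi> \<eta> \<theta>. splits v0 h \<alpha> (Suc k) \<Omega> \<Xi> \<eta> \<theta>"
proof -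
  obtain X E F T where mem: "X \<in> forms h (Suc k) (Suc k)" "E \<in> forms h k (Suc k)" "F \<in> forms h (Suc k) k"
    "T \<in> forms h k k"
    and \<Omega>: "\<Omega> = assemble X E F T"
    using forms_split[OF real_formsD(1)[OF assms]] by blast
  have "cnj_form \<Omega> = assemble (cnj_form X) (cnj_form F) (cnj_form E) (- cnj_form T)"
    unfolding \<Omega> by (simp add: cnj_form_add cnj_form_wedge rho_cnj_form \<alpha>_swap rho_minus wedge_minus_right)
  then have eq: "assemble X E F T
    = assemble (cnj_form X) (cnj_form F) (cnj_form E) (- cnj_form T)"
    using real_formsD(2)[OF assms] \<Omega> by simp
  have van: "lives_on_h X" "lives_on_h E" "lives_on_h F"
    "lives_on_h T"
    using mem vanishing_off_forms by blast+
  have van': "lives_on_h (cnj_form X)" "lives_on_h (cnj_form E)"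
    "lives_on_h (cnj_form F)" "lives_on_h (- cnj_form T)"
    using van by (simp_all add: vanishing_off_cnj_form vanishing_off_minus)
  have "F = cnj_form E" by (rule split_unique(3)[OF van van'(1,3,2,4) eq])
  moreover have "T = \<i> *\<^sub>C (- \<i>) *\<^sub>C T" by (simp add: scaleC_scaleC)
  moreover have "(- \<i>) *\<^sub>C T \<in> forms h k k" using mem(4) by (rule forms_scaleC)
  ultimately have "splits v0 h \<alpha> (Suc k) \<Omega> X E ((- \<i>) *\<^sub>C T)"
    using mem \<Omega> unfolding splits_eq by simp
  then show ?thesis by blast
qed

text \<open>
  Conjugation fixes \<open>\<i> *\<^sub>C (\<alpha> \<and>\<^sub>\<Lambda> cnj_form
  \<alpha>)\<close>, so it acts on the outer parts of a splitting separately.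
\<close>

lemma splits_real:
  assumes "splits v0 h \<alpha> (Suc k) \<Omega> \<Xi> \<eta> \<theta>" "\<Omega> \<in> real_forms UNIV (Suc k)"
  shows "\<Xi> \<in> real_forms h (Suc k)" "\<theta> \<in> real_forms h k"
proof -
  note s = assms(1)[unfolded splits_def]
  have "cnj_form \<Omega> = rho (cnj_form \<Xi>) + \<alpha> \<and>\<^sub>\<Lambda> rho \<eta> + cnj_form \<alpha> \<and>\<^sub>\<Lambda> cnj_form (rho \<eta>)
      + \<i> *\<^sub>C (volume_lift (cnj_form \<theta>))"
    using s by (simp add: cnj_form_add cnj_form_wedge cnj_form_scaleC rho_cnj_form \<alpha>_swap)
  moreover have "cnj_form \<Omega> = \<Omega>" by (rule real_formsD(2)[OF assms(2)])
  moreover have "cnj_form \<Xi> \<in> forms h (Suc k) (Suc k)" "cnj_form \<theta> \<in> forms h k k"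
    using s by (simp_all add: forms_cnj_form)
  ultimately have "splits v0 h \<alpha> (Suc k) \<Omega> (cnj_form \<Xi>) \<eta> (cnj_form \<theta>)"
    using s unfolding splits_def by simp
  from splits_unique[OF this assms(1)] show "\<Xi> \<in> real_forms h (Suc k)" "\<theta> \<in> real_forms h k"
    using s by (simp_all add: real_forms_def)
qed

lemma volume_wedge_real_forms:
  assumes "\<theta> \<in> real_forms h k"
  shows "\<i> *\<^sub>C (volume_lift \<theta>) \<in> real_forms UNIV (Suc k)"
proof (rule real_formsI)
  have a: "\<alpha> \<in> forms UNIV 1 0" using \<alpha>_covector by (simp only: forms_1_0)
  have "volume_lift \<theta> \<in> forms UNIV (1 + (0 + k)) (0 + (1 + k))"
    by (intro forms_wedge a forms_cnj_form rho_forms real_formsD(1)[OF assms])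
  then show "\<i> *\<^sub>C (volume_lift \<theta>) \<in> forms UNIV (Suc k) (Suc k)"
    by (simp add: forms_scaleC)
  show "cnj_form (\<i> *\<^sub>C (volume_lift \<theta>)) = \<i> *\<^sub>C (volume_lift \<theta>)"
    by (simp add: cnj_form_scaleC cnj_form_wedge \<alpha>_swap real_formsD(2)[OF assms] flip: rho_cnj_form)
qed

section \<open>Top forms on the space and on the hyperplane\<close>

lemma h_coframe: "\<exists>bs. coframe h bs \<and> length bs = m"
  using coframe_exists subspace_h dim_h dim_pos by blast

lemma forms_above_dim:
  assumes "\<omega> \<in> forms h a b" "m < a \<or> m < b" shows "\<omega> = 0"
proof -
  obtain bs where bs: "coframe h bs" "length bs = m" using h_coframe by blast
  have zero: "wedge_list \<beta>s = 0" if "set \<beta>s \<subseteq> covectors h" "m < length \<beta>s" for \<beta>s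
    using wedge_list_top_degree(1)[of bs \<beta>s] coframe_homogeneous[OF bs(1)] bs that
    by (simp add: coframe_def)
  show ?thesis
    using assms(1) unfolding forms_eq
    by (induction rule: form_span_induct) (use zero assms(2) in auto)
qed

lemma span_rho_image: "x \<in> complex_vector.span (rho ` A) \<Longrightarrow> x \<in> rho ` complex_vector.span A"
proof (induction rule: form_span_induct)
  case (base s)
  then show ?case using complex_vector.span_base by blast
next
  case zero
  show ?case by (rule image_eqI[of _ _ 0]) (simp_all add: complex_vector.span_zero)
next
  case (add x y)
  then obtain x' y' where "x' \<in> complex_vector.span A" "x = rho x'" "y' \<in> complex_vector.span A" "y = rho y'"
    by blast
  then show ?case by (intro image_eqI[of _ _ "x' + y'"]) (simp_all add: rho_add complex_vector.span_add)
next
  case (scale c x)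
  then obtain x' where "x' \<in> complex_vector.span A" "x = rho x'" by blast
  then show ?case by (intro image_eqI[of _ _ "c *\<^sub>C x'"]) (simp_all add: rho_scaleC complex_vector.span_scale)
qed

lemma rho_span: "x \<in> complex_vector.span A \<Longrightarrow> rho x \<in> complex_vector.span (rho ` A)"
  by (induction rule: form_span_induct)
    (auto simp: rho_add rho_scaleC intro: complex_vector.span_base complex_vector.span_zero
      complex_vector.span_add complex_vector.span_scale)

lemma coframe_lift:
  assumes bs: "coframe h bs" shows "coframe UNIV (\<alpha> # map rho bs)"
proof -
  let ?S = "complex_vector.span (set (\<alpha> # map rho bs))"
  have in_cov: "x \<in> covectors h" if "x \<in> complex_vector.span (set bs)" for x
    using bs that by (simp add: coframe_def)
  have van: "lives_on_h x" if "x \<in> covectors h" for x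
    using that vanishing_off_forms[of x 1 0] by (simp only: forms_1_0)
  have inj: "x = y" if "x \<in> covectors h" "y \<in> covectors h" "rho x = rho y" for x y
    by (rule rho_inj[OF van[OF that(1)] van[OF that(2)] that(3)])
  have \<alpha>: "\<alpha> \<notin> complex_vector.span (rho ` set bs)"
  proof
    assume "\<alpha> \<in> complex_vector.span (rho ` set bs)"
    then obtain x where "x \<in> covectors h" "\<alpha> = rho x" using span_rho_image in_cov by blast
    moreover have "rho x [v0] = 0" if "x \<in> covectors h"
      using van[OF that] proj_v0[of 1] by (auto simp: immersion_def vanishing_off_def)
    ultimately show False using \<alpha>_v0 by simp
  qed
  have indep: "complex_vector.independent (rho ` set bs)"
    unfolding complex_vector.dependent_def
  proof (safe)
    fix b assume b: "b \<in> set bs" "rho b \<in> complex_vector.span (rho ` set bs - {rho b})"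
    have "rho ` set bs - {rho b} \<subseteq> rho ` (set bs - {b})" by blast
    then have "rho b \<in> complex_vector.span (rho ` (set bs - {b}))"
      using b(2) complex_vector.span_mono by blast
    then obtain x where x: "x \<in> complex_vector.span (set bs - {b})" "rho b = rho x"
      using span_rho_image by blast
    then have "x \<in> complex_vector.span (set bs)" using complex_vector.span_mono[of "set bs - {b}" "set bs"] by blast
    then have "b = x" by (rule inj[OF coframe_covectors[OF bs b(1)] in_cov x(2)])
    moreover have "complex_vector.independent (set bs)" using bs by (simp add: coframe_def)
    ultimately show False using x(1) b(1) complex_vector.dependent_def[of "set bs"] by blast
  qed
  show ?thesis
    unfolding coframe_def
  proof (intro conjI)
    have "inj_on rho (set bs)"
    proof (rule inj_onI)
      fix x y assume xy: "x \<in> set bs" "y \<in> set bs" "rho x = rho y"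
      show "x = y"
        by (rule inj[OF coframe_covectors[OF bs xy(1)] coframe_covectors[OF bs xy(2)] xy(3)])
    qed
    moreover have "\<alpha> \<notin> rho ` set bs" using \<alpha> complex_vector.span_base[of \<alpha> "rho ` set bs"] by argo
    ultimately show "distinct (\<alpha> # map rho bs)" using bs by (simp add: distinct_map coframe_def)
    show "complex_vector.independent (set (\<alpha> # map rho bs))"
      using complex_vector.independent_insertI[OF \<alpha> indep] by simp
    show "?S = covectors UNIV"
    proof
      have "set (\<alpha> # map rho bs) \<subseteq> covectors UNIV"
        using \<alpha>_covector rho_covectors coframe_covectors[OF bs] by auto
      then show "?S \<subseteq> covectors UNIV"
        by (rule complex_vector.span_minimal) (rule subspace_covectors)
      have "rho ` covectors h \<subseteq> complex_vector.span (rho ` set bs)"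
        using rho_span bs by (auto simp: coframe_def)
      moreover have "complex_vector.span (rho ` set bs) \<subseteq> ?S"
        by (rule complex_vector.span_mono) auto
      moreover have "\<alpha> \<in> ?S" by (rule complex_vector.span_base) simp
      ultimately have "insert \<alpha> (rho ` covectors h) \<subseteq> ?S" by blast
      then have "complex_vector.span (insert \<alpha> (rho ` covectors h)) \<subseteq> ?S"
        by (rule complex_vector.span_minimal) (rule complex_vector.subspace_span)
      then show "covectors UNIV \<subseteq> ?S"
        using covectors_UNIV_span by blast
    qed
  qed
qed

lemma volume_form_lift: "volume_form (\<alpha> # map rho bs) = \<i> *\<^sub>C (volume_lift (volume_form bs))"
  by (simp add: volume_form_def rho_wedge_list wedge_scaleC_left wedge_assoc comp_def rho_scaleC rho_wedge
      rho_cnj_form)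

text \<open>
  In the coframe of the space that consists of \<open>\<alpha>\<close> and an immersed coframe of
  \<open>h\<close>, the volume form is \<open>\<i> *\<^sub>C (\<alpha> \<and>\<^sub>\<Lambda>
  cnj_form \<alpha>)\<close> times the immersed volume form of \<open>h\<close>.
\<close>

lemma nonneg_top_lift:
  assumes "lives_on_h x"
  shows "nonneg_top UNIV (\<i> *\<^sub>C (volume_lift x)) \<longleftrightarrow> nonneg_top h x"
proof -
  obtain bs where bs: "coframe h bs" using h_coframe by blast
  have "lives_on_h b" if "b \<in> set bs" for b
    using vanishing_off_forms[of b 1 0] coframe_covectors[OF bs that] by (simp only: forms_1_0)
  then have "lives_on_h (volume_form bs)"
    unfolding volume_form_def
    by (auto intro!: vanishing_off_wedge_list vanishing_off_scaleC vanishing_off_wedge vanishing_off_cnj_form)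
  then have van: "lives_on_h (complex_of_real r *\<^sub>C volume_form bs)" for r
    by (rule vanishing_off_scaleC)
  have "\<i> *\<^sub>C (volume_lift x) = complex_of_real r *\<^sub>C volume_form (\<alpha> # map rho bs) \<longleftrightarrow>
    x = complex_of_real r *\<^sub>C volume_form bs" for r
  proof -
    have "complex_of_real r *\<^sub>C volume_form (\<alpha> # map rho bs)
        = \<i> *\<^sub>C (volume_lift (complex_of_real r *\<^sub>C volume_form bs))"
      unfolding volume_form_lift by (simp add: rho_scaleC wedge_scaleC_right scaleC_scaleC mult.commute)
    then show ?thesis using volume_wedge_inj[OF assms van[of r]] by auto
  qed
  then show ?thesis unfolding nonneg_top_iff[OF bs] nonneg_top_iff[OF coframe_lift[OF bs]] by simp
qed

end

section \<open>The three cones\<close>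

text \<open>
  The Hermitian and the weak cone differ only in the space \<open>T\<close> of test forms, and the
  arguments for them use only how test forms split along the hyperplane.
\<close>

definition dual_positive ::
    "('v::complex_vector set \<Rightarrow> nat \<Rightarrow> 'v form set) \<Rightarrow> 'v set \<Rightarrow> nat \<Rightarrow> 'v form set"
  where "dual_positive T W p = {\<Omega> \<in> real_forms W p. \<forall>\<eta>\<in>T W (complex_vector.dim W - p).
    nonneg_top W (\<i> ^ ((complex_vector.dim W - p)\<^sup>2) *\<^sub>C (\<Omega> \<and>\<^sub>\<Lambda> \<eta> \<and>\<^sub>\<Lambda> cnj_form \<eta>))}"

definition test_forms :: "('v::complex_vector set \<Rightarrow> nat \<Rightarrow> 'v form set) \<Rightarrow> bool"
  where "test_forms T \<longleftrightarrow> T = (\<lambda>W k. forms W k 0) \<or> T = decomposable"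

lemma HP_eq: "HP = dual_positive (\<lambda>W k. forms W k 0)"
  by (simp add: fun_eq_iff HP_def dual_positive_def)

lemma WP_eq: "WP = dual_positive decomposable"
  by (simp add: fun_eq_iff WP_def dual_positive_def)

lemma test_forms_subset: "test_forms T \<Longrightarrow> \<eta> \<in> T W k \<Longrightarrow> \<eta> \<in> forms W k 0"
  using decomposable_in_forms by (auto simp: test_forms_def)

lemma dual_positive_add:
  assumes "\<Omega> \<in> dual_positive T W p" "\<Omega>' \<in> dual_positive T W p"
  shows "\<Omega> + \<Omega>' \<in> dual_positive T W p"
  using assms
  by (auto simp: dual_positive_def real_forms_add wedge_add_left scaleC_add_right intro: nonneg_top_add)

lemma dual_positive_scale:
  assumes "\<Omega> \<in> dual_positive T W p" "0 \<le> r"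
  shows "complex_of_real r *\<^sub>C \<Omega> \<in> dual_positive T W p"
proof -
  have "nonneg_top W (a *\<^sub>C ((complex_of_real r *\<^sub>C \<Omega>) \<and>\<^sub>\<Lambda> \<eta> \<and>\<^sub>\<Lambda> cnj_form \<eta>))"
    if "nonneg_top W (a *\<^sub>C (\<Omega> \<and>\<^sub>\<Lambda> \<eta> \<and>\<^sub>\<Lambda> cnj_form \<eta>))" for a \<eta>
    using nonneg_top_scale[OF that assms(2)]
    by (simp only: wedge_scaleC_left scaleC_scaleC mult.commute)
  then show ?thesis using assms(1) by (simp add: dual_positive_def real_forms_scale)
qed

lemma hermitian_square_real_forms:
  assumes "\<psi> \<in> decomposable W p" shows "hermitian_square p \<psi> \<in> real_forms W p"
proof (rule real_formsI)
  show "hermitian_square p \<psi> \<in> forms W p p"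
    using decomposable_wedge_cnj_in_forms[OF assms assms] by (simp add: hermitian_square_def forms_scaleC)
  show "cnj_form (hermitian_square p \<psi>) = hermitian_square p \<psi>"
    using homogeneous_forms[OF decomposable_in_forms[OF assms]] by (simp add: cnj_form_hermitian_square)
qed

lemma sum_hermitian_square_real_forms:
  "set \<psi>s \<subseteq> decomposable W p \<Longrightarrow> (\<Sum>\<psi>\<leftarrow>\<psi>s. hermitian_square p \<psi>) \<in> real_forms W p"
  by (induction \<psi>s) (simp_all add: real_forms_0 real_forms_add hermitian_square_real_forms)

lemma SP_eq: "SP W p = {\<Sum>\<psi>\<leftarrow>\<psi>s. hermitian_square p \<psi> |\<psi>s. set \<psi>s \<subseteq> decomposable W p}"
proof -
  have "c *\<^sub>C (\<Sum>\<psi>\<leftarrow>\<psi>s. f \<psi>) = (\<Sum>\<psi>\<leftarrow>\<psi>s. c *\<^sub>C f \<psi>)" for c \<psi>s and f :: "'a form \<Rightarrow> 'a form"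
    by (induction \<psi>s) (simp_all add: scaleC_add_right)
  then show ?thesis
    using sum_hermitian_square_real_forms[of _ W p] by (auto simp: SP_def hermitian_square_def)
qed

lemma SP_real_forms: "\<Omega> \<in> SP W p \<Longrightarrow> \<Omega> \<in> real_forms W p"
  by (simp add: SP_def)

lemma SP_0: "0 \<in> SP W p"
  unfolding SP_eq by (intro CollectI exI[of _ "[]"]) simp

lemma SP_add:
  assumes "\<Omega> \<in> SP W p" "\<Omega>' \<in> SP W p" shows "\<Omega> + \<Omega>' \<in> SP W p"
proof -
  obtain \<psi>s \<phi>s where "\<Omega> = (\<Sum>\<psi>\<leftarrow>\<psi>s. hermitian_square p \<psi>)" "set \<psi>s \<subseteq> decomposable W p"
    "\<Omega>' = (\<Sum>\<psi>\<leftarrow>\<phi>s. hermitian_square p \<psi>)" "set \<phi>s \<subseteq> decomposable W p"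
    using assms unfolding SP_eq by blast
  then show ?thesis unfolding SP_eq by (intro CollectI exI[of _ "\<psi>s @ \<phi>s"]) simp
qed

lemma SP_scale:
  assumes "\<Omega> \<in> SP W p" "0 \<le> r" shows "complex_of_real r *\<^sub>C \<Omega> \<in> SP W p"
proof -
  obtain \<psi>s where "\<Omega> = (\<Sum>\<psi>\<leftarrow>\<psi>s. hermitian_square p \<psi>)" "set \<psi>s \<subseteq> decomposable W p"
    using assms unfolding SP_eq by blast
  moreover have "complex_of_real r *\<^sub>C (\<Sum>\<psi>\<leftarrow>\<psi>s. hermitian_square p \<psi>)
      = (\<Sum>\<psi>\<leftarrow>map (scaleC (complex_of_real (sqrt r))) \<psi>s. hermitian_square p \<psi>)"
    using assms(2) by (induction \<psi>s) (simp_all add: scaleC_add_right hermitian_square_scaleC)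
  ultimately show ?thesis unfolding SP_eq
    by (intro CollectI exI[of _ "map (scaleC (complex_of_real (sqrt r))) \<psi>s"])
      (auto intro: decomposable_scaleC)
qed

lemma hermitian_square_SP: "\<psi> \<in> decomposable W p \<Longrightarrow> hermitian_square p \<psi> \<in> SP W p"
  unfolding SP_eq by (intro CollectI exI[of _ "[\<psi>]"]) simp

lemma SP_induct [consumes 1, case_names zero add]:
  assumes "\<Omega> \<in> SP W p" "P 0"
    and "\<And>\<psi> \<Omega>. \<psi> \<in> decomposable W p \<Longrightarrow> \<Omega> \<in> SP W p \<Longrightarrow> P \<Omega> \<Longrightarrow> P (hermitian_square p \<psi> + \<Omega>)"
  shows "P \<Omega>"
proof -
  obtain \<psi>s where "\<Omega> = (\<Sum>\<psi>\<leftarrow>\<psi>s. hermitian_square p \<psi>)" "set \<psi>s \<subseteq> decomposable W p"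
    using assms(1) unfolding SP_eq by blast
  moreover have "(\<Sum>\<psi>\<leftarrow>\<psi>s. hermitian_square p \<psi>) \<in> SP W p \<and> P (\<Sum>\<psi>\<leftarrow>\<psi>s. hermitian_square p \<psi>)"
    using \<open>set \<psi>s \<subseteq> decomposable W p\<close>
    by (induction \<psi>s) (simp_all add: SP_0 SP_add hermitian_square_SP assms(2,3))
  ultimately show ?thesis by simp
qed

lemma pull_back_SP:
  assumes "complex_linear_on W f W'" "complex_vector.subspace W" "\<Omega> \<in> SP W' p"
  shows "pull_back W f \<Omega> \<in> SP W p"
  using assms(3)
proof (induction rule: SP_induct)
  case zero
  then show ?case by (simp add: SP_0)
next
  case (add \<psi> \<Omega>)
  have "pull_back W f (hermitian_square p \<psi>) = hermitian_square p (pull_back W f \<psi>)"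
    by (simp add: hermitian_square_def pull_back_scaleC pull_back_wedge pull_back_cnj_form)
  then show ?case
    using add by (simp add: pull_back_add SP_add hermitian_square_SP pull_back_decomposable[OF assms(1,2)])
qed

context hyperplane_splitting
begin

lemma rho_SP: "\<Omega> \<in> SP h p \<Longrightarrow> rho \<Omega> \<in> SP UNIV p"
  unfolding rho_eq_pull_back by (rule pull_back_SP[OF proj_linear]) auto

lemma \<alpha>_wedge_rho_decomposable:
  assumes "\<psi> \<in> decomposable h k" shows "\<alpha> \<and>\<^sub>\<Lambda> rho \<psi> \<in> decomposable UNIV (Suc k)"
proof -
  obtain c \<beta>s where \<psi>: "\<psi> = c *\<^sub>C wedge_list \<beta>s" "length \<beta>s = k" "set \<beta>s \<subseteq> covectors h"
    using assms unfolding decomposable_eq by blast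
  then have "\<alpha> \<and>\<^sub>\<Lambda> rho \<psi> = c *\<^sub>C wedge_list (\<alpha> # map rho \<beta>s)"
    by (simp add: rho_scaleC rho_wedge_list wedge_scaleC_right)
  moreover have "set (\<alpha> # map rho \<beta>s) \<subseteq> covectors UNIV"
    using \<psi>(3) \<alpha>_covector rho_covectors by auto
  ultimately show ?thesis
    unfolding decomposable_eq using \<psi>(2)
    by (intro CollectI exI[of _ c] exI[of _ "\<alpha> # map rho \<beta>s"]) simp
qed

lemma volume_wedge_SP:
  assumes "\<theta> \<in> SP h k" shows "\<i> *\<^sub>C (volume_lift \<theta>) \<in> SP UNIV (Suc k)"
  using assms
proof (induction rule: SP_induct)
  case zero
  then show ?case by (simp add: SP_0)
next
  case (add \<psi> \<theta>)
  have "homogeneous k (rho \<psi>)"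
    using homogeneous_forms[OF decomposable_in_forms[OF add(1)]] by (simp add: homogeneous_rho)
  from hermitian_square_wedge[OF \<alpha>_homogeneous this]
  have "\<i> *\<^sub>C (volume_lift (hermitian_square k \<psi>)) = hermitian_square (Suc k) (\<alpha> \<and>\<^sub>\<Lambda> rho \<psi>)"
    by (simp add: hermitian_square_def[of "Suc 0"] hermitian_square_def[of k] wedge_scaleC_left wedge_scaleC_right
        scaleC_scaleC rho_scaleC rho_wedge rho_cnj_form wedge_assoc mult.commute)
  then show ?case
    using add(3) SP_add[OF hermitian_square_SP[OF \<alpha>_wedge_rho_decomposable[OF add(1)]]]
    by (simp add: rho_add wedge_add_right scaleC_add_right)
qed

text \<open>
  Each decomposable \<open>\<psi>\<close> splits into decomposable parts, and the outer parts of
  the product of \<open>\<psi>\<close> with its conjugate are the Hermitian squares of these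
  parts. The sign from moving \<open>\<psi>1\<close> past the conjugate of \<open>\<alpha>\<close>
  turns \<open>\<i> ^ ((Suc k)\<^sup>2)\<close> into \<open>\<i> * \<i> ^ (k\<^sup>2)\<close>.
\<close>

lemma SP_split:
  assumes "\<Omega> \<in> SP UNIV (Suc k)"
  shows "\<exists>X\<in>SP h (Suc k). \<exists>E\<in>forms h k (Suc k). \<exists>F\<in>forms h (Suc k) k. \<exists>T\<in>SP h k.
    \<Omega> = assemble X E F (\<i> *\<^sub>C T)"
  using assms
proof (induction rule: SP_induct)
  case zero
  show ?case by (rule bexI[of _ 0] bexI[of _ 0])+ (simp_all add: forms_0 SP_0)
next
  case (add \<psi> \<Omega>)
  from add(3) obtain X E F T where \<Omega>: "X\<in>SP h (Suc k)" "E\<in>forms h k (Suc k)" "F\<in>forms h (Suc k) k" "T\<in>SP h k"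
    "\<Omega> = assemble X E F (\<i> *\<^sub>C T)" by blast
  obtain \<psi>2 \<psi>1 where \<psi>: "\<psi>2 \<in> decomposable h (Suc k)" "\<psi>1 \<in> decomposable h k" "\<psi> = rho \<psi>2 + \<alpha> \<and>\<^sub>\<Lambda> rho \<psi>1"
    using decomposable_split[OF add(1)] by blast
  let ?c = "\<i> ^ ((Suc k)\<^sup>2)"
  have "homogeneous (Suc k) \<psi>2" "homogeneous k \<psi>1"
    using homogeneous_forms[OF decomposable_in_forms[OF \<psi>(1)]] homogeneous_forms[OF decomposable_in_forms[OF \<psi>(2)]]
    by simp_all
  note prod = split_product[OF this, of \<psi>2 \<psi>1]
  define E' where "E' = ?c *\<^sub>C (\<psi>1 \<and>\<^sub>\<Lambda> cnj_form \<psi>2)"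
  define F' where "F' = (?c * (-1) ^ Suc k) *\<^sub>C (\<psi>2 \<and>\<^sub>\<Lambda> cnj_form \<psi>1)"
  have mem: "E' \<in> forms h k (Suc k)" "F' \<in> forms h (Suc k) k"
    using \<psi> unfolding E'_def F'_def by (intro forms_scaleC decomposable_wedge_cnj_in_forms; simp)+
  have "?c *\<^sub>C (volume_lift ((-1) ^ k *\<^sub>C (\<psi>1 \<and>\<^sub>\<Lambda> cnj_form \<psi>1)))
    = volume_lift ((?c * (-1) ^ k) *\<^sub>C (\<psi>1 \<and>\<^sub>\<Lambda> cnj_form \<psi>1))"
    by (simp only: rho_scaleC wedge_scaleC_right scaleC_scaleC)
  also have "\<dots> = volume_lift (\<i> *\<^sub>C hermitian_square k \<psi>1)"
    by (simp only: i_power_square_Suc hermitian_square_def scaleC_scaleC)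
  finally have "hermitian_square (Suc k) \<psi> = assemble (hermitian_square (Suc k) \<psi>2) E' F' (\<i> *\<^sub>C hermitian_square k \<psi>1)"
    unfolding hermitian_square_def[of "Suc k"] \<psi>(3) prod E'_def F'_def scaleC_add_right
    by (simp only: rho_scaleC wedge_scaleC_right scaleC_scaleC)
  then show ?case
    by (intro bexI[of _ "hermitian_square (Suc k) \<psi>2 + X"] bexI[of _ "E' + E"] bexI[of _ "F' + F"]
        bexI[of _ "hermitian_square k \<psi>1 + T"])
      (use \<Omega> mem \<psi>(1,2) in \<open>simp_all add: rho_add wedge_add_right scaleC_add_right forms_add SP_add
        hermitian_square_SP\<close>)
qed

lemma SP_components:
  assumes s: "splits v0 h \<alpha> (Suc k) \<Omega> \<Xi> \<eta> \<theta>" and "\<Omega> \<in> SP UNIV (Suc k)"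
  shows "\<Xi> \<in> SP h (Suc k) \<and> \<theta> \<in> SP h k"
proof -
  obtain X E F T where \<Omega>: "X\<in>SP h (Suc k)" "E\<in>forms h k (Suc k)" "F\<in>forms h (Suc k) k" "T\<in>SP h k"
    "\<Omega> = assemble X E F (\<i> *\<^sub>C T)"
    using SP_split[OF assms(2)] by blast
  have van: "lives_on_h X" "lives_on_h E" "lives_on_h F"
    "lives_on_h (\<i> *\<^sub>C T)"
    using \<Omega>(1,4)[THEN SP_real_forms, THEN real_formsD(1), THEN vanishing_off_forms]
      \<Omega>(2,3)[THEN vanishing_off_forms] by (simp_all add: vanishing_off_scaleC)
  have "assemble X E F (\<i> *\<^sub>C T) = assemble \<Xi> \<eta> (cnj_form \<eta>) (\<i> *\<^sub>C \<theta>)"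
    using s[unfolded splits_eq] \<Omega>(5) by simp
  note u = split_unique[OF van splits_vanishing_off[OF s] this]
  have "X = \<Xi>" "\<i> *\<^sub>C T = \<i> *\<^sub>C \<theta>" using u(1,4) by simp_all
  then show ?thesis using \<Omega>(1,4) by simp
qed

text \<open>
  The parts of a test form that contain \<open>\<alpha>\<close> see only \<open>X\<close>, the
  other parts see only \<open>\<theta>\<close>. Since \<open>Suc k + l\<close> is the dimension of
  \<open>h\<close>, the remaining products of immersed forms exceed this dimension in their
  holomorphic or antiholomorphic degree and vanish, or they repeat \<open>\<alpha>\<close>. Only
  the mixed part \<open>E\<close> can pair with both parts of the test form at once, which one of
  the alternatives in the assumption rules out.
\<close>

lemma test_pairing:
  assumes X: "X \<in> forms h (Suc k) (Suc k)" and E: "E \<in> forms h k (Suc k)" and \<theta>: "\<theta> \<in> forms h k k"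
    and \<eta>2: "\<eta>2 \<in> forms h (Suc l) 0" and \<eta>1: "\<eta>1 \<in> forms h l 0" and dim: "Suc k + l = m"
    and \<Omega>: "\<Omega> = assemble X E (cnj_form E) (\<i> *\<^sub>C \<theta>)"
    and zero: "E = 0 \<or> \<eta>1 = 0 \<or> \<eta>2 = 0"
    and \<eta>: "\<eta> = rho \<eta>2 + \<alpha> \<and>\<^sub>\<Lambda> rho \<eta>1"
  shows "\<i> ^ ((Suc l)\<^sup>2) *\<^sub>C (\<Omega> \<and>\<^sub>\<Lambda> \<eta> \<and>\<^sub>\<Lambda> cnj_form \<eta>) = \<i> *\<^sub>C (\<alpha> \<and>\<^sub>\<Lambda> cnj_form \<alpha> \<and>\<^sub>\<Lambda>
    rho (\<i> ^ (l\<^sup>2) *\<^sub>C (X \<and>\<^sub>\<Lambda> \<eta>1 \<and>\<^sub>\<Lambda> cnj_form \<eta>1) + \<i> ^ ((Suc l)\<^sup>2) *\<^sub>C (\<theta> \<and>\<^sub>\<Lambda> \<eta>2 \<and>\<^sub>\<Lambda> cnj_form \<eta>2)))"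
proof -
  define Q22 where "Q22 = \<eta>2 \<and>\<^sub>\<Lambda> cnj_form \<eta>2"
  define Q12 where "Q12 = \<eta>1 \<and>\<^sub>\<Lambda> cnj_form \<eta>2"
  define Q21 where "Q21 = (-1) ^ Suc l *\<^sub>C (\<eta>2 \<and>\<^sub>\<Lambda> cnj_form \<eta>1)"
  define Q11 where "Q11 = \<eta>1 \<and>\<^sub>\<Lambda> cnj_form \<eta>1"
  have "\<eta>2 \<and>\<^sub>\<Lambda> cnj_form \<eta>1 \<in> forms h (Suc l) l"
    using forms_wedge[OF \<eta>2 forms_cnj_form[OF \<eta>1]] by simp
  then have Q: "Q22 \<in> forms h (Suc l) (Suc l)" "Q12 \<in> forms h l (Suc l)" "Q21 \<in> forms h (Suc l) l"
    using forms_wedge[OF \<eta>2 forms_cnj_form[OF \<eta>2]] forms_wedge[OF \<eta>1 forms_cnj_form[OF \<eta>2]]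
    unfolding Q22_def Q12_def Q21_def by (simp_all only: forms_scaleC add_0 add_0_right)
  have "homogeneous (Suc l) \<eta>2" "homogeneous l \<eta>1"
    using homogeneous_forms[OF \<eta>2] homogeneous_forms[OF \<eta>1] by simp_all
  from split_product[OF this, of \<eta>2 \<eta>1]
  have square: "\<eta> \<and>\<^sub>\<Lambda> cnj_form \<eta> = assemble Q22 Q12 Q21 ((-1) ^ l *\<^sub>C Q11)"
    by (simp only: \<eta> Q22_def Q12_def Q21_def Q11_def)
  \<comment> \<open>Products of immersed forms that exceed the dimension of the hyperplane\<close>
  have above: "X \<and>\<^sub>\<Lambda> Q22 = 0" "X \<and>\<^sub>\<Lambda> Q12 = 0" "X \<and>\<^sub>\<Lambda> Q21 = 0" "E \<and>\<^sub>\<Lambda> Q22 = 0" "cnj_form E \<and>\<^sub>\<Lambda> Q22 = 0"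
    using dim by (auto intro!: forms_above_dim[OF forms_wedge[OF X Q(1)]] forms_above_dim[OF forms_wedge[OF X Q(2)]]
      forms_above_dim[OF forms_wedge[OF X Q(3)]] forms_above_dim[OF forms_wedge[OF E Q(1)]]
      forms_above_dim[OF forms_wedge[OF forms_cnj_form[OF E] Q(1)]])
  \<comment> \<open>Products of the mixed part with the cross terms of the test form\<close>
  have mixed: "E \<and>\<^sub>\<Lambda> Q21 = 0" "cnj_form E \<and>\<^sub>\<Lambda> Q12 = 0"
    using zero by (auto simp: Q21_def Q12_def)
  note move = wedge_\<alpha>_move[OF homogeneous_rho[OF homogeneous_forms[OF X]]]
    wedge_\<alpha>_move[OF homogeneous_rho[OF homogeneous_forms[OF E]]]
    wedge_\<alpha>_move[OF homogeneous_rho[OF homogeneous_forms[OF forms_cnj_form[OF E]]]]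
    wedge_\<alpha>_move[OF homogeneous_rho[OF homogeneous_forms[OF \<theta>]]]
  have XQ: "rho X \<and>\<^sub>\<Lambda> (assemble Q22 Q12 Q21 Q)
    = volume_lift (X \<and>\<^sub>\<Lambda> Q)" for Q
    by (simp add: wedge_add_right move wedge_scaleC_right above flip: rho_wedge)
  have EQ: "(\<alpha> \<and>\<^sub>\<Lambda> rho E) \<and>\<^sub>\<Lambda> (assemble Q22 Q12 Q21 Q) = 0" for Q
    by (simp add: wedge_assoc wedge_add_right move wedge_scaleC_right wedge_minus_right \<alpha>_square_wedge above mixed flip: rho_wedge)
  have FQ: "(cnj_form \<alpha> \<and>\<^sub>\<Lambda> rho (cnj_form E)) \<and>\<^sub>\<Lambda>
      (assemble Q22 Q12 Q21 Q) = 0" for Q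
    by (simp add: wedge_assoc wedge_add_right move wedge_scaleC_right \<alpha>_square_wedge \<alpha>_swap wedge_minus_right
        above mixed flip: rho_wedge)
  have TQ: "(volume_lift (\<i> *\<^sub>C \<theta>)) \<and>\<^sub>\<Lambda>
      (assemble Q22 Q12 Q21 Q)
    = \<i> *\<^sub>C (volume_lift (\<theta> \<and>\<^sub>\<Lambda> Q22))" for Q
    by (simp add: wedge_assoc wedge_add_right rho_scaleC move wedge_scaleC_right wedge_scaleC_left \<alpha>_square_wedge
        \<alpha>_swap wedge_minus_right flip: rho_wedge)
  have "\<Omega> \<and>\<^sub>\<Lambda> \<eta> \<and>\<^sub>\<Lambda> cnj_form \<eta> = volume_lift (X \<and>\<^sub>\<Lambda> (-1) ^ l *\<^sub>C Q11)
      + \<i> *\<^sub>C (volume_lift (\<theta> \<and>\<^sub>\<Lambda> Q22))"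
    unfolding \<Omega> square wedge_add_left XQ EQ FQ TQ by simp
  then have "\<i> ^ ((Suc l)\<^sup>2) *\<^sub>C (\<Omega> \<and>\<^sub>\<Lambda> \<eta> \<and>\<^sub>\<Lambda> cnj_form \<eta>) =
      (\<i> ^ ((Suc l)\<^sup>2) * (-1) ^ l) *\<^sub>C (volume_lift (X \<and>\<^sub>\<Lambda> Q11))
      + (\<i> * \<i> ^ ((Suc l)\<^sup>2)) *\<^sub>C (volume_lift (\<theta> \<and>\<^sub>\<Lambda> Q22))"
    by (simp only: scaleC_add_right rho_scaleC wedge_scaleC_right scaleC_scaleC mult.commute)
  then show ?thesis
    unfolding i_power_square_Suc Q11_def Q22_def
    by (simp only: scaleC_add_right rho_add wedge_add_right rho_scaleC wedge_scaleC_right scaleC_scaleC)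
qed

lemma test_forms_rho: "test_forms T \<Longrightarrow> \<eta> \<in> T h k \<Longrightarrow> rho \<eta> \<in> T UNIV k"
  using rho_forms rho_decomposable by (auto simp: test_forms_def)

lemma test_forms_\<alpha>_wedge_rho:
  assumes "test_forms T" "\<eta> \<in> T h k" shows "\<alpha> \<and>\<^sub>\<Lambda> rho \<eta> \<in> T UNIV (Suc k)"
proof -
  have "\<alpha> \<in> forms UNIV 1 0" using \<alpha>_covector by (simp only: forms_1_0)
  then have "\<alpha> \<and>\<^sub>\<Lambda> rho \<eta> \<in> forms UNIV (Suc k) 0" if "\<eta> \<in> forms h k 0"
    using forms_wedge[OF _ rho_forms[OF that], of \<alpha> 1 0] by simp
  then show ?thesis using assms \<alpha>_wedge_rho_decomposable by (auto simp: test_forms_def)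
qed

lemma test_forms_split:
  assumes "test_forms T" "\<eta> \<in> T UNIV (Suc k)"
  shows "\<exists>\<eta>2\<in>T h (Suc k). \<exists>\<eta>1\<in>T h k. \<eta> = rho \<eta>2 + \<alpha> \<and>\<^sub>\<Lambda> rho \<eta>1"
  using assms decomposable_split[of \<eta> k] forms_holomorphic_split[of \<eta> k] by (auto simp: test_forms_def)

lemma vanishing_off_pairing:
  assumes "\<Omega> \<in> forms h p p" "\<eta> \<in> forms h k 0"
  shows "lives_on_h (c *\<^sub>C (\<Omega> \<and>\<^sub>\<Lambda> \<eta> \<and>\<^sub>\<Lambda> cnj_form \<eta>))"
  using assms[THEN vanishing_off_forms]
  by (intro vanishing_off_scaleC vanishing_off_wedge vanishing_off_cnj_form) simp_all

text \<open>
  Test forms of the shape \<open>\<alpha> \<and>\<^sub>\<Lambda> rho \<zeta>\<close> detect the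
  positivity of \<open>\<Xi>\<close>, and immersed test forms detect that of
  \<open>\<theta>\<close>.
\<close>

lemma dual_positive_components:
  assumes T: "test_forms T" and s: "splits v0 h \<alpha> (Suc k) \<Omega> \<Xi> \<eta> \<theta>" and km: "Suc k \<le> m"
    and \<Omega>: "\<Omega> \<in> dual_positive T UNIV (Suc k)"
  shows "\<Xi> \<in> dual_positive T h (Suc k) \<and> \<theta> \<in> dual_positive T h k"
proof -
  define l where "l = m - Suc k"
  have l: "Suc k + l = m" "m - k = Suc l" using km by (simp_all add: l_def)
  have mem: "\<Xi> \<in> forms h (Suc k) (Suc k)" "\<eta> \<in> forms h k (Suc k)" "\<theta> \<in> forms h k k"
    and \<Omega>_eq: "\<Omega> = assemble \<Xi> \<eta> (cnj_form \<eta>) (\<i> *\<^sub>C \<theta>)"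
    using s unfolding splits_eq by simp_all
  have pos: "nonneg_top UNIV (\<i> ^ ((Suc l)\<^sup>2) *\<^sub>C (\<Omega> \<and>\<^sub>\<Lambda> \<zeta> \<and>\<^sub>\<Lambda> cnj_form \<zeta>))" if "\<zeta> \<in> T UNIV (Suc l)" for \<zeta>
    using \<Omega> that l(2) by (simp add: dual_positive_def dim_UNIV)
  have real: "\<Omega> \<in> real_forms UNIV (Suc k)" using \<Omega> by (simp add: dual_positive_def)
  have "nonneg_top h (\<i> ^ (l\<^sup>2) *\<^sub>C (\<Xi> \<and>\<^sub>\<Lambda> \<zeta> \<and>\<^sub>\<Lambda> cnj_form \<zeta>))" if \<zeta>: "\<zeta> \<in> T h l" for \<zeta>
  proof -
    note \<zeta>f = test_forms_subset[OF T \<zeta>]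
    have "\<i> ^ ((Suc l)\<^sup>2) *\<^sub>C (\<Omega> \<and>\<^sub>\<Lambda> (\<alpha> \<and>\<^sub>\<Lambda> rho \<zeta>) \<and>\<^sub>\<Lambda> cnj_form (\<alpha> \<and>\<^sub>\<Lambda> rho \<zeta>))
      = \<i> *\<^sub>C (volume_lift (\<i> ^ (l\<^sup>2) *\<^sub>C (\<Xi> \<and>\<^sub>\<Lambda> \<zeta> \<and>\<^sub>\<Lambda> cnj_form \<zeta>)))"
      using test_pairing[OF mem forms_0 \<zeta>f l(1) \<Omega>_eq _ refl] by simp
    then show ?thesis
      using pos[OF test_forms_\<alpha>_wedge_rho[OF T \<zeta>]] nonneg_top_lift[OF vanishing_off_pairing[OF mem(1) \<zeta>f]]
      by simp
  qed
  moreover have "nonneg_top h (\<i> ^ ((Suc l)\<^sup>2) *\<^sub>C (\<theta> \<and>\<^sub>\<Lambda> \<zeta> \<and>\<^sub>\<Lambda> cnj_form \<zeta>))" if \<zeta>: "\<zeta> \<in> T h (Suc l)" for \<zeta>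
  proof -
    note \<zeta>f = test_forms_subset[OF T \<zeta>]
    have "\<i> ^ ((Suc l)\<^sup>2) *\<^sub>C (\<Omega> \<and>\<^sub>\<Lambda> rho \<zeta> \<and>\<^sub>\<Lambda> cnj_form (rho \<zeta>))
      = \<i> *\<^sub>C (volume_lift (\<i> ^ ((Suc l)\<^sup>2) *\<^sub>C (\<theta> \<and>\<^sub>\<Lambda> \<zeta> \<and>\<^sub>\<Lambda> cnj_form \<zeta>)))"
      using test_pairing[OF mem \<zeta>f forms_0 l(1) \<Omega>_eq _ refl] by simp
    then show ?thesis
      using pos[OF test_forms_rho[OF T \<zeta>]] nonneg_top_lift[OF vanishing_off_pairing[OF mem(3) \<zeta>f]]
      by simp
  qed
  ultimately show ?thesis
    using splits_real[OF s real] l by (simp add: dual_positive_def dim_h l_def)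
qed

lemma dual_positive_combine:
  assumes T: "test_forms T" and s: "splits v0 h \<alpha> (Suc k) \<Omega> \<Xi> 0 \<theta>" and km: "Suc k \<le> m"
    and \<Omega>: "\<Omega> \<in> real_forms UNIV (Suc k)"
    and \<Xi>: "\<Xi> \<in> dual_positive T h (Suc k)" and \<theta>: "\<theta> \<in> dual_positive T h k"
  shows "\<Omega> \<in> dual_positive T UNIV (Suc k)"
proof -
  define l where "l = m - Suc k"
  have l: "Suc k + l = m" "m - k = Suc l" using km by (simp_all add: l_def)
  have mem: "\<Xi> \<in> forms h (Suc k) (Suc k)" "0 \<in> forms h k (Suc k)" "\<theta> \<in> forms h k k"
    and \<Omega>_eq: "\<Omega> = rho \<Xi> + \<alpha> \<and>\<^sub>\<Lambda> rho 0 + cnj_form \<alpha> \<and>\<^sub>\<Lambda> rho (cnj_form 0) + volume_lift (\<i> *\<^sub>C \<theta>)"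
    using s unfolding splits_eq by simp_all
  have "nonneg_top UNIV (\<i> ^ ((Suc l)\<^sup>2) *\<^sub>C (\<Omega> \<and>\<^sub>\<Lambda> \<eta> \<and>\<^sub>\<Lambda> cnj_form \<eta>))" if \<eta>T: "\<eta> \<in> T UNIV (Suc l)" for \<eta>
  proof -
    obtain \<eta>2 \<eta>1 where \<eta>: "\<eta>2 \<in> T h (Suc l)" "\<eta>1 \<in> T h l" "\<eta> = rho \<eta>2 + \<alpha> \<and>\<^sub>\<Lambda> rho \<eta>1"
      using test_forms_split[OF T \<eta>T] by blast
    note \<eta>f = \<eta>(1,2)[THEN test_forms_subset[OF T]]
    have "nonneg_top h (\<i> ^ (l\<^sup>2) *\<^sub>C (\<Xi> \<and>\<^sub>\<Lambda> \<eta>1 \<and>\<^sub>\<Lambda> cnj_form \<eta>1))"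
      "nonneg_top h (\<i> ^ ((Suc l)\<^sup>2) *\<^sub>C (\<theta> \<and>\<^sub>\<Lambda> \<eta>2 \<and>\<^sub>\<Lambda> cnj_form \<eta>2))"
      using \<Xi> \<theta> \<eta>(1,2) l(2) by (simp_all add: dual_positive_def dim_h l_def)
    from nonneg_top_add[OF this] show ?thesis
      unfolding test_pairing[OF mem \<eta>f l(1) \<Omega>_eq disjI1[OF refl] \<eta>(3)]
      using nonneg_top_lift[OF vanishing_off_add[OF vanishing_off_pairing[OF mem(1) \<eta>f(2)]
            vanishing_off_pairing[OF mem(3) \<eta>f(1)]]] by blast
  qed
  then show ?thesis using \<Omega> l(2) by (simp add: dual_positive_def dim_UNIV)
qed

text \<open>
  Pairing a Hermitian square with a test form gives the Hermitian square of a form of top degree.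
\<close>

lemma SP_subset_HP:
  fixes \<Omega> :: "'a form"
  assumes km: "Suc k \<le> m" and "\<Omega> \<in> SP UNIV (Suc k)" shows "\<Omega> \<in> HP UNIV (Suc k)"
proof -
  define l where "l = m - Suc k"
  have l: "m - k = Suc l" using km by (simp add: l_def)
  obtain bs where bs: "coframe h bs" "length bs = m" using h_coframe by blast
  let ?bs = "\<alpha> # map rho bs"
  have co: "coframe UNIV ?bs" by (rule coframe_lift[OF bs(1)])
  have len: "length ?bs = Suc k + Suc l" using bs(2) km by (simp add: l_def)
  have "nonneg_top UNIV (\<i> ^ ((Suc l)\<^sup>2) *\<^sub>C (\<Omega> \<and>\<^sub>\<Lambda> \<eta> \<and>\<^sub>\<Lambda> cnj_form \<eta>))"
    if \<eta>: "\<eta> \<in> forms UNIV (Suc l) 0" for \<eta>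
    using assms(2)
  proof (induction rule: SP_induct)
    case zero
    have "nonneg_top UNIV (0 :: 'a form)" unfolding nonneg_top_iff[OF co] by (intro exI[of _ 0]) simp
    then show ?case by simp
  next
    case (add \<psi> \<Omega>)
    note \<psi> = decomposable_in_forms[OF add(1)]
    have "\<psi> \<and>\<^sub>\<Lambda> \<eta> \<in> forms UNIV (length ?bs) 0"
      using forms_wedge[OF \<psi> \<eta>] len by simp
    from hermitian_square_top_degree[OF co this]
    have "nonneg_top UNIV (hermitian_square (length ?bs) (\<psi> \<and>\<^sub>\<Lambda> \<eta>))"
      unfolding nonneg_top_iff[OF co] .
    moreover have "\<i> ^ ((Suc l)\<^sup>2) *\<^sub>C (hermitian_square (Suc k) \<psi> \<and>\<^sub>\<Lambda> \<eta> \<and>\<^sub>\<Lambda> cnj_form \<eta>)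
        = hermitian_square (length ?bs) (\<psi> \<and>\<^sub>\<Lambda> \<eta>)"
      unfolding len by (rule hermitian_square_wedge) (use homogeneous_forms[OF \<psi>] homogeneous_forms[OF \<eta>] in simp_all)
    ultimately show ?case
      using add(3) by (simp add: wedge_add_left scaleC_add_right nonneg_top_add)
  qed
  then show ?thesis
    unfolding HP_eq using SP_real_forms[OF assms(2)] l by (simp add: dual_positive_def dim_UNIV)
qed

lemma HP_subset_WP: "HP W p \<subseteq> WP W p"
  using decomposable_in_forms by (auto simp: HP_eq WP_eq dual_positive_def)

lemma cone_cases:
  assumes "C \<in> {SP, HP, WP}"
  obtains "C = SP" | T where "test_forms T" "C = dual_positive T"
  using assms by (auto simp: HP_eq WP_eq test_forms_def)

lemma cone_components:
  assumes "C \<in> {SP, HP, WP}" "Suc k \<le> m" "splits v0 h \<alpha> (Suc k) \<Omega> \<Xi> \<eta> \<theta>" "\<Omega> \<in> C UNIV (Suc k)"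
  shows "\<Xi> \<in> C h (Suc k) \<and> \<theta> \<in> C h k"
  using assms(1)
proof (cases rule: cone_cases)
  case 1
  then show ?thesis using SP_components[OF assms(3)] assms(4) by simp
next
  case (2 T)
  then show ?thesis using dual_positive_components[OF _ assms(3,2)] assms(4) by simp
qed

lemma cone_combine:
  assumes "C \<in> {SP, HP, WP}" "Suc k \<le> m" "splits v0 h \<alpha> (Suc k) \<Omega> \<Xi> 0 \<theta>" "\<Omega> \<in> real_forms UNIV (Suc k)"
    "\<Xi> \<in> C h (Suc k)" "\<theta> \<in> C h k"
  shows "\<Omega> \<in> C UNIV (Suc k)"
  using assms(1)
proof (cases rule: cone_cases)
  case 1
  have "\<Omega> = rho \<Xi> + \<i> *\<^sub>C (volume_lift \<theta>)"
    using assms(3) by (simp add: splits_def)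
  then show ?thesis using 1 assms(5,6) by (simp add: SP_add rho_SP volume_wedge_SP)
next
  case (2 T)
  then show ?thesis using dual_positive_combine[OF _ assms(3,2,4)] assms(5,6) by simp
qed

lemma cone_add: "C \<in> {SP, HP, WP} \<Longrightarrow> \<Omega> \<in> C W p \<Longrightarrow> \<Omega>' \<in> C W p \<Longrightarrow> \<Omega> + \<Omega>' \<in> C W p"
  by (auto simp: HP_eq WP_eq SP_add dual_positive_add)

lemma cone_scale: "C \<in> {SP, HP, WP} \<Longrightarrow> \<Omega> \<in> C W p \<Longrightarrow> 0 \<le> r \<Longrightarrow> complex_of_real r *\<^sub>C \<Omega> \<in> C W p"
  by (auto simp: HP_eq WP_eq SP_scale dual_positive_scale)

lemma cone_real_forms: "C \<in> {SP, HP, WP} \<Longrightarrow> \<Omega> \<in> C W p \<Longrightarrow> \<Omega> \<in> real_forms W p"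
  by (auto simp: HP_eq WP_eq SP_real_forms dual_positive_def)

lemma SP_subset_cone:
  fixes C :: "'a set \<Rightarrow> nat \<Rightarrow> 'a form set"
  shows "C \<in> {SP, HP, WP} \<Longrightarrow> Suc k \<le> m \<Longrightarrow> SP UNIV (Suc k) \<subseteq> C UNIV (Suc k)"
  using SP_subset_HP HP_subset_WP by blast

end

section \<open>Finitely many strongly positive generators\<close>

text \<open>
  The coefficients are the fourth roots of unity \<open>s\<close>. In the expansion of the
  right-hand side, \<open>\<Phi> x y\<close> has weight \<open>s * cnj s = 1\<close>, whereas the
  other values have the weights \<open>s\<close> and \<open>s\<^sup>2\<close>, which sum to zero.
\<close>

lemma polarization:
  fixes \<Phi> :: "'a form \<Rightarrow> 'a form \<Rightarrow> 'b form"
  assumes add: "\<And>x y z. \<Phi> (x + y) z = \<Phi> x z + \<Phi> y z" "\<And>x y z. \<Phi> z (x + y) = \<Phi> z x + \<Phi> z y"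
    and scale: "\<And>c x z. \<Phi> (c *\<^sub>C x) z = c *\<^sub>C \<Phi> x z" "\<And>c x z. \<Phi> z (c *\<^sub>C x) = cnj c *\<^sub>C \<Phi> z x"
  shows "4 *\<^sub>C \<Phi> x y = \<Phi> (x + 1 *\<^sub>C y) (x + 1 *\<^sub>C y) + (-1) *\<^sub>C \<Phi> (x + (-1) *\<^sub>C y) (x + (-1) *\<^sub>C y)
    + \<i> *\<^sub>C \<Phi> (x + \<i> *\<^sub>C y) (x + \<i> *\<^sub>C y) + (-\<i>) *\<^sub>C \<Phi> (x + (-\<i>) *\<^sub>C y) (x + (-\<i>) *\<^sub>C y)"
proof -
  have square: "\<Phi> (x + s *\<^sub>C y) (x + s *\<^sub>C y)
      = \<Phi> x x + cnj s *\<^sub>C \<Phi> x y + s *\<^sub>C \<Phi> y x + (s * cnj s) *\<^sub>C \<Phi> y y" for s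
    by (simp only: add scale scaleC_scaleC scaleC_add_right mult.commute add.assoc add.left_commute)
  show ?thesis
    unfolding square by (simp add: fun_eq_iff form_apply algebra_simps)
qed

text \<open>
  Polarization in one pair of factors at a time keeps the forms decomposable; polarizing the whole
  products would not. The prefix \<open>\<delta>s\<close> collects the factors that already agree.
\<close>

lemma wedge_cnj_in_span_hermitian_squares:
  assumes "length \<beta>s = length \<gamma>s" "set \<delta>s \<subseteq> covectors W" "set \<beta>s \<subseteq> covectors W" "set \<gamma>s \<subseteq> covectors W"
    "length \<delta>s + length \<beta>s = p"
  shows "wedge_list (\<delta>s @ \<beta>s) \<and>\<^sub>\<Lambda> cnj_form (wedge_list (\<delta>s @ \<gamma>s))
    \<in> complex_vector.span (hermitian_square p ` decomposable W p)" (is "_ \<in> ?S")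
  using assms
proof (induction \<beta>s \<gamma>s arbitrary: \<delta>s rule: list_induct2)
  case Nil
  have "1 *\<^sub>C wedge_list \<delta>s \<in> decomposable W p" using Nil unfolding decomposable_eq
    by (intro CollectI exI[of _ 1] exI[of _ \<delta>s]) simp
  then have "hermitian_square p (wedge_list \<delta>s) \<in> ?S"
    by (auto intro: complex_vector.span_base simp: scaleC_one)
  then have "(1 / \<i> ^ (p\<^sup>2)) *\<^sub>C hermitian_square p (wedge_list \<delta>s)
      \<in> ?S"
    by (rule complex_vector.span_scale)
  then show ?case by (simp add: hermitian_square_def scaleC_scaleC)
next
  case (Cons \<beta> \<beta>s \<gamma> \<gamma>s)
  define \<Phi> where "\<Phi> x y = wedge_list (\<delta>s @ x # \<beta>s) \<and>\<^sub>\<Lambda> cnj_form (wedge_list (\<delta>s @ y # \<gamma>s))" for x y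
  have diag: "\<Phi> x x \<in> ?S" if "x \<in> covectors W" for x
    using Cons.IH[of "\<delta>s @ [x]"] Cons.prems that by (simp add: \<Phi>_def)
  have "\<beta> + s *\<^sub>C \<gamma> \<in> covectors W" for s
    using Cons.prems subspace_covectors[of W]
    by (simp add: complex_vector.subspace_add complex_vector.subspace_scale)
  then have diag': "\<Phi> (\<beta> + s *\<^sub>C \<gamma>) (\<beta> + s *\<^sub>C \<gamma>) \<in> ?S" for s using diag by blast
  have "4 *\<^sub>C \<Phi> \<beta> \<gamma> = \<Phi> (\<beta> + 1 *\<^sub>C \<gamma>) (\<beta> + 1 *\<^sub>C \<gamma>) + (-1) *\<^sub>C \<Phi> (\<beta> + (-1) *\<^sub>C \<gamma>) (\<beta> + (-1) *\<^sub>C \<gamma>)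
    + \<i> *\<^sub>C \<Phi> (\<beta> + \<i> *\<^sub>C \<gamma>) (\<beta> + \<i> *\<^sub>C \<gamma>) + (-\<i>) *\<^sub>C \<Phi> (\<beta> + (-\<i>) *\<^sub>C \<gamma>) (\<beta> + (-\<i>) *\<^sub>C \<gamma>)"
    by (rule polarization) (simp_all add: \<Phi>_def wedge_list_append wedge_add_left wedge_add_right cnj_form_wedge
        cnj_form_add cnj_form_scaleC wedge_scaleC_left wedge_scaleC_right)
  also have "\<dots> \<in> ?S"
    by (intro complex_vector.span_add complex_vector.span_scale diag')
  finally have "(1/4) *\<^sub>C 4 *\<^sub>C \<Phi> \<beta> \<gamma> \<in> ?S" by (rule complex_vector.span_scale)
  then show ?case by (simp add: \<Phi>_def scaleC_scaleC)
qed

lemma forms_subset_span_hermitian_squares: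
  "forms W p p \<subseteq> complex_vector.span (hermitian_square p ` decomposable W p)"
  unfolding forms_eq
proof (rule complex_vector.span_minimal)
  show "{wedge_list \<beta>s \<and>\<^sub>\<Lambda> cnj_form (wedge_list \<gamma>s) |\<beta>s \<gamma>s. length \<beta>s = p \<and> set \<beta>s \<subseteq> covectors W \<and>
      length \<gamma>s = p \<and> set \<gamma>s \<subseteq> covectors W} \<subseteq> complex_vector.span (hermitian_square p ` decomposable W p)"
    using wedge_cnj_in_span_hermitian_squares[of _ _ "[]" W p] by auto
qed (rule complex_vector.subspace_span)

lemma wedge_in_span:
  assumes "\<omega> \<in> complex_vector.span A" "\<zeta> \<in> complex_vector.span B"
    and AB: "\<And>a b. a \<in> A \<Longrightarrow> b \<in> B \<Longrightarrow> a \<and>\<^sub>\<Lambda> b \<in> complex_vector.span S"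
  shows "\<omega> \<and>\<^sub>\<Lambda> \<zeta> \<in> complex_vector.span S"
  using assms(1)
proof (induction rule: form_span_induct)
  case (base a)
  show ?case
    using assms(2)
    by (induction rule: form_span_induct)
      (simp_all add: AB base wedge_add_right wedge_scaleC_right complex_vector.span_add
        complex_vector.span_scale complex_vector.span_zero)
qed (simp_all add: wedge_add_left wedge_scaleC_left complex_vector.span_add complex_vector.span_scale
    complex_vector.span_zero)

lemma wedge_list_in_span:
  assumes "set \<beta>s \<subseteq> complex_vector.span B"
  shows "wedge_list \<beta>s \<in> complex_vector.span (wedge_list ` {cs. set cs \<subseteq> B \<and> length cs = length \<beta>s})"
  using assms
proof (induction \<beta>s)
  case Nil
  then show ?case by (auto intro!: complex_vector.span_base)
next
  case (Cons \<beta> \<beta>s)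
  have "\<beta> \<and>\<^sub>\<Lambda> wedge_list \<beta>s \<in>
      complex_vector.span (wedge_list ` {cs. set cs \<subseteq> B \<and> length cs = Suc (length \<beta>s)})"
  proof (rule wedge_in_span)
    show "\<beta> \<in> complex_vector.span B" using Cons.prems by simp
    show "wedge_list \<beta>s \<in> complex_vector.span (wedge_list ` {cs. set cs \<subseteq> B \<and> length cs = length \<beta>s})"
      using Cons by simp
    fix a b assume "a \<in> B" "b \<in> wedge_list ` {cs. set cs \<subseteq> B \<and> length cs = length \<beta>s}"
    then obtain cs where "set cs \<subseteq> B" "length cs = length \<beta>s" "b = wedge_list cs" by blast
    with \<open>a \<in> B\<close> show "a \<and>\<^sub>\<Lambda> b \<in> complex_vector.span (wedge_list ` {cs. set cs \<subseteq> B \<and> length cs = Suc (length \<beta>s)})"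
      by (intro complex_vector.span_base image_eqI[of _ _ "a # cs"]) simp_all
  qed
  then show ?case by simp
qed

text \<open>
  Expanding every factor in the coframe leaves finitely many products.
\<close>

lemma forms_finite_dimensional:
  assumes "coframe W bs"
  shows "\<exists>A. finite A \<and> forms W p q \<subseteq> complex_vector.span A"
proof -
  define L where "L k = wedge_list ` {cs. set cs \<subseteq> set bs \<and> length cs = k}" for k
  define A where "A = (\<lambda>(a, b). a \<and>\<^sub>\<Lambda> cnj_form b) ` (L p \<times> L q)"
  have "finite (L k)" for k unfolding L_def by (intro finite_imageI finite_lists_length_eq) simp
  then have "finite A" by (simp add: A_def)
  have list: "wedge_list \<beta>s \<in> complex_vector.span (L (length \<beta>s))" if "set \<beta>s \<subseteq> covectors W" for \<beta>s
    using wedge_list_in_span[of \<beta>s "set bs"] that assms by (simp add: coframe_def L_def)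
  have cnj: "cnj_form x \<in> complex_vector.span (cnj_form ` B)" if "x \<in> complex_vector.span B" for x and B :: "'a form set"
    using that
    by (induction rule: form_span_induct)
      (auto simp: cnj_form_add cnj_form_scaleC intro: complex_vector.span_base complex_vector.span_add
        complex_vector.span_scale complex_vector.span_zero)
  have "wedge_list \<beta>s \<and>\<^sub>\<Lambda> cnj_form (wedge_list \<gamma>s) \<in> complex_vector.span A"
    if "length \<beta>s = p" "set \<beta>s \<subseteq> covectors W" "length \<gamma>s = q" "set \<gamma>s \<subseteq> covectors W" for \<beta>s \<gamma>s
  proof (rule wedge_in_span)
    show "wedge_list \<beta>s \<in> complex_vector.span (L p)" using list that by blast
    show "cnj_form (wedge_list \<gamma>s) \<in> complex_vector.span (cnj_form ` L q)" using cnj list that by blast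
    show "a \<and>\<^sub>\<Lambda> b \<in> complex_vector.span A" if "a \<in> L p" "b \<in> cnj_form ` L q" for a b
      using that unfolding A_def by (auto intro!: complex_vector.span_base)
  qed
  then have "forms W p q \<subseteq> complex_vector.span A"
    unfolding forms_eq by (intro complex_vector.span_minimal complex_vector.subspace_span) blast
  with \<open>finite A\<close> show ?thesis by blast
qed

lemma finite_hermitian_square_generators:
  assumes "coframe W bs"
  shows "\<exists>B. finite B \<and> B \<subseteq> hermitian_square p ` decomposable W p \<and> forms W p p \<subseteq> complex_vector.span B"
proof -
  let ?G = "hermitian_square p ` decomposable W p"
  obtain A where A: "finite A" "forms W p p \<subseteq> complex_vector.span A"
    using forms_finite_dimensional[OF assms] by blast
  obtain B where B: "B \<subseteq> ?G" "complex_vector.independent B" "?G \<subseteq> complex_vector.span B"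
    by (rule complex_vector.maximal_independent_subset)
  have "?G \<subseteq> forms W p p" using hermitian_square_real_forms real_formsD(1) by blast
  then have "B \<subseteq> complex_vector.span A" using A(2) B(1) by blast
  then have "finite B" using complex_vector.independent_span_bound[OF A(1) B(2)] by blast
  moreover have "complex_vector.span ?G \<subseteq> complex_vector.span B"
    using B(3) by (rule complex_vector.span_minimal) (rule complex_vector.subspace_span)
  then have "forms W p p \<subseteq> complex_vector.span B"
    using forms_subset_span_hermitian_squares by blast
  ultimately show ?thesis using B(1) by blast
qed

section \<open>Interiors\<close>

lemma continuous_eval: "continuous_on UNIV (\<lambda>\<omega> :: 'v form. \<omega> vs)"
  by (rule continuous_on_product_coordinates)

lemma continuous_formI:
  fixes f :: "'a::topological_space \<Rightarrow> 'v form"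
  shows "(\<And>vs. continuous_on UNIV (\<lambda>x. f x vs)) \<Longrightarrow> continuous_on UNIV f"
  by (rule continuous_on_coordinatewise_then_product)

text \<open>
  A spanning set is built up one element at a time. If the new element \<open>b\<close> is
  independent of the old ones, its remainder \<open>r b\<close> after subtracting its old
  coordinates is non-zero at some list \<open>vs\<close>, and evaluation at this list yields the
  coordinate of \<open>b\<close>. Thus all coordinates are combinations of point evaluations,
  which are continuous for pointwise convergence.
\<close>

lemma continuous_coordinates:
  fixes B :: "'v form set"
  assumes "finite B"
  shows "\<exists>c :: 'v form \<Rightarrow> 'v form \<Rightarrow> complex. (\<forall>b. continuous_on UNIV (c b)) \<and>
    (\<forall>b x y s. c b (x + s *\<^sub>C y) = c b x + s * c b y) \<and>
    (\<forall>\<omega>\<in>complex_vector.span B. \<omega> = (\<Sum>b\<in>B. c b \<omega> *\<^sub>C b))"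
  using assms
proof (induction B)
  case empty
  show ?case by (rule exI[of _ "\<lambda>_ _. 0"]) simp
next
  case (insert b B)
  then obtain c :: "'v form \<Rightarrow> 'v form \<Rightarrow> complex" where cont: "\<And>b. continuous_on UNIV (c b)"
    and lin: "\<And>b x y s. c b (x + s *\<^sub>C y) = c b x + s * c b y"
    and coord: "\<And>\<omega>. \<omega> \<in> complex_vector.span B \<Longrightarrow> \<omega> = (\<Sum>b\<in>B. c b \<omega> *\<^sub>C b)" by blast
  define r where "r \<omega> = \<omega> - (\<Sum>b\<in>B. c b \<omega> *\<^sub>C b)" for \<omega>
  have r_lin: "r (x + s *\<^sub>C y) = r x + s *\<^sub>C r y" for x y s
    by (simp add: r_def lin scaleC_add_left sum.distrib complex_vector.scale_sum_right
        complex_vector.scale_right_diff_distrib scaleC_scaleC)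
  have r_0: "r \<omega> = 0" if "\<omega> \<in> complex_vector.span B" for \<omega> using coord[OF that] by (simp add: r_def)
  show ?case
  proof (cases "r b = 0")
    case True
    then have "b = (\<Sum>b'\<in>B. c b' b *\<^sub>C b')" by (simp add: r_def)
    also have "\<dots> \<in> complex_vector.span B"
      by (intro complex_vector.span_sum complex_vector.span_scale complex_vector.span_base)
    finally have "complex_vector.span (insert b B) = complex_vector.span B"
      by (rule complex_vector.span_redundant)
    moreover have "(\<Sum>b'\<in>B. (if b' = b then 0 else c b' \<omega>) *\<^sub>C b') = (\<Sum>b'\<in>B. c b' \<omega> *\<^sub>C b')" for \<omega>
      by (rule sum.cong) (use insert.hyps(2) in auto)
    moreover have "continuous_on UNIV (\<lambda>\<omega>. if b' = b then 0 else c b' \<omega>)" for b'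
      using cont by (cases "b' = b") simp_all
    ultimately show ?thesis
      using insert.hyps lin coord by (intro exI[of _ "\<lambda>b' \<omega>. if b' = b then 0 else c b' \<omega>"]) simp
  next
    case False
    then obtain vs where vs: "r b vs \<noteq> 0" by (auto simp: fun_eq_iff form_apply)
    define t where "t \<omega> = r \<omega> vs / r b vs" for \<omega>
    have t_lin: "t (x + s *\<^sub>C y) = t x + s * t y" for x y s
      by (simp add: t_def r_lin form_apply add_divide_distrib)
    have t_span: "t \<omega> = s" if "\<omega> - s *\<^sub>C b \<in> complex_vector.span B" for \<omega> s
    proof -
      have "\<omega> = (\<omega> - s *\<^sub>C b) + s *\<^sub>C b" by simp
      then have "r \<omega> = s *\<^sub>C r b" using r_lin[of "\<omega> - s *\<^sub>C b" s b] r_0[OF that] by simp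
      then show ?thesis using vs by (simp add: t_def form_apply)
    qed
    have t_cont: "continuous_on UNIV t"
      unfolding t_def r_def form_apply form_sum_apply
      by (intro continuous_intros continuous_eval cont) (use vs in \<open>simp add: r_def form_apply form_sum_apply\<close>)
    \<comment> \<open>The old coordinates are applied to what is left after removing the multiple of \<open>b\<close>.\<close>
    define c' where "c' b' \<omega> = (if b' = b then t \<omega> else c b' (\<omega> + (- t \<omega>) *\<^sub>C b))" for b' \<omega>
    have "continuous_on UNIV (c' b')" for b'
    proof (cases "b' = b")
      case True
      then show ?thesis using t_cont by (simp add: c'_def[abs_def])
    next
      case False
      have "continuous_on UNIV (\<lambda>\<omega>. \<omega> + (- t \<omega>) *\<^sub>C b)"
        unfolding plus_fun_def scaleC_fun_def scaleC_complex_def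
        by (rule continuous_formI) (intro continuous_intros continuous_eval t_cont)
      from continuous_on_compose2[OF cont this] False show ?thesis by (simp add: c'_def[abs_def])
    qed
    moreover have "c' b' (x + s *\<^sub>C y) = c' b' x + s * c' b' y" for b' x y s
    proof -
      have "x + s *\<^sub>C y + (- t (x + s *\<^sub>C y)) *\<^sub>C b = (x + (- t x) *\<^sub>C b) + s *\<^sub>C (y + (- t y) *\<^sub>C b)"
        by (simp add: t_lin fun_eq_iff form_apply algebra_simps)
      then show ?thesis by (simp only: c'_def t_lin lin if_distrib split: if_split) simp
    qed
    moreover have "\<omega> = (\<Sum>b'\<in>insert b B. c' b' \<omega> *\<^sub>C b')" if \<omega>: "\<omega> \<in> complex_vector.span (insert b B)" for \<omega>
    proof -
      obtain s where s: "\<omega> - s *\<^sub>C b \<in> complex_vector.span B"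
        using \<omega> unfolding complex_vector.span_breakdown_eq by blast
      have "(\<Sum>b'\<in>B. c' b' \<omega> *\<^sub>C b') = (\<Sum>b'\<in>B. c b' (\<omega> - s *\<^sub>C b) *\<^sub>C b')"
        by (rule sum.cong) (use insert.hyps(2) t_span[OF s] in \<open>auto simp: c'_def\<close>)
      also have "\<dots> = \<omega> - s *\<^sub>C b" using coord[OF s] by simp
      finally show ?thesis using insert.hyps t_span[OF s] by (simp add: c'_def)
    qed
    ultimately show ?thesis by blast
  qed
qed

lemma interior_cone_iff:
  "\<Omega> \<in> interior_cone C W p \<longleftrightarrow>
    (\<exists>U. open U \<and> \<Omega> \<in> U \<and> \<Omega> \<in> real_forms W p \<and> U \<inter> real_forms W p \<subseteq> C W p)"
  unfolding interior_cone_def interior_of_def openin_open by auto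

text \<open>
  The sum \<open>E\<close> of finitely many strongly positive generators of all
  \<open>(p,p)\<close>-forms is interior: a real form near \<open>E\<close> differs from it by a
  combination of the generators with small coefficients, which may be replaced by their real parts
  because the generators are real. All coefficients of their sum stay positive.
\<close>

lemma SP_interior_nonempty:
  assumes "coframe W bs" shows "\<exists>\<Omega>. \<Omega> \<in> interior_cone SP W p"
proof -
  obtain B where B: "finite B" "B \<subseteq> hermitian_square p ` decomposable W p" "forms W p p \<subseteq> complex_vector.span B"
    using finite_hermitian_square_generators[OF assms] by blast
  obtain c :: "'a form \<Rightarrow> 'a form \<Rightarrow> complex" where cont: "\<And>b. continuous_on UNIV (c b)"
    and lin: "\<And>b x y s. c b (x + s *\<^sub>C y) = c b x + s * c b y"
    and coord: "\<And>\<omega>. \<omega> \<in> complex_vector.span B \<Longrightarrow> \<omega> = (\<Sum>b\<in>B. c b \<omega> *\<^sub>C b)"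
    using continuous_coordinates[OF B(1)] by blast
  have SP: "b \<in> SP W p" if "b \<in> B" for b using that B(2) hermitian_square_SP by blast
  have real: "cnj (b vs) = b vs" if "b \<in> B" for b vs
    using fun_cong[OF real_formsD(2)[OF SP_real_forms[OF SP[OF that]]], of vs] by (simp add: cnj_form_def)
  have expand: "\<omega> = (\<Sum>b\<in>B. complex_of_real (Re (c b \<omega>)) *\<^sub>C b)" if \<omega>: "\<omega> \<in> real_forms W p" for \<omega>
  proof
    fix vs
    have eq: "\<omega> vs = (\<Sum>b\<in>B. c b \<omega> * b vs)"
      using fun_cong[OF coord, of \<omega> vs] real_formsD(1)[OF \<omega>] B(3) by (auto simp: form_sum_apply form_apply)
    have "b vs = complex_of_real (Re (b vs))" if "b \<in> B" for b
      using real[OF that] by (metis complex_is_Real_iff Reals_cnj_iff of_real_Re)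
    then have re: "Re (c b \<omega> * b vs) = Re (c b \<omega>) * Re (b vs)" if "b \<in> B" for b
      using that by (metis Im_complex_of_real mult_zero_right diff_zero times_complex.sel(1) Re_complex_of_real)
    have "cnj (\<omega> vs) = \<omega> vs" using fun_cong[OF real_formsD(2)[OF \<omega>], of vs] by (simp add: cnj_form_def)
    then have "\<omega> vs = complex_of_real (Re (\<omega> vs))" by (metis Reals_cnj_iff of_real_Re)
    also have "Re (\<omega> vs) = (\<Sum>b\<in>B. Re (c b \<omega>) * Re (b vs))"
      unfolding eq Re_sum by (rule sum.cong) (simp_all only: re)
    also have "complex_of_real \<dots> = (\<Sum>b\<in>B. complex_of_real (Re (c b \<omega>)) * complex_of_real (Re (b vs)))"
      by simp
    also have "\<dots> = (\<Sum>b\<in>B. complex_of_real (Re (c b \<omega>)) * b vs)"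
      using \<open>\<And>b. b \<in> B \<Longrightarrow> b vs = complex_of_real (Re (b vs))\<close> by (intro sum.cong) simp_all
    finally show "\<omega> vs = (\<Sum>b\<in>B. complex_of_real (Re (c b \<omega>)) *\<^sub>C b) vs"
      by (simp add: form_sum_apply form_apply)
  qed
  have SP_sum: "(\<Sum>b\<in>A. complex_of_real (f b) *\<^sub>C b) \<in> SP W p" if "A \<subseteq> B" "\<And>b. b \<in> A \<Longrightarrow> 0 \<le> f b" for A f
    using finite_subset[OF that(1) B(1)] that
    by (induction A rule: finite_induct) (simp_all add: SP_0 SP_add SP_scale SP)
  define E where "E = (\<Sum>b\<in>B. complex_of_real 1 *\<^sub>C b)"
  have E: "E \<in> real_forms W p" unfolding E_def by (intro SP_real_forms SP_sum) auto
  \<comment> \<open>On \<open>U\<close> the coefficients \<open>1 + Re (\<dots>)\<close> of the generators are positive.\<close>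
  define U where "U = (\<Inter>b\<in>B. {\<omega>. - 1 < Re (c b (\<omega> + (-1) *\<^sub>C E))})"
  have "open {\<omega>. - 1 < Re (c b (\<omega> + (-1) *\<^sub>C E))}" for b
    unfolding lin by (intro open_Collect_less continuous_intros cont)
  then have "open U" unfolding U_def using B(1) by (intro open_INT) auto
  moreover have "c b (E + (-1) *\<^sub>C E) = 0" for b by (simp only: lin) simp
  then have "E \<in> U" by (simp add: U_def)
  moreover have "\<omega> \<in> SP W p" if \<omega>: "\<omega> \<in> U" "\<omega> \<in> real_forms W p" for \<omega>
  proof -
    have "\<omega> + (-1) *\<^sub>C E \<in> real_forms W p"
      using real_forms_diff[OF \<omega>(2) E] by simp
    from expand[OF this] have "\<omega> = E + (\<Sum>b\<in>B. complex_of_real (Re (c b (\<omega> + (-1) *\<^sub>C E))) *\<^sub>C b)"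
      by (simp add: algebra_simps)
    also have "\<dots> = (\<Sum>b\<in>B. complex_of_real (1 + Re (c b (\<omega> + (-1) *\<^sub>C E))) *\<^sub>C b)"
      unfolding E_def by (simp only: of_real_add scaleC_add_left sum.distrib)
    also have "\<dots> \<in> SP W p"
      by (intro SP_sum subset_refl) (use \<omega>(1) in \<open>auto simp: U_def intro: less_imp_le\<close>)
    finally show ?thesis .
  qed
  ultimately show ?thesis using E unfolding interior_cone_iff by blast
qed

lemma interior_cone_mono:
  "C W p \<subseteq> D W p \<Longrightarrow> \<Omega> \<in> interior_cone C W p \<Longrightarrow> \<Omega> \<in> interior_cone D W p"
  unfolding interior_cone_iff by blast

text \<open>
  The map \<open>L\<close> moves the point \<open>\<Omega>\<close> of the first cone inside its
  space when \<open>\<xi>\<close> is moved. If the moved points that remain in the first cone come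
  from points of the second cone, then interiority of \<open>\<Omega>\<close> is inherited by
  \<open>\<xi>\<close>.
\<close>

lemma interior_cone_pull:
  fixes L :: "'w::complex_vector form \<Rightarrow> 'v::complex_vector form"
  assumes "\<Omega> \<in> interior_cone C W p" "\<xi> \<in> real_forms W' q" "continuous_on UNIV L"
    and "L 0 = 0" "\<And>\<zeta>. \<zeta> \<in> real_forms W' q \<Longrightarrow> L \<zeta> \<in> real_forms W p"
    and "\<And>\<zeta>. \<zeta> \<in> real_forms W' q \<Longrightarrow> \<Omega> + L (\<zeta> - \<xi>) \<in> C W p \<Longrightarrow> \<zeta> \<in> D W' q"
  shows "\<xi> \<in> interior_cone D W' q"
proof -
  obtain U where U: "open U" "\<Omega> \<in> U" "\<Omega> \<in> real_forms W p" "U \<inter> real_forms W p \<subseteq> C W p"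
    using assms(1) unfolding interior_cone_iff by blast
  let ?f = "\<lambda>\<zeta>. \<Omega> + L (\<zeta> - \<xi>)"
  have diff: "continuous_on UNIV (\<lambda>\<zeta>. \<zeta> - \<xi>)"
    by (rule continuous_formI) (simp only: form_apply, intro continuous_intros continuous_eval)
  have "continuous_on UNIV (\<lambda>\<zeta>. L (\<zeta> - \<xi>) vs)" for vs
    using continuous_on_compose2[OF continuous_eval continuous_on_compose2[OF assms(3) diff]] by simp
  then have "continuous_on UNIV ?f"
    by (intro continuous_formI) (simp only: form_apply, intro continuous_intros)
  then have "open (?f -` U)" using U(1) by (simp add: continuous_on_open_vimage)
  moreover have "\<zeta> \<in> D W' q" if "\<zeta> \<in> ?f -` U" "\<zeta> \<in> real_forms W' q" for \<zeta>
  proof (rule assms(6)[OF that(2)])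
    have "?f \<zeta> \<in> real_forms W p"
      by (intro real_forms_add U(3) assms(5) real_forms_diff that(2) assms(2))
    then show "?f \<zeta> \<in> C W p" using that(1) U(4) by blast
  qed
  moreover have "\<xi> \<in> ?f -` U" using U(2) assms(4) by simp
  ultimately show ?thesis unfolding interior_cone_iff using assms(2) by blast
qed

lemma interior_cone_translate:
  assumes \<Omega>: "\<Omega> \<in> interior_cone C W p" and "\<zeta> \<in> real_forms W p"
    and translate: "\<And>\<omega>. \<omega> \<in> C W p \<Longrightarrow> \<omega> + \<zeta> \<in> C W p"
  shows "\<Omega> + \<zeta> \<in> interior_cone C W p"
proof (rule interior_cone_pull[OF \<Omega> _ continuous_on_id])
  show "\<Omega> + \<zeta> \<in> real_forms W p"
    using \<Omega> assms(2) unfolding interior_cone_iff by (blast intro: real_forms_add)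
  show "\<omega> \<in> C W p" if "\<Omega> + (\<omega> - (\<Omega> + \<zeta>)) \<in> C W p" for \<omega>
    using translate[OF that] by simp
qed simp_all

lemma interior_cone_scale:
  assumes \<Omega>: "\<Omega> \<in> interior_cone C W p" and "0 < r"
    and scale: "\<And>\<omega>. \<omega> \<in> C W p \<Longrightarrow> complex_of_real r *\<^sub>C \<omega> \<in> C W p"
  shows "complex_of_real r *\<^sub>C \<Omega> \<in> interior_cone C W p"
proof (rule interior_cone_pull[OF \<Omega>, where L = "\<lambda>\<omega>. complex_of_real (1 / r) *\<^sub>C \<omega>"])
  show "complex_of_real r *\<^sub>C \<Omega> \<in> real_forms W p"
    using \<Omega> unfolding interior_cone_iff by (blast intro: real_forms_scale)
  show "continuous_on UNIV (\<lambda>\<omega> :: 'a form. complex_of_real (1 / r) *\<^sub>C \<omega>)"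
    by (rule continuous_formI) (simp only: form_apply, intro continuous_intros continuous_eval)
  show "\<omega> \<in> C W p"
    if "\<Omega> + complex_of_real (1 / r) *\<^sub>C (\<omega> - complex_of_real r *\<^sub>C \<Omega>) \<in> C W p" for \<omega>
    using scale[OF that] assms(2)
    by (simp add: complex_vector.scale_right_diff_distrib scaleC_add_right scaleC_scaleC)
qed (simp_all add: real_forms_scale del: of_real_divide)

lemma interior_cone_absorbs:
  assumes "\<Omega> \<in> interior_cone C W p" "\<zeta> \<in> real_forms W p"
  shows "\<exists>e>0. \<forall>r. 0 \<le> r \<and> r < e \<longrightarrow> \<Omega> - complex_of_real r *\<^sub>C \<zeta> \<in> C W p"
proof -
  obtain U where U: "open U" "\<Omega> \<in> U" "\<Omega> \<in> real_forms W p" "U \<inter> real_forms W p \<subseteq> C W p"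
    using assms(1) unfolding interior_cone_iff by blast
  let ?f = "\<lambda>r. \<Omega> - complex_of_real r *\<^sub>C \<zeta>"
  have "continuous_on UNIV ?f"
    by (rule continuous_formI) (simp only: form_apply, intro continuous_intros)
  then have "open (?f -` U)" using U(1) by (simp add: continuous_on_open_vimage)
  moreover have "0 \<in> ?f -` U" using U(2) by simp
  ultimately obtain e where e: "e > 0" "ball 0 e \<subseteq> ?f -` U" by (meson openE)
  have "?f r \<in> C W p" if "0 \<le> r" "r < e" for r
  proof -
    have "r \<in> ball 0 e" using that by (simp add: dist_real_def)
    then have "?f r \<in> U" using e(2) by blast
    moreover have "?f r \<in> real_forms W p" using U(3) assms(2) by (intro real_forms_diff real_forms_scale)
    ultimately show ?thesis using U(4) by blast
  qed
  then show ?thesis using e(1) by blast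
qed

context hyperplane_splitting
begin

lemma continuous_rho: "continuous_on UNIV rho"
  unfolding immersion_def by (rule continuous_formI) (rule continuous_eval)

lemma continuous_wedge_right: "continuous_on UNIV (\<lambda>\<zeta> :: 'b form. \<omega> \<and>\<^sub>\<Lambda> \<zeta>)"
  by (rule continuous_formI) (unfold wedge_def, intro continuous_intros continuous_eval)

lemma continuous_volume_wedge: "continuous_on UNIV (\<lambda>\<theta>. \<i> *\<^sub>C (volume_lift \<theta>))"
proof -
  have "continuous_on UNIV (\<lambda>\<theta>. volume_lift \<theta>)"
    by (rule continuous_on_compose2[OF continuous_wedge_right
          continuous_on_compose2[OF continuous_wedge_right continuous_rho]]) simp_all
  from continuous_on_compose2[OF continuous_eval this] show ?thesis
    by (intro continuous_formI) (simp only: form_apply, intro continuous_intros, simp)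
qed

lemma splits_add_horizontal:
  assumes "splits v0 h \<alpha> p \<Omega> \<Xi> \<eta> \<theta>" "\<zeta> \<in> forms h p p"
  shows "splits v0 h \<alpha> p (\<Omega> + rho \<zeta>) (\<Xi> + \<zeta>) \<eta> \<theta>"
  using assms by (simp add: splits_def forms_add rho_add algebra_simps)

lemma splits_add_volume:
  assumes "splits v0 h \<alpha> p \<Omega> \<Xi> \<eta> \<theta>" "\<zeta> \<in> forms h (p - 1) (p - 1)"
  shows "splits v0 h \<alpha> p (\<Omega> + \<i> *\<^sub>C (volume_lift \<zeta>)) \<Xi> \<eta> (\<theta> + \<zeta>)"
  using assms by (simp add: splits_def forms_add rho_add wedge_add_right scaleC_add_right add.assoc)

text \<open>
  The immersion and the product with \<open>\<i> *\<^sub>C (\<alpha> \<and>\<^sub>\<Lambda>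
  cnj_form \<alpha>)\<close> are continuous right inverses of the two projections to the outer
  parts, so that these projections are open.
\<close>

lemma interior_components:
  assumes C: "C \<in> {SP, HP, WP}" "Suc k \<le> m" and s: "splits v0 h \<alpha> (Suc k) \<Omega> \<Xi> \<eta> \<theta>"
    and \<Omega>: "\<Omega> \<in> interior_cone C UNIV (Suc k)"
  shows "\<Xi> \<in> interior_cone C h (Suc k) \<and> \<theta> \<in> interior_cone C h k"
proof
  have "\<Omega> \<in> real_forms UNIV (Suc k)" using \<Omega> unfolding interior_cone_iff by blast
  note real = splits_real[OF s this]
  show "\<Xi> \<in> interior_cone C h (Suc k)"
  proof (rule interior_cone_pull[OF \<Omega> real(1) continuous_rho rho_0 rho_real_forms])
    fix \<zeta> assume \<zeta>: "\<zeta> \<in> real_forms h (Suc k)" "\<Omega> + rho (\<zeta> - \<Xi>) \<in> C UNIV (Suc k)"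
    have "splits v0 h \<alpha> (Suc k) (\<Omega> + rho (\<zeta> - \<Xi>)) \<zeta> \<eta> \<theta>"
      using splits_add_horizontal[OF s real_formsD(1)[OF real_forms_diff[OF \<zeta>(1) real(1)]]] by simp
    then show "\<zeta> \<in> C h (Suc k)" using cone_components[OF C _ \<zeta>(2)] by blast
  qed
  show "\<theta> \<in> interior_cone C h k"
  proof (rule interior_cone_pull[OF \<Omega> real(2) continuous_volume_wedge _ volume_wedge_real_forms])
    fix \<zeta> assume \<zeta>: "\<zeta> \<in> real_forms h k"
      "\<Omega> + \<i> *\<^sub>C (volume_lift (\<zeta> - \<theta>)) \<in> C UNIV (Suc k)"
    have "splits v0 h \<alpha> (Suc k) (\<Omega> + \<i> *\<^sub>C (volume_lift (\<zeta> - \<theta>))) \<Xi> \<eta> \<zeta>"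
      using splits_add_volume[OF s, of "\<zeta> - \<theta>"] real_formsD(1)[OF real_forms_diff[OF \<zeta>(1) real(2)]] by simp
    then show "\<zeta> \<in> C h k" using cone_components[OF C _ \<zeta>(2)] by blast
  qed simp
qed

text \<open>
  The linear reflection that negates \<open>v0\<close> and fixes the kernel of
  \<open>\<alpha>\<close>; it negates \<open>\<alpha>\<close> and fixes all immersed forms.
\<close>

definition reflection :: "'a \<Rightarrow> 'a"
  where "reflection v = v + (- 2 * \<alpha> [v] / \<alpha> [v0]) *\<^sub>C v0"

lemma reflection_linear: "complex_linear_on UNIV reflection UNIV"
proof -
  have "reflection (x + y) = reflection x + reflection y" for x y
  proof -
    have "- 2 * \<alpha> [x + y] / \<alpha> [v0] = (- 2 * \<alpha> [x] / \<alpha> [v0]) + (- 2 * \<alpha> [y] / \<alpha> [v0])"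
      by (simp only: \<alpha>_add distrib_left add_divide_distrib)
    then show ?thesis
      by (simp only: reflection_def scaleC_add_left add.assoc add.left_commute)
  qed
  moreover have "reflection (c *\<^sub>C x) = c *\<^sub>C reflection x" for c x
  proof -
    have "- 2 * \<alpha> [c *\<^sub>C x] / \<alpha> [v0] = c * (- 2 * \<alpha> [x] / \<alpha> [v0])"
      by (simp only: \<alpha>_scaleC) simp
    then show ?thesis
      by (simp only: reflection_def scaleC_add_right scaleC_scaleC)
  qed
  ultimately show ?thesis by (simp only: complex_linear_on_def subset_UNIV simp_thms ball_simps)
qed

lemma reflection_rho: "pull_back UNIV reflection (rho \<omega>) = rho \<omega>"
proof -
  have "proj (reflection v) = proj v" for v
    unfolding reflection_def proj_add proj_v0 by simp
  then show ?thesis by (simp add: pull_back_def immersion_def comp_def)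
qed

lemma reflection_\<alpha>: "pull_back UNIV reflection \<alpha> = - \<alpha>"
proof
  fix vs
  have "\<alpha> [reflection v] = - \<alpha> [v]" for v
    unfolding reflection_def \<alpha>_add \<alpha>_scaleC using \<alpha>_v0 by simp
  then show "pull_back UNIV reflection \<alpha> vs = (- \<alpha>) vs"
    by (cases "length vs = 1") (auto simp: pull_back_def form_apply length_Suc_conv \<alpha>_other)
qed

text \<open>
  Adding to an interior point its image under the reflection cancels the mixed part, and the sum
  remains interior because the reflected form is again strongly positive.
\<close>

lemma interior_SP_without_mixed_part:
  shows "\<exists>\<Omega> \<Xi> \<theta>. \<Omega> \<in> interior_cone SP UNIV (Suc k) \<and> splits v0 h \<alpha> (Suc k) \<Omega> \<Xi> 0 \<theta>"
proof -
  obtain bs where "coframe h bs" using h_coframe by blast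
  from SP_interior_nonempty[OF coframe_lift[OF this], of "Suc k"]
  obtain \<Omega> :: "'a form" where \<Omega>: "\<Omega> \<in> interior_cone SP UNIV (Suc k)" ..
  then have "\<Omega> \<in> SP UNIV (Suc k)" unfolding interior_cone_iff by blast
  then have g: "pull_back UNIV reflection \<Omega> \<in> SP UNIV (Suc k)"
    by (rule pull_back_SP[OF reflection_linear complex_vector.subspace_UNIV])
  obtain \<Xi> \<eta> \<theta> where s: "splits v0 h \<alpha> (Suc k) \<Omega> \<Xi> \<eta> \<theta>"
    using splits_exists SP_real_forms[OF \<open>\<Omega> \<in> SP UNIV (Suc k)\<close>] by blast
  then have \<Omega>_eq: "\<Omega> = rho \<Xi> + \<alpha> \<and>\<^sub>\<Lambda> rho \<eta> + cnj_form \<alpha> \<and>\<^sub>\<Lambda> cnj_form (rho \<eta>)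
      + \<i> *\<^sub>C (volume_lift \<theta>)" by (simp add: splits_def)
  have "cnj_form (- \<alpha>) = - cnj_form \<alpha>" by (simp add: cnj_form_def fun_eq_iff form_apply)
  then have g_eq: "pull_back UNIV reflection \<Omega> = rho \<Xi> + - (\<alpha> \<and>\<^sub>\<Lambda> rho \<eta>) + - (cnj_form \<alpha> \<and>\<^sub>\<Lambda> cnj_form (rho \<eta>))
      + \<i> *\<^sub>C (volume_lift \<theta>)"
    unfolding \<Omega>_eq by (simp add: pull_back_add pull_back_scaleC pull_back_wedge pull_back_cnj_form
        reflection_rho reflection_\<alpha> wedge_minus_left wedge_minus_right)
  have "\<Omega> + pull_back UNIV reflection \<Omega> = (rho \<Xi> + rho \<Xi>)
      + (\<i> *\<^sub>C (volume_lift \<theta>) + \<i> *\<^sub>C (volume_lift \<theta>))"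
    unfolding g_eq unfolding \<Omega>_eq by (simp add: fun_eq_iff form_apply)
  also have "\<dots> = rho (\<Xi> + \<Xi>) + \<i> *\<^sub>C (volume_lift (\<theta> + \<theta>))"
    by (simp only: rho_add wedge_add_right scaleC_add_right)
  finally have sum: "\<Omega> + pull_back UNIV reflection \<Omega> = rho (\<Xi> + \<Xi>) + \<i> *\<^sub>C (volume_lift (\<theta> + \<theta>))" .
  have "\<Xi> + \<Xi> \<in> forms h (Suc k) (Suc k)" "\<theta> + \<theta> \<in> forms h k k"
    using s by (simp_all only: splits_def forms_add diff_Suc_1)
  then have "splits v0 h \<alpha> (Suc k) (\<Omega> + pull_back UNIV reflection \<Omega>) (\<Xi> + \<Xi>) 0 (\<theta> + \<theta>)"
    unfolding splits_def sum by (simp add: forms_0 del: mult_2[symmetric])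
  moreover have "\<Omega> + pull_back UNIV reflection \<Omega> \<in> interior_cone SP UNIV (Suc k)"
    by (rule interior_cone_translate[OF \<Omega> SP_real_forms[OF g]]) (rule SP_add[OF _ g])
  ultimately show ?thesis by blast
qed

text \<open>
  The perturbations of \<open>\<Omega>\<close> have a mixed part, so the positivity of the outer
  parts alone does not suffice. A small multiple of an interior point \<open>\<Omega>'\<close>
  without mixed part is therefore split off: it is interior, and the outer parts of the rest stay
  positive because \<open>\<Xi>\<close> and \<open>\<theta>\<close> are interior.
\<close>

lemma interior_combine:
  assumes C: "C \<in> {SP, HP, WP}" "Suc k \<le> m" and s: "splits v0 h \<alpha> (Suc k) \<Omega> \<Xi> 0 \<theta>"
    and \<Omega>: "\<Omega> \<in> real_forms UNIV (Suc k)"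
    and \<Xi>: "\<Xi> \<in> interior_cone C h (Suc k)" and \<theta>: "\<theta> \<in> interior_cone C h k"
  shows "\<Omega> \<in> interior_cone C UNIV (Suc k)"
proof -
  obtain \<Omega>' \<Xi>' \<theta>' where \<Omega>': "\<Omega>' \<in> interior_cone SP UNIV (Suc k)" and s': "splits v0 h \<alpha> (Suc k) \<Omega>' \<Xi>' 0 \<theta>'"
    using interior_SP_without_mixed_part by blast
  have real': "\<Omega>' \<in> real_forms UNIV (Suc k)" using \<Omega>' unfolding interior_cone_iff by blast
  note real = splits_real[OF s' real']
  obtain e1 where e1: "e1 > 0" "\<And>r. 0 \<le> r \<Longrightarrow> r < e1 \<Longrightarrow> \<Xi> - complex_of_real r *\<^sub>C \<Xi>' \<in> C h (Suc k)"
    using interior_cone_absorbs[OF \<Xi> real(1)] by blast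
  obtain e2 where e2: "e2 > 0" "\<And>r. 0 \<le> r \<Longrightarrow> r < e2 \<Longrightarrow> \<theta> - complex_of_real r *\<^sub>C \<theta>' \<in> C h k"
    using interior_cone_absorbs[OF \<theta> real(2)] by blast
  define r where "r = min e1 e2 / 2"
  have r: "0 < r" "r < e1" "r < e2" using e1(1) e2(1) by (auto simp: r_def)
  let ?r = "complex_of_real r"
  have mem: "\<Xi> - ?r *\<^sub>C \<Xi>' \<in> forms h (Suc k) (Suc k)" "\<theta> - ?r *\<^sub>C \<theta>' \<in> forms h k k"
    using e1(2)[of r] e2(2)[of r] r cone_real_forms[OF C(1)] real_formsD(1) by simp_all blast+
  have rho_diff: "rho (x - c *\<^sub>C y) = rho x + (- c) *\<^sub>C rho y" for x y c
    using rho_add[of x "(- c) *\<^sub>C y"] rho_scaleC[of "- c" y] by simp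
  have "splits v0 h \<alpha> (Suc k) (\<Omega> - ?r *\<^sub>C \<Omega>') (\<Xi> - ?r *\<^sub>C \<Xi>') 0 (\<theta> - ?r *\<^sub>C \<theta>')"
  proof -
    have "\<Omega> = rho \<Xi> + \<i> *\<^sub>C (volume_lift \<theta>)" "\<Omega>' = rho \<Xi>' + \<i> *\<^sub>C (volume_lift \<theta>')"
      using s s' by (simp_all add: splits_def)
    then have "\<Omega> + (- ?r) *\<^sub>C \<Omega>' = rho (\<Xi> - ?r *\<^sub>C \<Xi>') + \<i> *\<^sub>C (volume_lift (\<theta> - ?r *\<^sub>C \<theta>'))"
      by (simp only: rho_diff wedge_add_right wedge_scaleC_right scaleC_add_right scaleC_scaleC mult.commute
          add.assoc add.left_commute)
    then show ?thesis using mem by (simp add: splits_def forms_0)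
  qed
  moreover have "\<Omega> - ?r *\<^sub>C \<Omega>' \<in> real_forms UNIV (Suc k)"
    by (intro real_forms_diff real_forms_scale \<Omega> real')
  ultimately have rest: "\<Omega> - ?r *\<^sub>C \<Omega>' \<in> C UNIV (Suc k)"
    using cone_combine[OF C] e1(2)[of r] e2(2)[of r] r by simp
  have "\<Omega>' \<in> interior_cone C UNIV (Suc k)"
    by (rule interior_cone_mono[of SP _ _ C, OF SP_subset_cone[OF C] \<Omega>'])
  then have "?r *\<^sub>C \<Omega>' \<in> interior_cone C UNIV (Suc k)"
    using r(1) cone_scale[OF C(1)] by (intro interior_cone_scale) simp_all
  then have "?r *\<^sub>C \<Omega>' + (\<Omega> - ?r *\<^sub>C \<Omega>') \<in> interior_cone C UNIV (Suc k)"
    by (rule interior_cone_translate) (use rest cone_real_forms[OF C(1)] cone_add[OF C(1)] in blast)+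
  then show ?thesis by simp
qed

end

theorem theorem1:
  fixes h :: "'v::complex_vector set" and v0 :: 'v and n p :: nat and \<alpha> \<Omega> :: "'v form"
  assumes "n \<ge> 2" and "complex_vector.dim (UNIV :: 'v set) = n"
    and "complex_vector.subspace h" and "complex_vector.dim h = n - 1"
    and "v0 \<notin> h"
    and "\<alpha> \<in> forms UNIV 1 0 - immersion v0 h ` forms h 1 0"
    and "1 \<le> p" and "p \<le> n - 1"
    and "\<Omega> \<in> real_forms UNIV p"
  shows "(\<exists>!(\<Xi>, \<eta>, \<theta>). splits v0 h \<alpha> p \<Omega> \<Xi> \<eta> \<theta>) \<and>
    (\<forall>C\<in>{SP, HP, WP}. \<forall>\<Xi> \<eta> \<theta>. splits v0 h \<alpha> p \<Omega> \<Xi> \<eta> \<theta> \<longrightarrow>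
      (\<Omega> \<in> C UNIV p \<longrightarrow> \<Xi> \<in> C h p \<and> \<theta> \<in> C h (p - 1)) \<and>
      (\<Omega> \<in> interior_cone C UNIV p \<longrightarrow>
        \<Xi> \<in> interior_cone C h p \<and> \<theta> \<in> interior_cone C h (p - 1)) \<and>
      (\<eta> = 0 \<longrightarrow>
        (\<Xi> \<in> C h p \<and> \<theta> \<in> C h (p - 1) \<longrightarrow> \<Omega> \<in> C UNIV p) \<and>
        (\<Xi> \<in> interior_cone C h p \<and> \<theta> \<in> interior_cone C h (p - 1) \<longrightarrow>
          \<Omega> \<in> interior_cone C UNIV p)))"
proof -
  obtain k where p: "p = Suc k" using assms(7) by (cases p) auto
  have km: "Suc k \<le> n - 1" using assms(8) p by simp
  interpret complex_hyperplane h v0 "n - 1"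
    by unfold_locales (use assms in simp_all)
  have \<alpha>: "\<alpha> \<in> covectors UNIV" "\<alpha> \<notin> rho ` covectors h"
    using assms(6) unfolding forms_1_0 Diff_iff by simp_all
  have "\<alpha> [v0] \<noteq> 0" using covector_rhoI[OF \<alpha>(1)] \<alpha>(2) by blast
  then interpret hyperplane_splitting h v0 "n - 1" \<alpha>
    by unfold_locales (rule \<alpha>(1))
  have "\<exists>!(\<Xi>, \<eta>, \<theta>). splits v0 h \<alpha> p \<Omega> \<Xi> \<eta> \<theta>"
  proof -
    obtain \<Xi> \<eta> \<theta> where s: "splits v0 h \<alpha> p \<Omega> \<Xi> \<eta> \<theta>"
      using splits_exists assms(9) unfolding p by blast
    show ?thesis
    proof (rule ex1I[of _ "(\<Xi>, \<eta>, \<theta>)"])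
      fix t assume t: "case t of (\<Xi>, \<eta>, \<theta>) \<Rightarrow> splits v0 h \<alpha> p \<Omega> \<Xi> \<eta> \<theta>"
      show "t = (\<Xi>, \<eta>, \<theta>)"
      proof (cases t)
        case (fields X E T)
        with t have "splits v0 h \<alpha> p \<Omega> X E T" by simp
        from splits_unique[OF this s] fields show ?thesis by simp
      qed
    qed (use s in simp)
  qed
  moreover have "(\<Omega> \<in> C UNIV p \<longrightarrow> \<Xi> \<in> C h p \<and> \<theta> \<in> C h (p - 1)) \<and>
      (\<Omega> \<in> interior_cone C UNIV p \<longrightarrow>
        \<Xi> \<in> interior_cone C h p \<and> \<theta> \<in> interior_cone C h (p - 1)) \<and>
      (\<eta> = 0 \<longrightarrow>
        (\<Xi> \<in> C h p \<and> \<theta> \<in> C h (p - 1) \<longrightarrow> \<Omega> \<in> C UNIV p) \<and>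
        (\<Xi> \<in> interior_cone C h p \<and> \<theta> \<in> interior_cone C h (p - 1) \<longrightarrow>
          \<Omega> \<in> interior_cone C UNIV p))"
    if C: "C \<in> {SP, HP, WP}" and "splits v0 h \<alpha> p \<Omega> \<Xi> \<eta> \<theta>" for C \<Xi> \<eta> \<theta>
  proof -
    have s: "splits v0 h \<alpha> (Suc k) \<Omega> \<Xi> \<eta> \<theta>" and real: "\<Omega> \<in> real_forms UNIV (Suc k)"
      using that(2) assms(9) p by simp_all
    have "\<Omega> \<in> C UNIV (Suc k)" if "\<eta> = 0" "\<Xi> \<in> C h (Suc k)" "\<theta> \<in> C h k"
      using cone_combine[OF C km _ real that(2,3)] s that(1) by simp
    moreover have "\<Omega> \<in> interior_cone C UNIV (Suc k)"
      if "\<eta> = 0" "\<Xi> \<in> interior_cone C h (Suc k)" "\<theta> \<in> interior_cone C h k"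
      using interior_combine[OF C km _ real that(2,3)] s that(1) by simp
    ultimately show ?thesis
      using cone_components[OF C km s] interior_components[OF C km s] unfolding p diff_Suc_1 by blast
  qed
  ultimately show ?thesis by blast
qed

end
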